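(* Suppose that $\mathbb G$ is polynomially $k$-saturated for every $k\in\mathbb N$ (and the standing assumptions (A1)–(A4) hold). Then: (i) for every $k\in\mathbb N$, $\lim_{n\to\infty}\delta^{\mathbb K}_n(\{\mathcal M\in\mathbb K_n:\mathcal M\text{ has the }k\text{-extension property}\})=1$ and $\lim_{n\to\infty}\delta^{\mathbb{SK}}_n(\{\mathcal M\in\mathbb{SK}_n:\mathcal M\text{ has the }k\text{-extension property}\})=1$; (ii) for every $L$-sentence $\varphi$, $\delta^{\mathbb K}_n(\{\mathcal M\in\mathbb K_n:\mathcal M\models\varphi\})$ converges to $0$ or $1$, and $\delta^{\mathbb{SK}}_n(\{\mathcal M\in\mathbb{SK}_n:\mathcal M\models\varphi\})$ converges to $0$ or $1$, as $n\to\infty$.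
   Context: Fix $l\ge2$. Vocabularies: $V_{pre}$; $V_{col}=\{P_1,\dots,P_l\}$ unary; $V_{rel}$ finite nonempty with arities $\ge2$; pairwise disjoint; $\rho$ = max arity in $V_{rel}$. $L_{pre},L$ are the languages over $V_{pre}$ and $V_{pre}\cup V_{col}\cup V_{rel}$. Pregeometry $(A,\mathrm{cl})$: reflexivity, monotonicity ($Y\subseteq\mathrm{cl}(X)\Rightarrow\mathrm{cl}(Y)\subseteq\mathrm{cl}(X)$), exchange, finite character; closed sets; $\dim(X)=\min\{|Y|:Y\subseteq X\subseteq\mathrm{cl}(Y)\}$. Fixed $L_{pre}$-formulas $\theta_m(x_1..x_{m+1})$ define $\mathrm{cl}_{\mathcal A}$ in any structure: $a\in\mathrm{cl}(\{b_1..b_m\})$ iff $\theta_m(\bar b,a)$, extended by finite character. $\mathbb G=\{\mathcal G_n\}$ finite $L_{pre}$-structures with $(G_n,\mathrm{cl})$ pregeometries. Closed substructure = substructure with closed universe. Standing assumptions: (A1) $|\mathrm{cl}_{\mathcal G_n}(X)|\le f(\dim X)$ for some $f$, closed subsets are universes of substructures; (A2) closures in closed substructures of $\mathcal G_n$ agree with $\mathrm{cl}_{\mathcal G_n}$; (A3) closed substructures of $\mathcal G_n$ are isomorphic to members of $\mathbb G$, $\dim G_n\to\infty$, substructure on $\mathrm{cl}(\emptyset)$ isomorphic to $\mathcal G_0$; (A4) each $\mathcal G_n$ has a quantifier-free characteristic $L_{pre}$-formula determining it up to isomorphism among structures where the $\theta_m$ define a pregeometry. $\mathcal M$ ($L$-structure)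 with $\mathcal M\restriction L_{pre}=\mathcal G_n$ is $l$-coloured if: $a$ satisfies some $P_i$ iff $a\notin\mathrm{cl}(\emptyset)$; no $R\in V_{rel}$ holds on tuples from $\mathrm{cl}(\emptyset)$; dependent elements outside $\mathrm{cl}(\emptyset)$ do not satisfy different colours; if $R(\bar a)$ holds ($R\in V_{rel}$) some $b,c\in\mathrm{cl}(\bar a)\setminus\mathrm{cl}(\emptyset)$ share no colour. Strongly $l$-coloured: moreover, if $R(\bar a)$ holds, any $b,c\in\mathrm{cl}(\bar a)\setminus\mathrm{cl}(\emptyset)$ with $b\notin\mathrm{cl}(\{c\})$ share no colour. Structures isomorphic to these are also so called. $\mathbb K_n$ ($\mathbb{SK}_n$): $l$-coloured (strongly) $\mathcal M$ with $\mathcal M\restriction L_{pre}=\mathcal G_n$. Measures: $\mathcal M\restriction d$ = $\mathcal M$ with interpretations of $V_{col}\cup V_{rel}$ restricted to tuples of dimension $\le d$; $\mathbb P_{n,0}$ uniform on $\mathbb K_n\restriction0=\{\mathcal M\restriction0:\mathcal M\in\mathbb K_n\}$; $\mathbb P_{n,r}(\mathcal M)=\mathbb P_{n,r-1}(\mathcal M\restriction(r-1))/|\{\mathcal M'\in\mathbb K_n\restriction r:\mathcal M'\restriction(r-1)=\mathcal M\restriction(r-1)\}|$; $\delta^{\mathbb K}_n=\mathbb P_{n,\rho}$; $\delta^{\mathbb{SK}}_n$ analogously on $\mathbb{SK}_n$. Polynomial $k$-saturation: there exist $\lambda_n\to\infty$ and a polynomial $P$ with $\lambda_n\le|G_n|\le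 P(\lambda_n)$ such that whenever $\mathcal A$ is a closed substructure of $\mathcal G_n$ and there are $\mathcal G$ isomorphic to a member of $\mathbb G$ and closed substructures $\mathcal A\subsetneq\mathcal B$ of $\mathcal G$ with $\dim A+1=\dim B\le k$, then $\mathcal G_n$ contains closed substructures $\mathcal B_1,\dots,\mathcal B_{\lambda_n}$ with pairwise intersections exactly $A$, each isomorphic to $\mathcal B$ via an isomorphism fixing $A$ pointwise. Extension property: a (strongly) $l$-coloured $\mathcal M$ has the $\mathcal B/\mathcal A$-extension property (for (strongly) $l$-coloured $\mathcal B$ and closed substructure $\mathcal A$ of it) if every isomorphism from a closed substructure $\mathcal A'$ of $\mathcal M$ onto $\mathcal A$ extends to an isomorphism from a closed substructure $\mathcal B'\supseteq\mathcal A'$ of $\mathcal M$ onto $\mathcal B$; the $k$-extension property means this for all such pairs with $\dim B\le k$. *)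

theory Defs
  imports Complex_Main "HOL-Computational_Algebra.Polynomial"
begin

section \<open>First-order logic\<close>

text \<open>Constants are function symbols of arity 0.\<close>

record ('f, 'r) vocab =
  fsyms :: "'f set"
  farity :: "'f \<Rightarrow> nat"
  rsyms :: "'r set"
  rarity :: "'r \<Rightarrow> nat"

record ('f, 'r, 'a) struct =
  univ :: "'a set"
  fint :: "'f \<Rightarrow> 'a list \<Rightarrow> 'a"
  rint :: "'r \<Rightarrow> 'a list set"

definition tuples :: "'a set \<Rightarrow> nat \<Rightarrow> 'a list set" where
  "tuples X m = {xs. set xs \<subseteq> X \<and> length xs = m}"

text \<open>The universe may be empty: the closure of the empty set, which is the universe of a closed
  substructure, may be empty.  Relation symbols outside the vocabulary are interpreted by the empty
  relation, so that structures that share their function part can be counted literally.\<close>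

definition is_struct :: "('f, 'r) vocab \<Rightarrow> ('f, 'r, 'a) struct \<Rightarrow> bool" where
  "is_struct V M \<longleftrightarrow>
     (\<forall>f \<in> fsyms V. \<forall>xs \<in> tuples (univ M) (farity V f). fint M f xs \<in> univ M) \<and>
     (\<forall>R \<in> rsyms V. rint M R \<subseteq> tuples (univ M) (rarity V R)) \<and>
     (\<forall>R. R \<notin> rsyms V \<longrightarrow> rint M R = {})"

definition substructure ::
  "('f, 'r) vocab \<Rightarrow> ('f, 'r, 'a) struct \<Rightarrow> ('f, 'r, 'a) struct \<Rightarrow> bool" where
  "substructure V A M \<longleftrightarrow> is_struct V A \<and> univ A \<subseteq> univ M \<and>
     (\<forall>f \<in> fsyms V. \<forall>xs \<in> tuples (univ A) (farity V f). fint A f xs = fint M f xs) \<and>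
     (\<forall>R \<in> rsyms V. rint A R = rint M R \<inter> tuples (univ A) (rarity V R))"

definition iso ::
  "('f, 'r) vocab \<Rightarrow> ('a \<Rightarrow> 'b) \<Rightarrow> ('f, 'r, 'a) struct \<Rightarrow> ('f, 'r, 'b) struct \<Rightarrow> bool" where
  "iso V h A B \<longleftrightarrow> bij_betw h (univ A) (univ B) \<and>
     (\<forall>f \<in> fsyms V. \<forall>xs \<in> tuples (univ A) (farity V f).
        h (fint A f xs) = fint B f (map h xs)) \<and>
     (\<forall>R \<in> rsyms V. \<forall>xs \<in> tuples (univ A) (rarity V R).
        xs \<in> rint A R \<longleftrightarrow> map h xs \<in> rint B R)"

definition isomorphic ::
  "('f, 'r) vocab \<Rightarrow> ('f, 'r, 'a) struct \<Rightarrow> ('f, 'r, 'b) struct \<Rightarrow> bool" where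
  "isomorphic V A B \<longleftrightarrow> (\<exists>h. iso V h A B)"

datatype 'f tm = Var nat | Fn 'f "'f tm list"

text \<open>\<open>Falsum\<close> is primitive because a quantifier-free formula without variables need not
  exist otherwise.\<close>

datatype ('f, 'r) fm =
    Falsum
  | Eq "'f tm" "'f tm"
  | Pred 'r "'f tm list"
  | Neg "('f, 'r) fm"
  | And "('f, 'r) fm" "('f, 'r) fm"
  | Exi nat "('f, 'r) fm"

fun wf_tm :: "('f, 'r) vocab \<Rightarrow> 'f tm \<Rightarrow> bool" where
  "wf_tm V (Var i) \<longleftrightarrow> True"
| "wf_tm V (Fn f ts) \<longleftrightarrow> f \<in> fsyms V \<and> length ts = farity V f \<and> (\<forall>t \<in> set ts. wf_tm V t)"

fun wf_fm :: "('f, 'r) vocab \<Rightarrow> ('f, 'r) fm \<Rightarrow> bool" where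
  "wf_fm V Falsum \<longleftrightarrow> True"
| "wf_fm V (Eq s t) \<longleftrightarrow> wf_tm V s \<and> wf_tm V t"
| "wf_fm V (Pred R ts) \<longleftrightarrow> R \<in> rsyms V \<and> length ts = rarity V R \<and> (\<forall>t \<in> set ts. wf_tm V t)"
| "wf_fm V (Neg \<phi>) \<longleftrightarrow> wf_fm V \<phi>"
| "wf_fm V (And \<phi> \<psi>) \<longleftrightarrow> wf_fm V \<phi> \<and> wf_fm V \<psi>"
| "wf_fm V (Exi i \<phi>) \<longleftrightarrow> wf_fm V \<phi>"

fun fv_tm :: "'f tm \<Rightarrow> nat set" where
  "fv_tm (Var i) = {i}"
| "fv_tm (Fn f ts) = (\<Union>t \<in> set ts. fv_tm t)"

fun fv :: "('f, 'r) fm \<Rightarrow> nat set" where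
  "fv Falsum = {}"
| "fv (Eq s t) = fv_tm s \<union> fv_tm t"
| "fv (Pred R ts) = (\<Union>t \<in> set ts. fv_tm t)"
| "fv (Neg \<phi>) = fv \<phi>"
| "fv (And \<phi> \<psi>) = fv \<phi> \<union> fv \<psi>"
| "fv (Exi i \<phi>) = fv \<phi> - {i}"

fun quantifier_free :: "('f, 'r) fm \<Rightarrow> bool" where
  "quantifier_free (Neg \<phi>) \<longleftrightarrow> quantifier_free \<phi>"
| "quantifier_free (And \<phi> \<psi>) \<longleftrightarrow> quantifier_free \<phi> \<and> quantifier_free \<psi>"
| "quantifier_free (Exi i \<phi>) \<longleftrightarrow> False"
| "quantifier_free _ \<longleftrightarrow> True"

fun eval_tm :: "('f, 'r, 'a) struct \<Rightarrow> (nat \<Rightarrow> 'a) \<Rightarrow> 'f tm \<Rightarrow> 'a" where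
  "eval_tm M e (Var i) = e i"
| "eval_tm M e (Fn f ts) = fint M f (map (eval_tm M e) ts)"

fun sat :: "('f, 'r, 'a) struct \<Rightarrow> (nat \<Rightarrow> 'a) \<Rightarrow> ('f, 'r) fm \<Rightarrow> bool" where
  "sat M e Falsum \<longleftrightarrow> False"
| "sat M e (Eq s t) \<longleftrightarrow> eval_tm M e s = eval_tm M e t"
| "sat M e (Pred R ts) \<longleftrightarrow> map (eval_tm M e) ts \<in> rint M R"
| "sat M e (Neg \<phi>) \<longleftrightarrow> \<not> sat M e \<phi>"
| "sat M e (And \<phi> \<psi>) \<longleftrightarrow> sat M e \<phi> \<and> sat M e \<psi>"
| "sat M e (Exi i \<phi>) \<longleftrightarrow> (\<exists>a \<in> univ M. sat M (e(i := a)) \<phi>)"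

text \<open>A list assigns its \<open>i\<close>-th entry to the variable \<open>Var i\<close>; variables are numbered from 0.\<close>

definition holds :: "('f, 'r, 'a) struct \<Rightarrow> ('f, 'r) fm \<Rightarrow> 'a list \<Rightarrow> bool" where
  "holds M \<phi> xs \<longleftrightarrow> sat M (\<lambda>i. xs ! i) \<phi>"

definition sentence :: "('f, 'r) vocab \<Rightarrow> ('f, 'r) fm \<Rightarrow> bool" where
  "sentence V \<phi> \<longleftrightarrow> wf_fm V \<phi> \<and> fv \<phi> = {}"

definition models :: "('f, 'r, 'a) struct \<Rightarrow> ('f, 'r) fm \<Rightarrow> bool" where
  "models M \<phi> \<longleftrightarrow> (\<forall>e. sat M e \<phi>)"


section \<open>Pregeometries\<close>

definition pregeometry :: "'a set \<Rightarrow> ('a set \<Rightarrow> 'a set) \<Rightarrow> bool" where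
  "pregeometry A c \<longleftrightarrow>
     (\<forall>X \<subseteq> A. X \<subseteq> c X \<and> c X \<subseteq> A) \<and>
     (\<forall>X \<subseteq> A. \<forall>Y \<subseteq> A. Y \<subseteq> c X \<longrightarrow> c Y \<subseteq> c X) \<and>
     (\<forall>X \<subseteq> A. \<forall>a \<in> A. \<forall>b \<in> A. a \<in> c (insert b X) - c X \<longrightarrow> b \<in> c (insert a X)) \<and>
     (\<forall>X \<subseteq> A. c X = (\<Union>F \<in> {F. F \<subseteq> X \<and> finite F}. c F))"

definition dim :: "('a set \<Rightarrow> 'a set) \<Rightarrow> 'a set \<Rightarrow> nat" where
  "dim c X = (LEAST d. \<exists>Y. finite Y \<and> Y \<subseteq> X \<and> X \<subseteq> c Y \<and> card Y = d)"

text \<open>The formula \<open>\<theta> m\<close> has the free variables \<open>Var 0, \<dots>, Var m\<close>, the last one standing for the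
  element of the closure.\<close>

definition cl :: "(nat \<Rightarrow> ('f, 'p) fm) \<Rightarrow> ('f, 'p, 'a) struct \<Rightarrow> 'a set \<Rightarrow> 'a set" where
  "cl \<theta> A X = {a \<in> univ A. \<exists>bs. set bs \<subseteq> X \<and> holds A (\<theta> (length bs)) (bs @ [a])}"

text \<open>The second conjunct says that whether \<open>\<theta>\<close> holds depends on the set of parameters only, as
  is implicit in defining the closure of a finite set through an enumeration of it.\<close>

definition defines_pregeometry ::
  "(nat \<Rightarrow> ('f, 'p) fm) \<Rightarrow> ('f, 'p, 'a) struct \<Rightarrow> bool" where
  "defines_pregeometry \<theta> A \<longleftrightarrow> pregeometry (univ A) (cl \<theta> A) \<and>
     (\<forall>bs a. set bs \<subseteq> univ A \<and> a \<in> univ A \<longrightarrow>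
        (a \<in> cl \<theta> A (set bs) \<longleftrightarrow> holds A (\<theta> (length bs)) (bs @ [a])))"

definition sdim :: "(nat \<Rightarrow> ('f, 'p) fm) \<Rightarrow> ('f, 'p, 'a) struct \<Rightarrow> nat" where
  "sdim \<theta> A = dim (cl \<theta> A) (univ A)"

text \<open>\<open>c\<close> is the closure operator of the ambient structure \<open>M\<close>.\<close>

definition closed_substructure ::
  "('f, 'r) vocab \<Rightarrow> ('a set \<Rightarrow> 'a set) \<Rightarrow> ('f, 'r, 'a) struct \<Rightarrow> ('f, 'r, 'a) struct \<Rightarrow> bool" where
  "closed_substructure V c A M \<longleftrightarrow> substructure V A M \<and> c (univ A) = univ A"


section \<open>Assumptions on the underlying family\<close>

definition pregeometry_formulas ::
  "('f, 'p) vocab \<Rightarrow> (nat \<Rightarrow> ('f, 'p) fm) \<Rightarrow> bool" where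
  "pregeometry_formulas V \<theta> \<longleftrightarrow> (\<forall>m. wf_fm V (\<theta> m) \<and> fv (\<theta> m) \<subseteq> {..m})"

definition finite_pregeometries ::
  "('f, 'p) vocab \<Rightarrow> (nat \<Rightarrow> ('f, 'p) fm) \<Rightarrow> (nat \<Rightarrow> ('f, 'p, 'a) struct) \<Rightarrow> bool" where
  "finite_pregeometries V \<theta> G \<longleftrightarrow>
     (\<forall>n. is_struct V (G n) \<and> finite (univ (G n)) \<and> defines_pregeometry \<theta> (G n))"

definition bounded_closures ::
  "('f, 'p) vocab \<Rightarrow> (nat \<Rightarrow> ('f, 'p) fm) \<Rightarrow> (nat \<Rightarrow> ('f, 'p, 'a) struct) \<Rightarrow> bool" where
  "bounded_closures V \<theta> G \<longleftrightarrow>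
     (\<exists>f :: nat \<Rightarrow> nat. \<forall>n. \<forall>X \<subseteq> univ (G n).
        card (cl \<theta> (G n) X) \<le> f (dim (cl \<theta> (G n)) X)) \<and>
     (\<forall>n. \<forall>X \<subseteq> univ (G n). cl \<theta> (G n) X = X \<longrightarrow>
        (\<exists>A. substructure V A (G n) \<and> univ A = X))"

definition closures_agree ::
  "('f, 'p) vocab \<Rightarrow> (nat \<Rightarrow> ('f, 'p) fm) \<Rightarrow> (nat \<Rightarrow> ('f, 'p, 'a) struct) \<Rightarrow> bool" where
  "closures_agree V \<theta> G \<longleftrightarrow>
     (\<forall>n A. closed_substructure V (cl \<theta> (G n)) A (G n) \<longrightarrow>
        (\<forall>X \<subseteq> univ A. cl \<theta> A X = cl \<theta> (G n) X))"

definition closed_under_substructures ::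
  "('f, 'p) vocab \<Rightarrow> (nat \<Rightarrow> ('f, 'p) fm) \<Rightarrow> (nat \<Rightarrow> ('f, 'p, 'a) struct) \<Rightarrow> bool" where
  "closed_under_substructures V \<theta> G \<longleftrightarrow>
     (\<forall>n A. closed_substructure V (cl \<theta> (G n)) A (G n) \<longrightarrow> (\<exists>m. isomorphic V A (G m))) \<and>
     filterlim (\<lambda>n. sdim \<theta> (G n)) at_top sequentially \<and>
     (\<forall>n. \<exists>A. substructure V A (G n) \<and> univ A = cl \<theta> (G n) {} \<and> isomorphic V A (G 0))"

text \<open>The variables of the characteristic formula of \<open>G n\<close> enumerate the universe.  Here and
  below, structures that are only relevant up to isomorphism range over the element type of the
  family; this type is infinite because the dimensions of the \<open>G n\<close> tend to infinity, so it
  carries a copy of every finite structure, also over a prescribed finite substructure.\<close>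

definition characteristic_formulas ::
  "('f, 'p) vocab \<Rightarrow> (nat \<Rightarrow> ('f, 'p) fm) \<Rightarrow> (nat \<Rightarrow> ('f, 'p, 'a) struct) \<Rightarrow> bool" where
  "characteristic_formulas V \<theta> G \<longleftrightarrow>
     (\<forall>n. \<exists>\<chi>. wf_fm V \<chi> \<and> quantifier_free \<chi> \<and> fv \<chi> \<subseteq> {..<card (univ (G n))} \<and>
        (\<forall>A :: ('f, 'p, 'a) struct. is_struct V A \<and> defines_pregeometry \<theta> A \<longrightarrow>
           (isomorphic V A (G n) \<longleftrightarrow>
              (\<exists>xs. distinct xs \<and> set xs = univ A \<and> length xs = card (univ (G n)) \<and>
                 holds A \<chi> xs))))"

definition polynomially_saturated ::
  "('f, 'p) vocab \<Rightarrow> (nat \<Rightarrow> ('f, 'p) fm) \<Rightarrow> (nat \<Rightarrow> ('f, 'p, 'a) struct) \<Rightarrow> nat \<Rightarrow> bool" where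
  "polynomially_saturated V \<theta> G k \<longleftrightarrow>
     (\<exists>(\<Lambda> :: nat \<Rightarrow> nat) (P :: real poly).
        filterlim \<Lambda> at_top sequentially \<and>
        (\<forall>n. \<Lambda> n \<le> card (univ (G n)) \<and> real (card (univ (G n))) \<le> poly P (real (\<Lambda> n))) \<and>
        (\<forall>n A H B.
           closed_substructure V (cl \<theta> (G n)) A (G n) \<and>
           is_struct V H \<and> (\<exists>m. isomorphic V H (G m)) \<and>
           closed_substructure V (cl \<theta> H) A H \<and> closed_substructure V (cl \<theta> H) B H \<and>
           univ A \<subset> univ B \<and> sdim \<theta> A + 1 = sdim \<theta> B \<and> sdim \<theta> B \<le> k \<longrightarrow>
           (\<exists>C :: nat \<Rightarrow> ('f, 'p, 'a) struct.
              (\<forall>i < \<Lambda> n. closed_substructure V (cl \<theta> (G n)) (C i) (G n) \<and>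
                 (\<exists>h. iso V h B (C i) \<and> (\<forall>a \<in> univ A. h a = a))) \<and>
              (\<forall>i < \<Lambda> n. \<forall>j < \<Lambda> n. i \<noteq> j \<longrightarrow> univ (C i) \<inter> univ (C j) = univ A))))"


section \<open>Coloured structures\<close>

datatype ('p, 'r) lsym = Pre 'p | Col nat | Rel 'r

definition full_vocab ::
  "('f, 'p) vocab \<Rightarrow> nat \<Rightarrow> 'r set \<Rightarrow> ('r \<Rightarrow> nat) \<Rightarrow> ('f, ('p, 'r) lsym) vocab" where
  "full_vocab V l Rs ar =
     \<lparr>fsyms = fsyms V, farity = farity V,
      rsyms = Pre ` rsyms V \<union> Col ` {1..l} \<union> Rel ` Rs,
      rarity = (\<lambda>S. case S of Pre p \<Rightarrow> rarity V p | Col i \<Rightarrow> 1 | Rel R \<Rightarrow> ar R)\<rparr>"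

definition reduct :: "('f, ('p, 'r) lsym, 'a) struct \<Rightarrow> ('f, 'p, 'a) struct" where
  "reduct M = \<lparr>univ = univ M, fint = fint M, rint = (\<lambda>p. rint M (Pre p))\<rparr>"

abbreviation lcl ::
  "(nat \<Rightarrow> ('f, 'p) fm) \<Rightarrow> ('f, ('p, 'r) lsym, 'a) struct \<Rightarrow> 'a set \<Rightarrow> 'a set" where
  "lcl \<theta> M \<equiv> cl \<theta> (reduct M)"

definition has_colour :: "('f, ('p, 'r) lsym, 'a) struct \<Rightarrow> nat \<Rightarrow> 'a \<Rightarrow> bool" where
  "has_colour M i a \<longleftrightarrow> [a] \<in> rint M (Col i)"

definition share_colour :: "nat \<Rightarrow> ('f, ('p, 'r) lsym, 'a) struct \<Rightarrow> 'a \<Rightarrow> 'a \<Rightarrow> bool" where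
  "share_colour l M a b \<longleftrightarrow> (\<exists>i \<in> {1..l}. has_colour M i a \<and> has_colour M i b)"

text \<open>In the third condition \<open>a = b\<close> is allowed, so no element has two colours.\<close>

definition coloured ::
  "(nat \<Rightarrow> ('f, 'p) fm) \<Rightarrow> nat \<Rightarrow> 'r set \<Rightarrow> ('f, ('p, 'r) lsym, 'a) struct \<Rightarrow> bool" where
  "coloured \<theta> l Rs M \<longleftrightarrow>
     (\<forall>a \<in> univ M. (\<exists>i \<in> {1..l}. has_colour M i a) \<longleftrightarrow> a \<notin> lcl \<theta> M {}) \<and>
     (\<forall>R \<in> Rs. \<forall>xs \<in> rint M (Rel R). \<not> set xs \<subseteq> lcl \<theta> M {}) \<and>
     (\<forall>a \<in> univ M - lcl \<theta> M {}. \<forall>b \<in> univ M - lcl \<theta> M {}. a \<in> lcl \<theta> M {b} \<longrightarrow>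
        (\<forall>i \<in> {1..l}. \<forall>j \<in> {1..l}. has_colour M i a \<and> has_colour M j b \<longrightarrow> i = j)) \<and>
     (\<forall>R \<in> Rs. \<forall>xs \<in> rint M (Rel R).
        \<exists>b \<in> lcl \<theta> M (set xs) - lcl \<theta> M {}. \<exists>c \<in> lcl \<theta> M (set xs) - lcl \<theta> M {}.
          \<not> share_colour l M b c)"

definition strongly_coloured ::
  "(nat \<Rightarrow> ('f, 'p) fm) \<Rightarrow> nat \<Rightarrow> 'r set \<Rightarrow> ('f, ('p, 'r) lsym, 'a) struct \<Rightarrow> bool" where
  "strongly_coloured \<theta> l Rs M \<longleftrightarrow> coloured \<theta> l Rs M \<and>
     (\<forall>R \<in> Rs. \<forall>xs \<in> rint M (Rel R).
        \<forall>b \<in> lcl \<theta> M (set xs) - lcl \<theta> M {}. \<forall>c \<in> lcl \<theta> M (set xs) - lcl \<theta> M {}.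
          b \<notin> lcl \<theta> M {c} \<longrightarrow> \<not> share_colour l M b c)"

definition Kset ::
  "('f, 'p) vocab \<Rightarrow> (nat \<Rightarrow> ('f, 'p) fm) \<Rightarrow> (nat \<Rightarrow> ('f, 'p, 'a) struct) \<Rightarrow>
   nat \<Rightarrow> 'r set \<Rightarrow> ('r \<Rightarrow> nat) \<Rightarrow> nat \<Rightarrow> ('f, ('p, 'r) lsym, 'a) struct set" where
  "Kset V \<theta> G l Rs ar n =
     {M. is_struct (full_vocab V l Rs ar) M \<and> reduct M = G n \<and> coloured \<theta> l Rs M}"

definition SKset ::
  "('f, 'p) vocab \<Rightarrow> (nat \<Rightarrow> ('f, 'p) fm) \<Rightarrow> (nat \<Rightarrow> ('f, 'p, 'a) struct) \<Rightarrow>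
   nat \<Rightarrow> 'r set \<Rightarrow> ('r \<Rightarrow> nat) \<Rightarrow> nat \<Rightarrow> ('f, ('p, 'r) lsym, 'a) struct set" where
  "SKset V \<theta> G l Rs ar n =
     {M. is_struct (full_vocab V l Rs ar) M \<and> reduct M = G n \<and> strongly_coloured \<theta> l Rs M}"

definition iso_class ::
  "('f, 'r) vocab \<Rightarrow> (nat \<Rightarrow> ('f, 'r, 'a) struct set) \<Rightarrow> ('f, 'r, 'a) struct set" where
  "iso_class V K = {B. is_struct V B \<and> (\<exists>n. \<exists>M \<in> K n. isomorphic V B M)}"


section \<open>The dimension conditional measures\<close>

definition dim_restrict ::
  "(nat \<Rightarrow> ('f, 'p) fm) \<Rightarrow> nat \<Rightarrow> ('f, ('p, 'r) lsym, 'a) struct \<Rightarrow>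
   ('f, ('p, 'r) lsym, 'a) struct" where
  "dim_restrict \<theta> d M = M\<lparr>rint := (\<lambda>S. case S of
       Pre p \<Rightarrow> rint M S
     | _ \<Rightarrow> {xs \<in> rint M S. dim (lcl \<theta> M) (set xs) \<le> d})\<rparr>"

text \<open>\<open>dc_prob \<theta> K r M\<close> is meant for \<open>M\<close> in \<open>dim_restrict \<theta> r ` K\<close>.\<close>

fun dc_prob ::
  "(nat \<Rightarrow> ('f, 'p) fm) \<Rightarrow> ('f, ('p, 'r) lsym, 'a) struct set \<Rightarrow> nat \<Rightarrow>
   ('f, ('p, 'r) lsym, 'a) struct \<Rightarrow> real" where
  "dc_prob \<theta> K 0 M = 1 / real (card (dim_restrict \<theta> 0 ` K))"
| "dc_prob \<theta> K (Suc r) M = dc_prob \<theta> K r (dim_restrict \<theta> r M) /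
     real (card {M' \<in> dim_restrict \<theta> (Suc r) ` K. dim_restrict \<theta> r M' = dim_restrict \<theta> r M})"

text \<open>A tuple has dimension at most its length, so for \<open>r\<close> the maximal arity the measure lives
  on \<open>K\<close> itself.\<close>

definition dc_measure ::
  "(nat \<Rightarrow> ('f, 'p) fm) \<Rightarrow> 'r set \<Rightarrow> ('r \<Rightarrow> nat) \<Rightarrow> ('f, ('p, 'r) lsym, 'a) struct set \<Rightarrow>
   ('f, ('p, 'r) lsym, 'a) struct set \<Rightarrow> real" where
  "dc_measure \<theta> Rs ar K X = (\<Sum>M\<in>X. dc_prob \<theta> K (Max (ar ` Rs)) M)"


section \<open>Extension properties\<close>

text \<open>\<open>V\<close> is the full vocabulary.\<close>

definition extension_property ::
  "('f, ('p, 'r) lsym) vocab \<Rightarrow> (nat \<Rightarrow> ('f, 'p) fm) \<Rightarrow> ('f, ('p, 'r) lsym, 'a) struct \<Rightarrow>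
   ('f, ('p, 'r) lsym, 'a) struct \<Rightarrow> ('f, ('p, 'r) lsym, 'a) struct \<Rightarrow> bool" where
  "extension_property V \<theta> B A M \<longleftrightarrow>
     (\<forall>A' h. closed_substructure V (lcl \<theta> M) A' M \<and> iso V h A' A \<longrightarrow>
        (\<exists>B' g. closed_substructure V (lcl \<theta> M) B' M \<and> univ A' \<subseteq> univ B' \<and>
           iso V g B' B \<and> (\<forall>a \<in> univ A'. g a = h a)))"

definition k_extension_property ::
  "('f, ('p, 'r) lsym) vocab \<Rightarrow> (nat \<Rightarrow> ('f, 'p) fm) \<Rightarrow>
   ('f, ('p, 'r) lsym, 'a) struct set \<Rightarrow> nat \<Rightarrow> ('f, ('p, 'r) lsym, 'a) struct \<Rightarrow> bool" where
  "k_extension_property V \<theta> \<C> k M \<longleftrightarrow>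
     (\<forall>B \<in> \<C>. \<forall>A. closed_substructure V (lcl \<theta> B) A B \<and> sdim \<theta> (reduct B) \<le> k \<longrightarrow>
        extension_property V \<theta> B A M)"

end

theory Submission
  imports Defs
begin

text \<open>Once the colours are fixed, the relations of a random structure are independent fair coins on
  the permitted tuples, and the colours themselves are uniform.  Hence the dimension conditional
  measure is the image of the uniform measure on \<open>precolourings\<close> (admissible colours, arbitrary
  relations) under the map \<open>prune\<close> that erases the forbidden tuples.  In this uniform model the
  events that the disjoint copies provided by saturation carry a prescribed structure are
  independent, each with probability bounded below, so a fixed one-dimensional extension problem
  fails with probability exponentially small in \<open>\<Lambda> n\<close>, while only polynomially many problems occur.
  Almost every structure therefore solves all of them; this property (\<open>good\<close>) yields the
  extension property by adding one dimension at a time, and elementary equivalence up to a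
  quantifier rank by a back-and-forth argument.\<close>

section \<open>Isomorphisms\<close>

text \<open>Permission of a tuple depends on the colours alone; coloured elements have dimension
  one, and permitted tuples have dimension at least two. So level 0 of the measure is a point mass,
  level 1 chooses the colours, and every later level chooses among tuples whose permission is
  already settled. Choices that share the lower level then have equally many preimages under
  \<open>prune\<close>, which is what the division in \<open>dc_prob\<close> asks for. The preimages
  of whole colourings need not be equally large, because the number of forbidden tuples varies with
  the colours; hence the image measure is not simply the uniform one. Independence of the copies
  rests on closedness: dependent elements outside the closure of the empty set belong to the same
  closed sets, so recolouring the part of a closed set outside a smaller closed set cannot clash
  with the remaining colours. Closures of bounded dimension have bounded size, so a copy involves at
  most \<open>t\<close> labelled tuples, with \<open>t\<close> depending on \<open>k\<close> only;
  this gives the success probability \<open>1 / 2 ^ t\<close>. \<open>good\<close> admits problems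
  posed by any member of the family, so one random structure can pose problems to another, and
  conversely.\<close>

lemma iso_bij: "iso V p A B \<Longrightarrow> bij_betw p (univ A) (univ B)"
  by (simp add: iso_def)

lemma eval_tm_iso:
  assumes "iso V p A B" "is_struct V A" "wf_tm V t" "\<forall>i \<in> fv_tm t. e i \<in> univ A \<and> e' i = p (e i)"
  shows "eval_tm A e t \<in> univ A \<and> eval_tm B e' t = p (eval_tm A e t)"
  using assms(3,4)
proof (induction t)
  case (Var x)
  then show ?case by simp
next
  case (Fn f ts)
  have IH: "eval_tm A e t \<in> univ A \<and> eval_tm B e' t = p (eval_tm A e t)" if "t \<in> set ts" for t
    using Fn that by auto
  have *: "map (eval_tm A e) ts \<in> tuples (univ A) (farity V f)"
    using IH Fn.prems by (auto simp: tuples_def)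
  have "map (eval_tm B e') ts = map p (map (eval_tm A e) ts)"
    using IH by simp
  moreover have "p (fint A f (map (eval_tm A e) ts)) = fint B f (map p (map (eval_tm A e) ts))"
    using assms(1) Fn.prems * by (simp add: iso_def del: map_map)
  moreover have "fint A f (map (eval_tm A e) ts) \<in> univ A"
    using assms(2) Fn.prems * by (simp add: is_struct_def)
  ultimately show ?case by (simp del: map_map)
qed

text \<open>Only free variables are constrained: \<open>holds\<close> indexes a list, and its
  entries beyond the length are unspecified.\<close>

lemma sat_iso:
  assumes "iso V p A B" "is_struct V A" "wf_fm V \<phi>" "\<forall>i \<in> fv \<phi>. e i \<in> univ A \<and> e' i = p (e i)"
  shows "sat A e \<phi> \<longleftrightarrow> sat B e' \<phi>"
  using assms(3,4)
proof (induction \<phi> arbitrary: e e')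
  case (Eq s t)
  have "inj_on p (univ A)"
    using assms(1) by (simp add: iso_def bij_betw_def)
  moreover have "eval_tm A e s \<in> univ A \<and> eval_tm B e' s = p (eval_tm A e s)"
    and "eval_tm A e t \<in> univ A \<and> eval_tm B e' t = p (eval_tm A e t)"
    using Eq by (auto intro!: eval_tm_iso[OF assms(1,2)])
  ultimately show ?case by (auto dest: inj_onD)
next
  case (Pred R ts)
  have IH: "eval_tm A e t \<in> univ A \<and> eval_tm B e' t = p (eval_tm A e t)" if "t \<in> set ts" for t
    using Pred that by (intro eval_tm_iso[OF assms(1,2)]) auto
  have *: "map (eval_tm A e) ts \<in> tuples (univ A) (rarity V R)"
    using IH Pred.prems by (auto simp: tuples_def)
  have "map (eval_tm B e') ts = map p (map (eval_tm A e) ts)"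
    using IH by simp
  moreover have "map (eval_tm A e) ts \<in> rint A R \<longleftrightarrow> map p (map (eval_tm A e) ts) \<in> rint B R"
    using assms(1) Pred.prems * by (simp add: iso_def del: map_map)
  ultimately show ?case by (simp del: map_map)
next
  case (Exi i \<phi>)
  have IH: "sat A (e(i := a)) \<phi> \<longleftrightarrow> sat B (e'(i := p a)) \<phi>" if "a \<in> univ A" for a
    using Exi that by (intro Exi.IH) auto
  have "univ B = p ` univ A"
    using iso_bij[OF assms(1)] by (simp add: bij_betw_def)
  with IH show ?case by simp
next
  case (And \<phi> \<psi>)
  have "sat A e \<phi> \<longleftrightarrow> sat B e' \<phi>" "sat A e \<psi> \<longleftrightarrow> sat B e' \<psi>"
    using And.prems by (intro And.IH; simp)+
  then show ?case by simp
qed simp_all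

lemma iso_inv:
  assumes "iso V p A B" "is_struct V A"
  shows "iso V (inv_into (univ A) p) B A"
proof -
  let ?q = "inv_into (univ A) p"
  have bij: "bij_betw p (univ A) (univ B)"
    using assms(1) by (rule iso_bij)
  have q: "?q x \<in> univ A \<and> p (?q x) = x" if "x \<in> univ B" for x
    using that bij by (auto simp: bij_betw_def f_inv_into_f inv_into_into)
  have tup: "map ?q xs \<in> tuples (univ A) m \<and> map p (map ?q xs) = xs"
    if "xs \<in> tuples (univ B) m" for xs m
    using that q by (auto simp: tuples_def intro!: map_idI)
  have "?q (fint B f xs) = fint A f (map ?q xs)"
    if "f \<in> fsyms V" "xs \<in> tuples (univ B) (farity V f)" for f xs
  proof -
    have "p (fint A f (map ?q xs)) = fint B f xs"
      using assms(1) that tup[OF that(2)] by (metis iso_def)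
    moreover have "fint A f (map ?q xs) \<in> univ A"
      using assms(2) that tup[OF that(2)] by (auto simp: is_struct_def)
    ultimately show ?thesis
      using bij by (metis bij_betw_def inv_into_f_f)
  qed
  moreover have "xs \<in> rint B R \<longleftrightarrow> map ?q xs \<in> rint A R"
    if "R \<in> rsyms V" "xs \<in> tuples (univ B) (rarity V R)" for R xs
    using assms(1) that tup[OF that(2)] by (metis iso_def)
  ultimately show ?thesis
    using bij_betw_inv_into[OF bij] by (simp add: iso_def)
qed

lemma tuples_map:
  "bij_betw p X Y \<Longrightarrow> xs \<in> tuples X m \<Longrightarrow> map p xs \<in> tuples Y m"
  by (auto simp: tuples_def bij_betw_def)

lemma iso_comp:
  assumes "iso V p A B" "iso V q B C"
  shows "iso V (q \<circ> p) A C"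
proof -
  have bij: "bij_betw p (univ A) (univ B)"
    using assms(1) by (rule iso_bij)
  then show ?thesis
    using assms bij_betw_trans[OF bij iso_bij[OF assms(2)]] tuples_map[OF bij]
    by (simp add: iso_def)
qed

lemma iso_cong:
  assumes iso: "iso V p A B" and q: "\<forall>a \<in> univ A. q a = p a" and A: "is_struct V A"
  shows "iso V q A B"
proof -
  have m: "map q xs = map p xs" if "xs \<in> tuples (univ A) m" for xs m
    using that q by (auto simp: tuples_def)
  have "bij_betw q (univ A) (univ B) \<longleftrightarrow> bij_betw p (univ A) (univ B)"
    using q by (intro bij_betw_cong) auto
  moreover have "q (fint A f xs) = fint B f (map q xs)"
    if "f \<in> fsyms V" "xs \<in> tuples (univ A) (farity V f)" for f xs
    unfolding m[OF that(2)] using that iso A q by (simp add: iso_def is_struct_def)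
  moreover have "xs \<in> rint A R \<longleftrightarrow> map q xs \<in> rint B R"
    if "R \<in> rsyms V" "xs \<in> tuples (univ A) (rarity V R)" for R xs
    unfolding m[OF that(2)] using that iso by (simp add: iso_def)
  ultimately show ?thesis
    using iso by (auto simp: iso_def)
qed

lemma iso_id: "iso V id A A"
  by (simp add: iso_def)

text \<open>A canonical representative of the substructure on \<open>X\<close>. The predicate
  \<open>substructure\<close> leaves the functions outside the smaller universe open, so it does not
  determine a structure literally; with \<open>restr\<close> a substructure is named by its universe
  alone.\<close>

definition restr :: "('f, 'r, 'a) struct \<Rightarrow> 'a set \<Rightarrow> ('f, 'r, 'a) struct" where
  "restr M X = \<lparr>univ = X, fint = fint M, rint = (\<lambda>R. {xs \<in> rint M R. set xs \<subseteq> X})\<rparr>"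

lemma univ_restr [simp]: "univ (restr M X) = X"
  by (simp add: restr_def)

lemma substructure_iff_restr:
  "substructure V A M \<longleftrightarrow> is_struct V A \<and> univ A \<subseteq> univ M \<and>
     (\<forall>f \<in> fsyms V. \<forall>xs \<in> tuples (univ A) (farity V f). fint A f xs = fint M f xs) \<and>
     (\<forall>R \<in> rsyms V. \<forall>xs \<in> tuples (univ A) (rarity V R). xs \<in> rint A R \<longleftrightarrow> xs \<in> rint M R)"
  unfolding substructure_def is_struct_def by blast

lemma substructure_iso_restr: "substructure V A M \<Longrightarrow> iso V id A (restr M (univ A))"
  by (auto simp: substructure_iff_restr iso_def restr_def tuples_def)

lemma restr_iso_substructure: "substructure V A M \<Longrightarrow> iso V id (restr M (univ A)) A"
  by (auto simp: substructure_iff_restr iso_def restr_def tuples_def)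

lemma substructure_restr:
  assumes "is_struct V M" "substructure V A M"
  shows "substructure V (restr M (univ A)) M"
  using assms unfolding substructure_iff_restr is_struct_def restr_def by (force simp: tuples_def)

lemma is_struct_restr:
  assumes "is_struct V M" "X \<subseteq> univ M"
    "\<forall>f \<in> fsyms V. \<forall>xs \<in> tuples X (farity V f). fint M f xs \<in> X"
  shows "is_struct V (restr M X)"
  using assms unfolding is_struct_def restr_def by (force simp: tuples_def)

lemma iso_substructure_iff:
  assumes "substructure V A M" "substructure V B N"
  shows "iso V p A B \<longleftrightarrow> iso V p (restr M (univ A)) (restr N (univ B))"
proof
  assume "iso V p A B"
  then have "iso V (id \<circ> (p \<circ> id)) (restr M (univ A)) (restr N (univ B))"
    by (intro iso_comp[where B = B] iso_comp[where B = A] restr_iso_substructure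
        substructure_iso_restr assms)
  then show "iso V p (restr M (univ A)) (restr N (univ B))" by simp
next
  assume "iso V p (restr M (univ A)) (restr N (univ B))"
  then have "iso V (id \<circ> (p \<circ> id)) A B"
    by (intro iso_comp[where B = "restr N (univ B)"] iso_comp[where B = "restr M (univ A)"]
        restr_iso_substructure substructure_iso_restr assms)
  then show "iso V p A B" by simp
qed

lemma iso_restr_iff:
  "iso V p (restr M X) (restr N Y) \<longleftrightarrow> bij_betw p X Y \<and>
     (\<forall>f \<in> fsyms V. \<forall>xs \<in> tuples X (farity V f). p (fint M f xs) = fint N f (map p xs)) \<and>
     (\<forall>R \<in> rsyms V. \<forall>xs \<in> tuples X (rarity V R). xs \<in> rint M R \<longleftrightarrow> map p xs \<in> rint N R)"
proof (cases "bij_betw p X Y")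
  case True
  then have "set (map p xs) \<subseteq> Y" if "xs \<in> tuples X m" for xs m
    using that tuples_map[OF True that] by (simp add: tuples_def)
  then show ?thesis
    by (auto simp: iso_def restr_def tuples_def)
qed (simp add: iso_def)

lemma iso_restr_mono:
  assumes "iso V p (restr M X) (restr N Y)" "Z \<subseteq> X"
  shows "iso V p (restr M Z) (restr N (p ` Z))"
proof -
  have "bij_betw p Z (p ` Z)"
    using assms by (auto simp: iso_restr_iff bij_betw_def inj_on_subset)
  moreover have "tuples Z m \<subseteq> tuples X m" for m
    using assms(2) by (auto simp: tuples_def)
  ultimately show ?thesis
    using assms(1) unfolding iso_restr_iff by blast
qed

text \<open>A literal equality, by the convention that symbols outside the vocabulary have empty
  interpretation.\<close>

lemma restr_univ:
  assumes "is_struct V M"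
  shows "restr M (univ M) = M"
proof -
  have "rint M R \<subseteq> {xs. set xs \<subseteq> univ M}" for R
    using assms by (cases "R \<in> rsyms V") (simp_all add: is_struct_def tuples_def, blast)
  then have "{xs \<in> rint M R. set xs \<subseteq> univ M} = rint M R" for R
    by blast
  then show ?thesis by (simp add: restr_def)
qed

section \<open>Pregeometries\<close>

lemma
  assumes "pregeometry U c"
  shows cl_extensive: "X \<subseteq> U \<Longrightarrow> X \<subseteq> c X"
    and cl_subset: "X \<subseteq> U \<Longrightarrow> c X \<subseteq> U"
    and cl_least: "X \<subseteq> U \<Longrightarrow> Y \<subseteq> U \<Longrightarrow> Y \<subseteq> c X \<Longrightarrow> c Y \<subseteq> c X"
    and cl_exchange: "X \<subseteq> U \<Longrightarrow> a \<in> U \<Longrightarrow> b \<in> U \<Longrightarrow> a \<in> c (insert b X) \<Longrightarrow> a \<notin> c X \<Longrightarrow> b \<in> c (insert a X)"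
proof -
  note pg = assms[unfolded pregeometry_def]
  note 1 = pg[THEN conjunct1] and 2 = pg[THEN conjunct2, THEN conjunct1]
    and 3 = pg[THEN conjunct2, THEN conjunct2, THEN conjunct1]
  show "X \<subseteq> U \<Longrightarrow> X \<subseteq> c X" "X \<subseteq> U \<Longrightarrow> c X \<subseteq> U"
    using 1 by simp_all
  show "X \<subseteq> U \<Longrightarrow> Y \<subseteq> U \<Longrightarrow> Y \<subseteq> c X \<Longrightarrow> c Y \<subseteq> c X"
    using 2 by simp
  show "X \<subseteq> U \<Longrightarrow> a \<in> U \<Longrightarrow> b \<in> U \<Longrightarrow> a \<in> c (insert b X) \<Longrightarrow> a \<notin> c X \<Longrightarrow> b \<in> c (insert a X)"
    using 3 by simp
qed

lemma cl_mono:
  assumes "pregeometry U c" "X \<subseteq> Y" "Y \<subseteq> U"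
  shows "c X \<subseteq> c Y"
  using cl_extensive[OF assms(1,3)] assms by (intro cl_least[OF assms(1)]) auto

lemma cl_idem:
  assumes "pregeometry U c" "X \<subseteq> U"
  shows "c (c X) = c X"
  using cl_extensive[OF assms(1), of "c X"] cl_subset[OF assms]
    cl_least[OF assms(1), of X "c X"] assms by auto

lemma dependent_sym:
  assumes "pregeometry U c" "a \<in> U" "b \<in> U" "a \<in> c {b}" "a \<notin> c {}"
  shows "b \<in> c {a}"
  using cl_exchange[OF assms(1), of "{}" a b] assms by simp

section \<open>Independent sets, the exchange lemma of Steinitz, and dimension\<close>

definition indep :: "('a set \<Rightarrow> 'a set) \<Rightarrow> 'a set \<Rightarrow> bool" where
  "indep c J \<longleftrightarrow> (\<forall>x \<in> J. x \<notin> c (J - {x}))"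

text \<open>If some old \<open>x\<close> became dependent after adding \<open>y\<close>, exchange
  would put \<open>y\<close> into the closure of \<open>J\<close>.\<close>

lemma indep_insert:
  assumes pg: "pregeometry U c" and "J \<subseteq> U" "y \<in> U" "indep c J" "y \<notin> c J"
  shows "indep c (insert y J)"
  unfolding indep_def
proof
  fix x assume x: "x \<in> insert y J"
  have "y \<notin> J"
    using assms cl_extensive[OF pg, of J] by auto
  show "x \<notin> c (insert y J - {x})"
  proof (cases "x = y")
    case True
    with \<open>y \<notin> J\<close> show ?thesis using assms by simp
  next
    case False
    show ?thesis
    proof
      assume "x \<in> c (insert y J - {x})"
      moreover have "insert y J - {x} = insert y (J - {x})"
        using False by auto
      moreover have "x \<notin> c (J - {x})" "x \<in> U" "insert x (J - {x}) = J"
        using x False assms by (auto simp: indep_def)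
      ultimately have "y \<in> c J"
        using cl_exchange[OF pg, of "J - {x}" x y] assms by auto
      then show False using assms by simp
    qed
  qed
qed

lemma indep_subset:
  assumes pg: "pregeometry U c" and "J \<subseteq> U" "indep c J" "I \<subseteq> J"
  shows "indep c I"
  unfolding indep_def
proof
  fix x assume "x \<in> I"
  moreover have "c (I - {x}) \<subseteq> c (J - {x})"
    using assms by (intro cl_mono[OF pg]) auto
  ultimately show "x \<notin> c (I - {x})"
    using assms by (auto simp: indep_def)
qed

text \<open>Replacement argument: an element of \<open>J - I\<close> is traded for an element of
  \<open>I\<close>, which keeps independence and cardinality and shrinks \<open>J - I\<close>, until
  \<open>J\<close> lies inside \<open>I\<close>.\<close>

lemma steinitz:
  assumes pg: "pregeometry U c" and "finite I" "finite J" "I \<subseteq> U" "J \<subseteq> U" "indep c J" "J \<subseteq> c I"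
  shows "card J \<le> card I"
  using assms(3,5-7)
proof (induction "card (J - I)" arbitrary: J)
  case 0
  then have "J \<subseteq> I" by auto
  then show ?case using assms(2) by (simp add: card_mono)
next
  case (Suc m)
  then obtain x where x: "x \<in> J" "x \<notin> I"
    by (metis card.empty nat.distinct(1) Diff_iff all_not_in_conv)
  have nx: "x \<notin> c (J - {x})"
    using Suc.prems x by (auto simp: indep_def)
  \<comment> \<open>Otherwise the closure of \<open>I\<close>, and with it \<open>x\<close>, would
    lie in \<open>c (J - {x})\<close>.\<close>
  have "\<not> I \<subseteq> c (J - {x})"
    using nx x Suc.prems assms(4) cl_least[OF pg, of "J - {x}" I] by blast
  then obtain y where y: "y \<in> I" "y \<notin> c (J - {x})" by auto
  have "y \<notin> J - {x}" "y \<noteq> x"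
    using y x cl_extensive[OF pg, of "J - {x}"] Suc.prems by auto
  let ?J = "insert y (J - {x})"
  have "indep c ?J"
    using Suc.prems y assms(4) indep_subset[OF pg, of J "J - {x}"] by (intro indep_insert[OF pg]) auto
  moreover have "?J - I = (J - I) - {x}"
    using y x by auto
  then have "m = card (?J - I)"
    using Suc.hyps(2) x Suc.prems by simp
  moreover have "?J \<subseteq> c I"
    using Suc.prems y cl_extensive[OF pg, of I] assms(4) by auto
  ultimately have "card ?J \<le> card I"
    using Suc.hyps(1)[of ?J] Suc.prems y assms(4) by auto
  moreover have "card ?J = card J"
    using \<open>y \<notin> J - {x}\<close> x Suc.prems card.remove[of J x] card_insert_disjoint[of "J - {x}" y]
    by simp
  ultimately show ?case by simp
qed

lemma dim_le: "finite Y \<Longrightarrow> Y \<subseteq> X \<Longrightarrow> X \<subseteq> c Y \<Longrightarrow> dim c X \<le> card Y"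
  unfolding dim_def by (rule Least_le) auto

text \<open>A generating subset of least size is independent, since a dependent element could be
  dropped from it.\<close>

lemma basis_exists:
  assumes pg: "pregeometry U c" and "finite X" "X \<subseteq> U"
  obtains J where "finite J" "J \<subseteq> X" "X \<subseteq> c J" "card J = dim c X" "indep c J"
proof -
  have "\<exists>Y. finite Y \<and> Y \<subseteq> X \<and> X \<subseteq> c Y \<and> card Y = card X"
    using assms cl_extensive[OF pg, of X] by blast
  then have "\<exists>Y. finite Y \<and> Y \<subseteq> X \<and> X \<subseteq> c Y \<and> card Y = dim c X"
    unfolding dim_def by (rule LeastI)
  then obtain J where J: "finite J" "J \<subseteq> X" "X \<subseteq> c J" "card J = dim c X" by auto
  have "indep c J"
    unfolding indep_def
  proof (intro ballI notI)
    fix x assume x: "x \<in> J" "x \<in> c (J - {x})"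
    have "J \<subseteq> c (J - {x})"
      using x J assms cl_extensive[OF pg, of "J - {x}"] by blast
    then have "X \<subseteq> c (J - {x})"
      using cl_least[OF pg, of "J - {x}" J] J assms by blast
    then have "dim c X \<le> card (J - {x})"
      using J by (intro dim_le) auto
    then show False
      using x J by (metis card_Diff1_less leD)
  qed
  with J show thesis by (rule that)
qed

lemma dim_le_card: "pregeometry U c \<Longrightarrow> finite X \<Longrightarrow> X \<subseteq> U \<Longrightarrow> dim c X \<le> card X"
  by (rule dim_le) (auto dest: cl_extensive)

lemma card_indep_le_dim:
  assumes pg: "pregeometry U c" and "finite X" "X \<subseteq> U" "J \<subseteq> X" "indep c J"
  shows "card J \<le> dim c X"
proof -
  obtain I where I: "finite I" "I \<subseteq> X" "X \<subseteq> c I" "card I = dim c X"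
    using basis_exists[OF assms(1-3)] by metis
  have "card J \<le> card I"
    using assms I by (intro steinitz[OF pg]) (auto intro: finite_subset)
  with I show ?thesis by simp
qed

lemma dim_mono:
  assumes pg: "pregeometry U c" and "finite Y" "X \<subseteq> Y" "Y \<subseteq> U"
  shows "dim c X \<le> dim c Y"
proof -
  obtain J where "finite J" "J \<subseteq> X" "card J = dim c X" "indep c J"
    using basis_exists[OF pg, of X] assms by (metis finite_subset subset_trans)
  then show ?thesis
    using card_indep_le_dim[OF pg, of Y J] assms by auto
qed

text \<open>A basis of \<open>Y\<close> together with \<open>b\<close> generates the new closure,
  which gives one inequality, and is independent, which gives the other.\<close>

lemma dim_cl_insert:
  assumes pg: "pregeometry U c" and "finite U" "Y \<subseteq> U" "c Y = Y" "b \<in> U - Y"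
  shows "dim c (c (insert b Y)) = dim c Y + 1"
proof (rule antisym)
  obtain J where J: "finite J" "J \<subseteq> Y" "Y \<subseteq> c J" "card J = dim c Y" "indep c J"
    using basis_exists[OF pg, of Y] assms by (metis finite_subset)
  have sub: "insert b J \<subseteq> U" "insert b Y \<subseteq> U" using J assms by auto
  have inb: "insert b J \<subseteq> c (insert b Y)"
    using J assms cl_extensive[OF pg, of "insert b Y"] by auto
  have nb: "b \<notin> J" using J assms by auto
  have "c J \<subseteq> c (insert b J)"
    using sub by (intro cl_mono[OF pg]) auto
  then have "insert b Y \<subseteq> c (insert b J)"
    using J cl_extensive[OF pg sub(1)] by auto
  then have "c (insert b Y) \<subseteq> c (insert b J)"
    using cl_least[OF pg sub(1,2)] by auto
  then have "dim c (c (insert b Y)) \<le> card (insert b J)"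
    using J inb by (intro dim_le) auto
  then show "dim c (c (insert b Y)) \<le> dim c Y + 1"
    using J nb by simp
  have "c J \<subseteq> Y"
    using J assms cl_mono[OF pg, of J Y] by auto
  then have "indep c (insert b J)"
    using J assms sub by (intro indep_insert[OF pg]) auto
  then have "card (insert b J) \<le> dim c (c (insert b Y))"
    using assms sub inb cl_subset[OF pg sub(2)]
    by (intro card_indep_le_dim[OF pg]) (auto intro: finite_subset)
  then show "dim c Y + 1 \<le> dim c (c (insert b Y))"
    using J nb by simp
qed

text \<open>\<open>dim c X\<close> consults closures of subsets of \<open>X\<close> only, so it
  suffices to compare the two operators there; the third assumption makes \<open>p\<close> reflect
  membership in closures.\<close>

lemma dim_bij:
  assumes "inj_on p X" "\<And>T. T \<subseteq> X \<Longrightarrow> c' (p ` T) = p ` c T" "\<And>T. T \<subseteq> X \<Longrightarrow> c T \<subseteq> X"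
  shows "dim c' (p ` X) = dim c X"
proof -
  have "(\<exists>Y. finite Y \<and> Y \<subseteq> p ` X \<and> p ` X \<subseteq> c' Y \<and> card Y = d) \<longleftrightarrow>
    (\<exists>Y. finite Y \<and> Y \<subseteq> X \<and> X \<subseteq> c Y \<and> card Y = d)" (is "?L \<longleftrightarrow> ?R") for d
  proof
    assume ?L
    then obtain Y' where Y': "finite Y'" "Y' \<subseteq> p ` X" "p ` X \<subseteq> c' Y'" "card Y' = d" by auto
    obtain Y where Y: "Y \<subseteq> X" "Y' = p ` Y"
      using Y'(2) by (auto simp: subset_image_iff)
    have inj: "inj_on p Y" using assms(1) Y by (auto intro: inj_on_subset)
    have "finite Y" using inj Y Y' by (simp add: finite_image_iff)
    moreover have "card Y = d" using inj Y Y' by (simp add: card_image)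
    moreover have "X \<subseteq> c Y"
    proof
      fix x assume "x \<in> X"
      then have "p x \<in> p ` c Y" using Y Y' assms(2)[of Y] by auto
      with \<open>x \<in> X\<close> show "x \<in> c Y"
        using assms(1) assms(3)[of Y] Y by (auto dest: inj_onD)
    qed
    ultimately show ?R using Y by blast
  next
    assume ?R
    then obtain Y where Y: "finite Y" "Y \<subseteq> X" "X \<subseteq> c Y" "card Y = d" by auto
    have inj: "inj_on p Y" using assms(1) Y by (auto intro: inj_on_subset)
    have "p ` X \<subseteq> c' (p ` Y)" using Y assms(2)[of Y] by auto
    then show ?L using Y inj by (intro exI[of _ "p ` Y"]) (auto simp: card_image)
  qed
  then show ?thesis by (simp add: dim_def)
qed

lemma dim_cong:
  assumes "\<And>T. T \<subseteq> X \<Longrightarrow> c' T = c T" "\<And>T. T \<subseteq> X \<Longrightarrow> c T \<subseteq> X"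
  shows "dim c' X = dim c X"
  using dim_bij[where p = id and X = X and c = c and c' = c'] assms by simp

lemma dim_0_iff:
  assumes pg: "pregeometry U c" and "finite X" "X \<subseteq> U"
  shows "dim c X = 0 \<longleftrightarrow> X \<subseteq> c {}"
proof
  assume "dim c X = 0"
  then show "X \<subseteq> c {}"
    using basis_exists[OF assms] by (metis card_0_eq)
next
  assume "X \<subseteq> c {}"
  then show "dim c X = 0"
    using dim_le[of "{}" X c] by auto
qed

lemma dim_le_1:
  assumes pg: "pregeometry U c" and "finite X" "X \<subseteq> U" "dim c X \<le> 1"
  obtains "X \<subseteq> c {}" | y where "y \<in> X" "X \<subseteq> c {y}"
proof -
  obtain J where J: "finite J" "J \<subseteq> X" "X \<subseteq> c J" "card J = dim c X"
    using basis_exists[OF assms(1-3)] by metis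
  then consider "J = {}" | y where "J = {y}"
    using assms(4) by (cases "card J = 0") (auto simp: le_Suc_eq card_1_singleton_iff)
  then show thesis
    using J that by cases auto
qed

section \<open>Avoiding patterns on disjoint blocks\<close>

text \<open>Each pattern is attained on a proportion of at least \<open>1/2^t\<close> of the sets avoiding the
  previous ones, because overwriting a block by its pattern is at most \<open>2^t\<close> to one.\<close>

lemma card_avoid_patterns:
  fixes Om :: "'b set set"
  assumes fin: "finite Om"
    and disj: "\<And>i j. i < m \<Longrightarrow> j < m \<Longrightarrow> i \<noteq> j \<Longrightarrow> D i \<inter> D j = {}"
    and w: "\<And>i. i < m \<Longrightarrow> w i \<subseteq> D i"
    and D: "\<And>i. i < m \<Longrightarrow> finite (D i) \<and> card (D i) \<le> t"
    and ov: "\<And>i Q. i < m \<Longrightarrow> Q \<in> Om \<Longrightarrow> (Q - D i) \<union> w i \<in> Om"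
  shows "real (card {Q \<in> Om. \<forall>i < m. Q \<inter> D i \<noteq> w i}) \<le> (1 - 1 / 2 ^ t) ^ m * real (card Om)"
proof -
  define S where "S j = {Q \<in> Om. \<forall>i < j. Q \<inter> D i \<noteq> w i}" for j
  have "real (card (S j)) \<le> (1 - 1 / 2 ^ t) ^ j * real (card Om)" if "j \<le> m" for j
    using that
  proof (induction j)
    case 0
    then show ?case by (simp add: S_def)
  next
    case (Suc j)
    then have j: "j < m" by simp
    have finS: "finite (S j)" using fin by (simp add: S_def)
    define E where "E = {Q \<in> S j. Q \<inter> D j = w j}"
    have "finite E" using finS by (simp add: E_def)
    \<comment> \<open>The second component records what was overwritten. It ranges over
      \<open>Pow (D j)\<close>, whence the factor \<open>2 ^ t\<close>.\<close>
    let ?f = "\<lambda>Q. ((Q - D j) \<union> w j, Q \<inter> D j)"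
    have "inj_on ?f (S j)"
    proof (rule inj_onI)
      fix Q R assume eq: "?f Q = ?f R"
      then have eq1: "(Q - D j) \<union> w j = (R - D j) \<union> w j" and eq2: "Q \<inter> D j = R \<inter> D j" by simp_all
      have "x \<in> Q \<longleftrightarrow> x \<in> R" for x
      proof (cases "x \<in> D j")
        case True
        then show ?thesis using eq2 by blast
      next
        case False
        then have "x \<notin> w j" using w[OF j] by blast
        then show ?thesis using eq1 False by blast
      qed
      then show "Q = R" by blast
    qed
    moreover have "?f ` S j \<subseteq> E \<times> Pow (D j)"
    proof
      fix y assume "y \<in> ?f ` S j"
      then obtain Q where Q: "Q \<in> S j" "y = ?f Q" by auto
      \<comment> \<open>The blocks are disjoint, so overwriting block \<open>j\<close> creates no
        pattern on an earlier block.\<close>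
      have "(Q - D j \<union> w j) \<inter> D i = Q \<inter> D i" if "i < j" for i
        using disj[of i j] w[OF j] j that by auto
      then have "Q - D j \<union> w j \<in> S j"
        using Q ov[OF j, of Q] by (auto simp: S_def)
      moreover have "(Q - D j \<union> w j) \<inter> D j = w j" using w[OF j] by auto
      ultimately show "y \<in> E \<times> Pow (D j)" using Q by (auto simp: E_def)
    qed
    ultimately have "card (S j) \<le> card (E \<times> Pow (D j))"
      using \<open>finite E\<close> D[OF j] by (intro card_inj_on_le) auto
    also have "\<dots> \<le> card E * 2 ^ t"
      using D[OF j] by (simp add: card_cartesian_product card_Pow)
    finally have "real (card (S j)) \<le> real (card E * 2 ^ t)"
      by (rule of_nat_mono)
    then have "real (card (S j)) \<le> real (card E) * 2 ^ t"
      by simp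
    then have le: "real (card (S j)) / 2 ^ t \<le> real (card E)"
      by (simp add: divide_le_eq)
    have "S (Suc j) = S j - E"
      by (auto simp: S_def E_def less_Suc_eq)
    moreover have "E \<subseteq> S j" by (auto simp: E_def)
    ultimately have "real (card (S (Suc j))) = real (card (S j)) - real (card E)"
      using finS \<open>finite E\<close> by (simp add: card_Diff_subset card_mono of_nat_diff)
    also have "\<dots> \<le> (1 - 1 / 2 ^ t) * real (card (S j))"
      using le by (simp add: algebra_simps)
    also have "\<dots> \<le> (1 - 1 / 2 ^ t) * ((1 - 1 / 2 ^ t) ^ j * real (card Om))"
      using Suc by (intro mult_left_mono) auto
    finally show ?case by simp
  qed
  from this[of m] show ?thesis by (simp add: S_def)
qed


section \<open>Colourings as sets of labelled tuples\<close>

definition syms :: "nat \<Rightarrow> 'r set \<Rightarrow> ('p, 'r) lsym set" where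
  "syms l Rs = Col ` {1..l} \<union> Rel ` Rs"

text \<open>The value at \<open>Pre\<close> is a placeholder: \<open>ltuples\<close> contains only
  labels from \<open>syms\<close>.\<close>

definition symar :: "('r \<Rightarrow> nat) \<Rightarrow> ('p, 'r) lsym \<Rightarrow> nat" where
  "symar ar S = (case S of Pre p \<Rightarrow> 0 | Col i \<Rightarrow> 1 | Rel R \<Rightarrow> ar R)"

text \<open>The interpretation of all colours and relations together is one subset of this set, so
  that erasing, overwriting and symmetric differences become plain set operations.\<close>

definition ltuples :: "nat \<Rightarrow> 'r set \<Rightarrow> ('r \<Rightarrow> nat) \<Rightarrow> 'a set \<Rightarrow> (('p, 'r) lsym \<times> 'a list) set" where
  "ltuples l Rs ar X = Sigma (syms l Rs) (\<lambda>S. tuples X (symar ar S))"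

definition sharing :: "nat \<Rightarrow> (('p, 'r) lsym \<times> 'a list) set \<Rightarrow> 'a \<Rightarrow> 'a \<Rightarrow> bool" where
  "sharing l Q a b \<longleftrightarrow> (\<exists>i \<in> {1..l}. (Col i, [a]) \<in> Q \<and> (Col i, [b]) \<in> Q)"

text \<open>The colour clauses of \<open>coloured\<close>, relative to a set \<open>X\<close> so
  that they can be imposed on a closed piece and carried along isomorphisms.\<close>

definition colour_ok ::
  "nat \<Rightarrow> ('a set \<Rightarrow> 'a set) \<Rightarrow> 'a set \<Rightarrow> (('p, 'r) lsym \<times> 'a list) set \<Rightarrow> bool" where
  "colour_ok l c X Q \<longleftrightarrow>
     (\<forall>a \<in> X. (\<exists>i \<in> {1..l}. (Col i, [a]) \<in> Q) \<longleftrightarrow> a \<notin> c {}) \<and>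
     (\<forall>a \<in> X - c {}. \<forall>b \<in> X - c {}. a \<in> c {b} \<longrightarrow>
        (\<forall>i \<in> {1..l}. \<forall>j \<in> {1..l}. (Col i, [a]) \<in> Q \<and> (Col j, [b]) \<in> Q \<longrightarrow> i = j))"

text \<open>The flag \<open>s\<close> selects strong colourings.\<close>

definition permitted ::
  "bool \<Rightarrow> nat \<Rightarrow> ('a set \<Rightarrow> 'a set) \<Rightarrow> (('p, 'r) lsym \<times> 'a list) set \<Rightarrow> 'a set \<Rightarrow> bool" where
  "permitted s l c Q Z \<longleftrightarrow>
     (\<exists>b \<in> c Z - c {}. \<exists>d \<in> c Z - c {}. \<not> sharing l Q b d) \<and>
     (s \<longrightarrow> (\<forall>b \<in> c Z - c {}. \<forall>d \<in> c Z - c {}. b \<notin> c {d} \<longrightarrow> \<not> sharing l Q b d))"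

definition relations_ok ::
  "bool \<Rightarrow> nat \<Rightarrow> ('a set \<Rightarrow> 'a set) \<Rightarrow> (('p, 'r) lsym \<times> 'a list) set \<Rightarrow> bool" where
  "relations_ok s l c Q \<longleftrightarrow> (\<forall>R xs. (Rel R, xs) \<in> Q \<longrightarrow> permitted s l c Q (set xs))"

definition prune ::
  "bool \<Rightarrow> nat \<Rightarrow> ('a set \<Rightarrow> 'a set) \<Rightarrow> (('p, 'r) lsym \<times> 'a list) set \<Rightarrow>
   (('p, 'r) lsym \<times> 'a list) set" where
  "prune s l c Q = {x \<in> Q. \<forall>R. fst x = Rel R \<longrightarrow> permitted s l c Q (set (snd x))}"

definition dcut ::
  "('a set \<Rightarrow> 'a set) \<Rightarrow> nat \<Rightarrow> (('p, 'r) lsym \<times> 'a list) set \<Rightarrow> (('p, 'r) lsym \<times> 'a list) set" where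
  "dcut c d Q = {x \<in> Q. dim c (set (snd x)) \<le> d}"

lemma colour_okD:
  assumes "colour_ok l c X Q" "a \<in> X"
  shows "(\<exists>i \<in> {1..l}. (Col i, [a]) \<in> Q) \<longleftrightarrow> a \<notin> c {}"
  using assms by (simp add: colour_ok_def)

lemma colour_ok_unique:
  assumes "colour_ok l c X Q" "a \<in> X" "b \<in> X" "a \<notin> c {}" "b \<notin> c {}" "a \<in> c {b}"
    "i \<in> {1..l}" "j \<in> {1..l}" "(Col i, [a]) \<in> Q" "(Col j, [b]) \<in> Q"
  shows "i = j"
proof -
  note u = assms(1)[unfolded colour_ok_def, THEN conjunct2]
  show ?thesis
    using u[rule_format, of a b i j] assms by simp
qed

lemma colour_ok_subset:
  assumes ok: "colour_ok l c X Q" and Y: "Y \<subseteq> X"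
  shows "colour_ok l c Y Q"
  unfolding colour_ok_def
proof (intro conjI ballI impI; (elim conjE DiffE)?)
  show "(\<exists>i \<in> {1..l}. (Col i, [a]) \<in> Q) \<longleftrightarrow> a \<notin> c {}" if "a \<in> Y" for a
    using colour_okD[OF ok, of a] that Y by blast
next
  fix a b i j
  assume "a \<in> Y" "b \<in> Y" "a \<notin> c {}" "b \<notin> c {}" "a \<in> c {b}" "i \<in> {1..l}" "j \<in> {1..l}"
    "(Col i, [a]) \<in> Q" "(Col j, [b]) \<in> Q"
  moreover from this have "a \<in> X" "b \<in> X" using Y by blast+
  ultimately show "i = j" by (intro colour_ok_unique[OF ok])
qed

lemma sharing_cong:
  "(\<And>i a. (Col i, [a]) \<in> Q \<longleftrightarrow> (Col i, [a]) \<in> Q') \<Longrightarrow> sharing l Q = sharing l Q'"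
  by (intro ext) (simp add: sharing_def)

text \<open>Permission never looks at relation tuples. This is why the relations are free once the
  colours are fixed, and why pruning does not change what is permitted.\<close>

lemma permitted_cong:
  "(\<And>i a. (Col i, [a]) \<in> Q \<longleftrightarrow> (Col i, [a]) \<in> Q') \<Longrightarrow> permitted s l c Q Z = permitted s l c Q' Z"
  using sharing_cong[of Q Q' l] by (simp add: permitted_def)

lemma colour_ok_cong:
  "(\<And>i a. (Col i, [a]) \<in> Q \<longleftrightarrow> (Col i, [a]) \<in> Q') \<Longrightarrow> colour_ok l c X Q = colour_ok l c X Q'"
  by (simp add: colour_ok_def)

lemma Col_in_prune [simp]: "(Col i, xs) \<in> prune s l c Q \<longleftrightarrow> (Col i, xs) \<in> Q"
  by (simp add: prune_def)

lemma permitted_prune [simp]: "permitted s l c (prune s l c Q) Z = permitted s l c Q Z"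
  by (rule permitted_cong) simp

lemma prune_subset: "prune s l c Q \<subseteq> Q"
  by (auto simp: prune_def)

lemma dcut_subset: "dcut c d Q \<subseteq> Q"
  by (auto simp: dcut_def)

lemma dcut_dcut: "d \<le> e \<Longrightarrow> dcut c d (dcut c e Q) = dcut c d Q"
  by (auto simp: dcut_def)

lemma finite_syms: "finite Rs \<Longrightarrow> finite (syms l Rs)"
  by (simp add: syms_def)

lemma finite_tuples: "finite X \<Longrightarrow> finite (tuples X m)"
  using finite_lists_length_eq[of X m] by (simp add: tuples_def)

lemma card_tuples: "finite X \<Longrightarrow> card (tuples X m) = card X ^ m"
  using card_lists_length_eq[of X m] by (simp add: tuples_def)

lemma finite_ltuples: "finite Rs \<Longrightarrow> finite X \<Longrightarrow> finite (ltuples l Rs ar X)"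
  by (auto simp: ltuples_def intro!: finite_SigmaI finite_syms finite_tuples)

lemma card_ltuples_le:
  assumes "finite Rs" "finite X" "card X \<le> F"
  shows "card (ltuples l Rs ar X :: (('p, 'r) lsym \<times> 'a list) set)
    \<le> (\<Sum>S \<in> (syms l Rs :: ('p, 'r) lsym set). F ^ symar ar S)"
  using assms
  by (auto simp: ltuples_def card_SigmaI finite_syms finite_tuples card_tuples
      intro!: sum_mono power_mono)

lemma mem_ltuples:
  "(S, xs) \<in> ltuples l Rs ar X \<longleftrightarrow> S \<in> syms l Rs \<and> set xs \<subseteq> X \<and> length xs = symar ar S"
  by (auto simp: ltuples_def tuples_def)

lemma Col_in_ltuplesD:
  "(Col i, xs) \<in> ltuples l Rs ar X \<Longrightarrow> \<exists>a. xs = [a] \<and> a \<in> X \<and> 1 \<le> i \<and> i \<le> l"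
  by (auto simp: mem_ltuples symar_def syms_def length_Suc_conv)

text \<open>The parameter \<open>dummy\<close> only names the type of the symbols in \<open>Pre\<close>.\<close>

locale colouring =
  fixes U :: "'a set" and c :: "'a set \<Rightarrow> 'a set" and l :: nat and Rs :: "'r set"
    and ar :: "'r \<Rightarrow> nat" and s :: bool and dummy :: "'p itself"
  assumes pg: "pregeometry U c" and finU: "finite U" and l: "1 \<le> l"
    and Rs: "finite Rs" "Rs \<noteq> {}" "\<forall>R \<in> Rs. 2 \<le> ar R"
begin

abbreviation LT :: "(('p, 'r) lsym \<times> 'a list) set" where
  "LT \<equiv> ltuples l Rs ar U"

definition precolourings :: "(('p, 'r) lsym \<times> 'a list) set set" where
  "precolourings = {Q. Q \<subseteq> LT \<and> colour_ok l c U Q}"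

definition colourings :: "(('p, 'r) lsym \<times> 'a list) set set" where
  "colourings = {Q \<in> precolourings. relations_ok s l c Q}"

text \<open>Divided by the number of precolourings, its size is the probability that the pruned
  random set, cut at dimension \<open>r\<close>, equals \<open>Q\<close>.\<close>

abbreviation fibre :: "nat \<Rightarrow> (('p, 'r) lsym \<times> 'a list) set \<Rightarrow> (('p, 'r) lsym \<times> 'a list) set set" where
  "fibre r Q \<equiv> {w \<in> precolourings. dcut c r (prune s l c w) = Q}"

lemma finite_precolourings: "finite precolourings"
proof (rule finite_subset)
  show "precolourings \<subseteq> Pow LT" unfolding precolourings_def by (rule subsetI) simp
  show "finite (Pow LT)"
    using Rs(1) finU by (intro finite_Pow_iff[THEN iffD2] finite_ltuples)
qed

lemma precolourings_nonempty: "precolourings \<noteq> {}"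
proof -
  \<comment> \<open>A single colour is admissible, since dependent elements only have to
    agree.\<close>
  let ?Q = "(\<lambda>a. (Col 1, [a])) ` (U - c {}) :: (('p, 'r) lsym \<times> 'a list) set"
  have mem: "(Col i, [a]) \<in> ?Q \<longleftrightarrow> i = 1 \<and> a \<in> U \<and> a \<notin> c {}" for i a
    by auto
  have "?Q \<subseteq> LT"
    using l by (auto simp: mem_ltuples syms_def symar_def)
  moreover have "colour_ok l c U ?Q"
    unfolding colour_ok_def mem using l by simp
  ultimately have "?Q \<in> precolourings"
    by (simp add: precolourings_def)
  then show ?thesis by blast
qed

lemma prune_in_colourings: "w \<in> precolourings \<Longrightarrow> prune s l c w \<in> colourings"
proof -
  assume w: "w \<in> precolourings"
  then have "prune s l c w \<subseteq> LT"
    using prune_subset[of s l c w] by (auto simp: precolourings_def)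
  moreover have "colour_ok l c U (prune s l c w)"
    using w colour_ok_cong[of "prune s l c w" w] by (simp add: precolourings_def)
  moreover have "relations_ok s l c (prune s l c w)"
    by (auto simp: relations_ok_def) (simp add: prune_def)
  ultimately show ?thesis by (simp add: colourings_def precolourings_def)
qed

lemma colourings_subset: "colourings \<subseteq> precolourings"
  by (auto simp: colourings_def)

lemma finite_colourings: "finite colourings"
  using colourings_subset finite_precolourings by (rule finite_subset)

lemma colourings_nonempty: "colourings \<noteq> {}"
  using precolourings_nonempty prune_in_colourings by blast

lemma in_LT_D:
  assumes "(S, xs) \<in> LT"
  shows "set xs \<subseteq> U" "dim c (set xs) \<le> length xs"
proof -
  show "set xs \<subseteq> U" using assms by (simp add: mem_ltuples)
  then have "dim c (set xs) \<le> card (set xs)"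
    by (intro dim_le_card[OF pg]) auto
  then show "dim c (set xs) \<le> length xs"
    using card_length[of xs] by simp
qed

text \<open>All elements of the closure of a set of dimension one that lie outside the closure of the
  empty set have the same colour.\<close>

lemma not_permitted_of_dim_le_1:
  assumes ok: "colour_ok l c U Q" and Z: "finite Z" "Z \<subseteq> U" "dim c Z \<le> 1"
  shows "\<not> permitted s' l c Q Z"
  using Z
proof (rule dim_le_1[OF pg])
  assume "Z \<subseteq> c {}"
  then have "c Z \<subseteq> c {}" using Z cl_least[OF pg, of "{}" Z] by auto
  then show ?thesis by (auto simp: permitted_def)
next
  fix y assume y: "y \<in> Z" "Z \<subseteq> c {y}"
  then have yU: "y \<in> U" using Z by auto
  have sub: "c Z \<subseteq> c {y}" using Z y cl_least[OF pg, of "{y}" Z] by auto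
  have "sharing l Q b d" if b: "b \<in> c Z - c {}" and d: "d \<in> c Z - c {}" for b d
  proof -
    have U: "b \<in> U" "d \<in> U" using that cl_subset[OF pg Z(2)] by auto
    \<comment> \<open>Outside \<open>c {}\<close> dependence is symmetric, so \<open>b\<close>
      generates \<open>c {y}\<close> and hence \<open>d\<close>.\<close>
    have "y \<in> c {b}" using dependent_sym[OF pg, of b y] b sub U yU by auto
    then have "c {y} \<subseteq> c {b}" using cl_least[OF pg, of "{b}" "{y}"] U yU by auto
    then have db: "d \<in> c {b}" using d sub by auto
    obtain i where i: "i \<in> {1..l}" "(Col i, [b]) \<in> Q"
      using colour_okD[OF ok, of b] U b by auto
    obtain j where j: "j \<in> {1..l}" "(Col j, [d]) \<in> Q"
      using colour_okD[OF ok, of d] U d by auto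
    have "j = i"
      using colour_ok_unique[OF ok, of d b j i] U b d db i j by auto
    with i j show ?thesis by (auto simp: sharing_def)
  qed
  then show ?thesis by (auto simp: permitted_def)
qed

text \<open>Coloured elements lie outside \<open>c {}\<close>, and permitted tuples have dimension
  at least two; nothing is left in dimension zero. The measure at level 0 is thus a point
  mass.\<close>

lemma dcut_0_colouring: "Q \<in> colourings \<Longrightarrow> dcut c 0 Q = {}"
proof -
  assume Q: "Q \<in> colourings"
  then have sub: "Q \<subseteq> LT" and ok: "colour_ok l c U Q" and rel: "relations_ok s l c Q"
    by (auto simp: colourings_def precolourings_def)
  have False if x: "(S, xs) \<in> Q" "dim c (set xs) = 0" for S xs
  proof -
    have xs: "set xs \<subseteq> U" "S \<in> syms l Rs"
      using subsetD[OF sub x(1)] unfolding mem_ltuples by simp_all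
    then consider i where "S = Col i" | R where "S = Rel R" by (auto simp: syms_def)
    then show False
    proof cases
      case 1
      then obtain a where a: "xs = [a]" "a \<in> U" "1 \<le> i" "i \<le> l"
        using x sub Col_in_ltuplesD by blast
      then have "a \<in> c {}" using x xs dim_0_iff[OF pg, of "set xs"] by auto
      then show False using colour_okD[OF ok, of a] a x 1 by auto
    next
      case 2
      then have "permitted s l c Q (set xs)" using x rel by (auto simp: relations_ok_def)
      then show False
        using not_permitted_of_dim_le_1[OF ok, of "set xs" s] xs x by auto
    qed
  qed
  then show ?thesis by (auto simp: dcut_def)
qed

text \<open>A single element has dimension at most one, so from level 1 on a truncated set still
  carries all colours and thereby decides permission.\<close>

lemma Col_dcut_iff:
  assumes "Q \<subseteq> LT" "1 \<le> d"
  shows "(Col i, xs) \<in> dcut c d Q \<longleftrightarrow> (Col i, xs) \<in> Q"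
proof
  assume x: "(Col i, xs) \<in> Q"
  then have "length xs = 1" using assms Col_in_ltuplesD by fastforce
  then have "dim c (set xs) \<le> d" using in_LT_D(2)[of "Col i" xs] assms x by auto
  with x show "(Col i, xs) \<in> dcut c d Q" by (simp add: dcut_def)
qed (simp add: dcut_def)

text \<open>The symmetric difference with \<open>(Q - Q') \<union> (Q' - Q)\<close> maps one fibre into the other.\<close>

lemma card_fibre_le:
  assumes Q: "Q \<in> dcut c (Suc r) ` colourings" and Q': "Q' \<in> dcut c (Suc r) ` colourings"
    and eq: "dcut c r Q = dcut c r Q'"
  shows "card (fibre (Suc r) Q) \<le> card (fibre (Suc r) Q')"
proof -
  obtain P where P: "P \<in> colourings" "Q = dcut c (Suc r) P" using Q by auto
  obtain P' where P': "P' \<in> colourings" "Q' = dcut c (Suc r) P'" using Q' by auto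
  have PT: "P \<subseteq> LT" "P' \<subseteq> LT" and Pok: "colour_ok l c U P'" and Prel: "relations_ok s l c P'"
    using P P' by (auto simp: colourings_def precolourings_def)
  have QT: "Q \<subseteq> LT" "Q' \<subseteq> LT" using P P' PT dcut_subset by blast+
  let ?f = "\<lambda>w. {x. (x \<in> w) \<noteq> ((x \<in> Q) \<noteq> (x \<in> Q'))}"
  have "inj_on ?f (fibre (Suc r) Q)"
  proof (rule inj_onI)
    fix v w assume eq: "?f v = ?f w"
    have "x \<in> v \<longleftrightarrow> x \<in> w" for x
    proof -
      have "x \<in> ?f v \<longleftrightarrow> x \<in> ?f w" using eq by (rule arg_cong)
      then show ?thesis by (simp only: mem_Collect_eq) blast
    qed
    then show "v = w" by blast
  qed
  moreover have "?f w \<in> fibre (Suc r) Q'" if w: "w \<in> fibre (Suc r) Q" for w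
  proof -
    have wT: "w \<subseteq> LT" and wok: "colour_ok l c U w" and wQ: "dcut c (Suc r) (prune s l c w) = Q"
      using w by (auto simp: precolourings_def)
    have prT: "prune s l c w \<subseteq> LT" using prune_subset wT by blast
    have fT: "?f w \<subseteq> LT" using wT QT by auto
    \<comment> \<open>No colour is cut at level \<open>Suc r\<close>, so \<open>w\<close> has the
      colours of \<open>Q\<close>, and the shift turns them into those of \<open>Q'\<close>.\<close>
    have col: "(Col i, xs) \<in> w \<longleftrightarrow> (Col i, xs) \<in> Q" for i xs
      using Col_dcut_iff[OF prT, of "Suc r" i xs] by (simp add: wQ)
    have colf: "(Col i, xs) \<in> ?f w \<longleftrightarrow> (Col i, xs) \<in> Q'" for i xs
      using col by auto
    have colP: "(Col i, xs) \<in> P' \<longleftrightarrow> (Col i, xs) \<in> Q'" for i xs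
      using Col_dcut_iff[OF PT(2), of "Suc r" i xs] P' by simp
    have fok: "colour_ok l c U (?f w)"
      using Pok colour_ok_cong[of "?f w" P'] colf colP by simp
    have "(S, xs) \<in> dcut c (Suc r) (prune s l c (?f w)) \<longleftrightarrow> (S, xs) \<in> Q'" (is "?L \<longleftrightarrow> ?R") for S xs
    proof (cases "(S, xs) \<in> LT")
      case False
      then show ?thesis using fT QT prune_subset dcut_subset by blast
    next
      case True
      then have "S \<in> syms l Rs" by (simp add: mem_ltuples)
      then consider i where "S = Col i" | R where "S = Rel R" by (auto simp: syms_def)
      then show ?thesis
      proof cases
        case 1
        have "prune s l c (?f w) \<subseteq> LT" using fT prune_subset by blast
        then show ?thesis
          unfolding 1 using Col_dcut_iff[of "prune s l c (?f w)" "Suc r" i xs] colf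
          by (simp only: Col_in_prune)
      next
        case 2
        have xs: "finite (set xs)" "set xs \<subseteq> U" using True by (auto simp: mem_ltuples)
        show ?thesis
        proof (cases "dim c (set xs) \<le> 1")
          case True
          then have "\<not> permitted s l c (?f w) (set xs)" "\<not> permitted s l c P' (set xs)"
            using not_permitted_of_dim_le_1[OF fok] not_permitted_of_dim_le_1[OF Pok] xs by auto
          then show ?thesis
            using 2 Prel P' by (auto simp: dcut_def prune_def relations_ok_def)
        next
          case False
          show ?thesis
          proof (cases "dim c (set xs) \<le> Suc r")
            case True
            \<comment> \<open>A tuple of dimension at least two below level \<open>Suc r\<close>
              forces \<open>1 \<le> r\<close>. Then \<open>Q\<close> and \<open>Q'\<close>, which
              agree up to level \<open>r\<close>, have the same colours and hence the same permitted
              tuples; on these the shift exchanges \<open>Q\<close> for \<open>Q'\<close>.\<close>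
            then have r: "1 \<le> r" using False by simp
            have "(Col i, ys) \<in> Q \<longleftrightarrow> (Col i, ys) \<in> Q'" for i ys
              using Col_dcut_iff[OF QT(1) r, of i ys] Col_dcut_iff[OF QT(2) r, of i ys] eq by simp
            then have p: "permitted s l c w (set xs) = permitted s l c (?f w) (set xs)"
              "permitted s l c P' (set xs) = permitted s l c (?f w) (set xs)"
              using col colf colP by (auto intro!: permitted_cong)
            have wQ': "(S, xs) \<in> Q \<longleftrightarrow> (S, xs) \<in> w \<and> permitted s l c w (set xs)"
              using True 2 unfolding wQ[symmetric] by (simp add: dcut_def prune_def)
            have PQ': "(S, xs) \<in> Q' \<Longrightarrow> permitted s l c P' (set xs)"
              using Prel P' 2 by (auto simp: dcut_def relations_ok_def)
            have "?L \<longleftrightarrow> (S, xs) \<in> ?f w \<and> permitted s l c (?f w) (set xs)"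
              using True 2 by (simp add: dcut_def prune_def)
            then show ?thesis using p wQ' PQ' by auto
          next
            case False
            then show ?thesis using P' by (auto simp: dcut_def)
          qed
        qed
      qed
    qed
    then have "dcut c (Suc r) (prune s l c (?f w)) = Q'" by auto
    then show ?thesis using fT fok by (simp add: precolourings_def)
  qed
  ultimately show ?thesis
    using finite_precolourings by (intro card_inj_on_le[of ?f]) auto
qed

text \<open>The fibre at level \<open>r\<close> is the disjoint union of the fibres of all
  refinements to level \<open>Suc r\<close>, and these have equal size because
  \<open>card_fibre_le\<close> applies in both directions.\<close>

lemma card_fibre_step:
  assumes Q: "Q \<in> dcut c (Suc r) ` colourings"
  shows "card (fibre r (dcut c r Q)) =
    card {Q' \<in> dcut c (Suc r) ` colourings. dcut c r Q' = dcut c r Q} * card (fibre (Suc r) Q)"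
proof -
  let ?C = "{Q' \<in> dcut c (Suc r) ` colourings. dcut c r Q' = dcut c r Q}"
  have finC: "finite ?C" using finite_colourings by simp
  have un: "fibre r (dcut c r Q) = (\<Union>Q' \<in> ?C. fibre (Suc r) Q')"
  proof (intro set_eqI iffI)
    fix w assume "w \<in> fibre r (dcut c r Q)"
    then have w: "w \<in> precolourings" "dcut c r (prune s l c w) = dcut c r Q" by auto
    then have "dcut c (Suc r) (prune s l c w) \<in> ?C"
      using prune_in_colourings[OF w(1)] by (auto simp: dcut_dcut)
    with w show "w \<in> (\<Union>Q' \<in> ?C. fibre (Suc r) Q')" by blast
  next
    fix w assume "w \<in> (\<Union>Q' \<in> ?C. fibre (Suc r) Q')"
    then show "w \<in> fibre r (dcut c r Q)"
      by (auto simp: dcut_dcut[of r "Suc r" c "prune s l c w", symmetric])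
  qed
  have "card (fibre r (dcut c r Q)) = (\<Sum>Q' \<in> ?C. card (fibre (Suc r) Q'))"
    unfolding un using finC finite_precolourings by (intro card_UN_disjoint) auto
  also have "\<dots> = (\<Sum>Q' \<in> ?C. card (fibre (Suc r) Q))"
    using Q by (intro sum.cong refl antisym card_fibre_le) auto
  finally show ?thesis by simp
qed

lemma dcut_Max_colouring:
  assumes "Q \<in> colourings"
  shows "dcut c (Max (ar ` Rs)) Q = Q"
proof -
  have M: "ar R \<le> Max (ar ` Rs)" if "R \<in> Rs" for R
    using Rs that by simp
  obtain R0 where "R0 \<in> Rs" using Rs by auto
  \<comment> \<open>Colours have arity one and must be covered by the bound too; this is where a
    relation symbol has to exist.\<close>
  then have "2 \<le> Max (ar ` Rs)" using order_trans[OF _ M[of R0]] Rs by blast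
  have "dim c (set xs) \<le> Max (ar ` Rs)" if "(S, xs) \<in> Q" for S xs
  proof -
    have T: "(S, xs) \<in> LT" using assms that by (auto simp: colourings_def precolourings_def)
    then have "length xs \<le> Max (ar ` Rs)"
      using M \<open>2 \<le> Max (ar ` Rs)\<close> by (auto simp: mem_ltuples syms_def symar_def)
    then show ?thesis using in_LT_D(2)[OF T] by simp
  qed
  then show ?thesis by (auto simp: dcut_def)
qed

end

section \<open>The dimension conditional measure as an image of a uniform measure\<close>

text \<open>Puts a structure together from its reduct and its labelled tuples;
  \<open>expandE\<close> is the converse decomposition.\<close>

definition expand ::
  "('f, 'p, 'a) struct \<Rightarrow> (('p, 'r) lsym \<times> 'a list) set \<Rightarrow> ('f, ('p, 'r) lsym, 'a) struct" where
  "expand A Q = \<lparr>univ = univ A, fint = fint A,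
     rint = (\<lambda>S. case S of Pre p \<Rightarrow> rint A p | _ \<Rightarrow> {xs. (S, xs) \<in> Q})\<rparr>"

lemma univ_expand [simp]: "univ (expand A Q) = univ A"
  and fint_expand [simp]: "fint (expand A Q) = fint A"
  and rint_expand_Pre [simp]: "rint (expand A Q) (Pre P) = rint A P"
  and rint_expand_Col [simp]: "xs \<in> rint (expand A Q) (Col i) \<longleftrightarrow> (Col i, xs) \<in> Q"
  and rint_expand_Rel [simp]: "xs \<in> rint (expand A Q) (Rel R) \<longleftrightarrow> (Rel R, xs) \<in> Q"
  by (simp_all add: expand_def)

lemma reduct_expand [simp]: "reduct (expand A Q) = A"
  by (simp add: reduct_def expand_def)

lemma in_iff_rint_expand: "S \<in> syms l Rs \<Longrightarrow> (S, xs) \<in> Q \<longleftrightarrow> xs \<in> rint (expand A Q) S"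
  by (auto simp: syms_def)

text \<open>Pairs labelled \<open>Pre\<close> are invisible to \<open>expand\<close>, hence the
  restriction to \<open>ltuples\<close>.\<close>

lemma expand_inj:
  assumes "expand A Q = expand A Q'" "Q \<subseteq> ltuples l Rs ar X" "Q' \<subseteq> ltuples l Rs ar X"
  shows "Q = Q'"
proof -
  have "(S, xs) \<in> Q \<longleftrightarrow> (S, xs) \<in> Q'" for S xs
  proof (cases "S \<in> syms l Rs")
    case True
    then show ?thesis using in_iff_rint_expand[of S l Rs] assms(1) by metis
  next
    case False
    then show ?thesis using assms(2,3) by (auto simp: mem_ltuples dest!: subsetD)
  qed
  then show ?thesis by auto
qed

lemma full_vocab_simps [simp]:
  "fsyms (full_vocab V l Rs ar) = fsyms V" "farity (full_vocab V l Rs ar) = farity V"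
  "rsyms (full_vocab V l Rs ar) = Pre ` rsyms V \<union> syms l Rs"
  "rarity (full_vocab V l Rs ar) (Pre P) = rarity V P"
  by (auto simp: full_vocab_def syms_def)

lemma rarity_full_vocab: "S \<in> syms l Rs \<Longrightarrow> rarity (full_vocab V l Rs ar) S = symar ar S"
  by (auto simp: full_vocab_def syms_def symar_def)

lemma Pre_notin_syms [simp]: "Pre P \<notin> syms l Rs"
  by (auto simp: syms_def)

lemma is_struct_expand:
  assumes "is_struct V A" "Q \<subseteq> ltuples l Rs ar (univ A)"
  shows "is_struct (full_vocab V l Rs ar) (expand A Q)"
proof -
  have "rint (expand A Q) S \<subseteq> tuples (univ A) (rarity (full_vocab V l Rs ar) S)"
    if "S \<in> syms l Rs" for S
    using assms(2) that in_iff_rint_expand[OF that, of _ Q A]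
    by (auto simp: rarity_full_vocab mem_ltuples tuples_def dest!: subsetD)
  moreover have "rint (expand A Q) S = {}" if "S \<notin> Pre ` rsyms V \<union> syms l Rs" for S
  proof -
    have "(S, xs) \<notin> Q" for xs
      using that subsetD[OF assms(2), of "(S, xs)"] by (auto simp: mem_ltuples)
    moreover have "rint A P = {}" if "S = Pre P" for P
      using \<open>S \<notin> _\<close> that assms(1) by (auto simp: is_struct_def)
    ultimately show ?thesis by (cases S) auto
  qed
  ultimately show ?thesis
    using assms(1) unfolding is_struct_def by (auto simp: subset_iff)
qed

lemma expandE:
  assumes "is_struct (full_vocab V l Rs ar) M"
  obtains Q where "Q \<subseteq> ltuples l Rs ar (univ M)" "M = expand (reduct M) Q"
proof -
  let ?Q = "{(S, xs). S \<in> syms l Rs \<and> xs \<in> rint M S}"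
  have sub: "rint M S \<subseteq> tuples (univ M) (symar ar S)" if "S \<in> syms l Rs" for S
  proof -
    have "rint M S \<subseteq> tuples (univ M) (rarity (full_vocab V l Rs ar) S)"
      using assms that unfolding is_struct_def by simp
    then show ?thesis by (simp add: rarity_full_vocab[OF that])
  qed
  have "?Q \<subseteq> ltuples l Rs ar (univ M)"
    using sub unfolding ltuples_def by blast
  moreover have "rint M S = rint (expand (reduct M) ?Q) S" for S
  proof (cases "S \<in> syms l Rs")
    case True
    then show ?thesis using in_iff_rint_expand[OF True, of _ ?Q "reduct M"] by auto
  next
    case False
    show ?thesis
    proof (cases S)
      case (Pre P)
      then show ?thesis by (simp add: reduct_def)
    qed (use assms False in \<open>auto simp: is_struct_def\<close>)
  qed
  then have "rint M = rint (expand (reduct M) ?Q)" by (rule ext)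
  then have "M = expand (reduct M) ?Q"
    by (intro struct.equality) (simp_all add: reduct_def)
  ultimately show thesis by (rule that)
qed

lemma share_colour_expand: "share_colour l (expand A Q) a b \<longleftrightarrow> sharing l Q a b"
  by (simp add: share_colour_def sharing_def has_colour_def)

lemma relations_ok_iff:
  assumes "Q \<subseteq> ltuples l Rs ar X"
  shows "relations_ok s l c Q \<longleftrightarrow>
    (\<forall>R \<in> Rs. \<forall>xs. (Rel R, xs) \<in> Q \<longrightarrow> permitted s l c Q (set xs))"
proof -
  have "R \<in> Rs" if "(Rel R, xs) \<in> Q" for R xs
    using subsetD[OF assms that] by (auto simp: mem_ltuples syms_def)
  then show ?thesis unfolding relations_ok_def by blast
qed

lemma coloured_expand_iff:
  assumes pg: "pregeometry (univ A) (cl \<theta> A)" and Q: "Q \<subseteq> ltuples l Rs ar (univ A)"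
  shows "coloured \<theta> l Rs (expand A Q) \<longleftrightarrow>
      colour_ok l (cl \<theta> A) (univ A) Q \<and> relations_ok False l (cl \<theta> A) Q"
    and "strongly_coloured \<theta> l Rs (expand A Q) \<longleftrightarrow>
      colour_ok l (cl \<theta> A) (univ A) Q \<and> relations_ok True l (cl \<theta> A) Q"
proof -
  let ?c = "cl \<theta> A"
  \<comment> \<open>Recovers the second clause of \<open>coloured\<close>: permission asks for
    elements of the closure outside \<open>?c {}\<close>.\<close>
  have ne: "\<not> set xs \<subseteq> ?c {}" if "(Rel R, xs) \<in> Q" "permitted s l ?c Q (set xs)" for R xs s
  proof
    assume "set xs \<subseteq> ?c {}"
    moreover have "set xs \<subseteq> univ A" using that Q by (auto simp: mem_ltuples dest!: subsetD)
    ultimately have "?c (set xs) \<subseteq> ?c {}" using cl_least[OF pg, of "{}" "set xs"] by simp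
    then show False using that by (auto simp: permitted_def)
  qed
  have rel: "(\<forall>R \<in> Rs. \<forall>xs \<in> rint (expand A Q) (Rel R). P xs) \<longleftrightarrow>
      (\<forall>R \<in> Rs. \<forall>xs. (Rel R, xs) \<in> Q \<longrightarrow> P xs)" for P
    unfolding Ball_def rint_expand_Rel ..
  have cols: "colour_ok l ?c (univ A) Q \<longleftrightarrow>
     (\<forall>a \<in> univ A. (\<exists>i \<in> {1..l}. has_colour (expand A Q) i a) \<longleftrightarrow> a \<notin> ?c {}) \<and>
     (\<forall>a \<in> univ A - ?c {}. \<forall>b \<in> univ A - ?c {}. a \<in> ?c {b} \<longrightarrow>
        (\<forall>i \<in> {1..l}. \<forall>j \<in> {1..l}.
          has_colour (expand A Q) i a \<and> has_colour (expand A Q) j b \<longrightarrow> i = j))"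
    unfolding colour_ok_def has_colour_def rint_expand_Col ..
  have rels: "relations_ok False l ?c Q \<longleftrightarrow> (\<forall>R \<in> Rs. \<forall>xs. (Rel R, xs) \<in> Q \<longrightarrow>
        (\<exists>b \<in> ?c (set xs) - ?c {}. \<exists>d \<in> ?c (set xs) - ?c {}. \<not> sharing l Q b d))"
    unfolding relations_ok_iff[OF Q] permitted_def by (simp only: simp_thms)
  have rels': "relations_ok True l ?c Q \<longleftrightarrow> relations_ok False l ?c Q \<and>
      (\<forall>R \<in> Rs. \<forall>xs. (Rel R, xs) \<in> Q \<longrightarrow>
        (\<forall>b \<in> ?c (set xs) - ?c {}. \<forall>d \<in> ?c (set xs) - ?c {}.
          b \<notin> ?c {d} \<longrightarrow> \<not> sharing l Q b d))"
    unfolding relations_ok_iff[OF Q] permitted_def simp_thms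
    by (simp only: ball_conj_distrib all_conj_distrib imp_conjR)
  have ne': "relations_ok False l ?c Q \<Longrightarrow> \<forall>R \<in> Rs. \<forall>xs. (Rel R, xs) \<in> Q \<longrightarrow> \<not> set xs \<subseteq> ?c {}"
  proof (intro ballI allI impI)
    fix R xs assume "relations_ok False l ?c Q" "(Rel R, xs) \<in> Q"
    then show "\<not> set xs \<subseteq> ?c {}" using ne[of R xs False] by (simp add: relations_ok_def)
  qed
  show 1: "coloured \<theta> l Rs (expand A Q) \<longleftrightarrow>
      colour_ok l ?c (univ A) Q \<and> relations_ok False l ?c Q"
    unfolding coloured_def reduct_expand share_colour_expand rel cols univ_expand
    unfolding rels[symmetric] using ne' by argo
  show "strongly_coloured \<theta> l Rs (expand A Q) \<longleftrightarrow>
      colour_ok l ?c (univ A) Q \<and> relations_ok True l ?c Q"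
    unfolding strongly_coloured_def 1 reduct_expand share_colour_expand rel rels' by argo
qed

lemma iso_expand_iff:
  "iso (full_vocab V l Rs ar) p (restr (expand A Q) X) (restr (expand B Q') Y) \<longleftrightarrow>
     iso V p (restr A X) (restr B Y) \<and>
     (\<forall>S xs. (S, xs) \<in> ltuples l Rs ar X \<longrightarrow> ((S, xs) \<in> Q \<longleftrightarrow> (S, map p xs) \<in> Q'))"
proof -
  have *: "(\<forall>S \<in> syms l Rs. \<forall>xs \<in> tuples X (rarity (full_vocab V l Rs ar) S).
      xs \<in> rint (expand A Q) S \<longleftrightarrow> map p xs \<in> rint (expand B Q') S) \<longleftrightarrow>
    (\<forall>S xs. (S, xs) \<in> ltuples l Rs ar X \<longrightarrow> ((S, xs) \<in> Q \<longleftrightarrow> (S, map p xs) \<in> Q'))"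
    (is "?L \<longleftrightarrow> ?R")
  proof
    assume L: ?L
    show ?R
    proof (intro allI impI)
      fix S :: "('b, 'c) lsym" and xs assume x: "(S, xs) \<in> ltuples l Rs ar X"
      then have S: "S \<in> syms l Rs" by (simp add: mem_ltuples)
      have "xs \<in> tuples X (rarity (full_vocab V l Rs ar) S)"
        using x by (simp add: rarity_full_vocab[OF S] mem_ltuples tuples_def)
      then show "(S, xs) \<in> Q \<longleftrightarrow> (S, map p xs) \<in> Q'"
        using L[rule_format, OF S] in_iff_rint_expand[OF S, of xs Q A]
          in_iff_rint_expand[OF S, of "map p xs" Q' B] by simp
    qed
  next
    assume R: ?R
    show ?L
    proof (intro ballI)
      fix S :: "('b, 'c) lsym" and xs
      assume S: "S \<in> syms l Rs" and xs: "xs \<in> tuples X (rarity (full_vocab V l Rs ar) S)"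
      then have "(S, xs) \<in> ltuples l Rs ar X"
        by (simp add: rarity_full_vocab[OF S] mem_ltuples tuples_def)
      then show "xs \<in> rint (expand A Q) S \<longleftrightarrow> map p xs \<in> rint (expand B Q') S"
        using R[rule_format, of S xs] in_iff_rint_expand[OF S, of xs Q A]
          in_iff_rint_expand[OF S, of "map p xs" Q' B] by simp
    qed
  qed
  show ?thesis
    unfolding iso_restr_iff full_vocab_simps ball_Un * by simp
qed

lemma dim_restrict_expand: "dim_restrict \<theta> d (expand A Q) = expand A (dcut (cl \<theta> A) d Q)"
  unfolding dim_restrict_def reduct_expand
  by (auto simp: expand_def dcut_def fun_eq_iff split: lsym.splits)

text \<open>Induction on the level: passing from \<open>r\<close> to \<open>Suc r\<close> divides
  \<open>dc_prob\<close> by the number of refinements, and \<open>card_fibre_step\<close> says that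
  the fibre size is divided by the same number. At level 0 the fibre is the set of all
  precolourings.\<close>

lemma dc_prob_expand:
  assumes "colouring (univ A) (cl \<theta> A) l Rs ar"
    and "Q \<in> dcut (cl \<theta> A) r ` colouring.colourings (univ A) (cl \<theta> A) l Rs ar s"
  shows "dc_prob \<theta> (expand A ` colouring.colourings (univ A) (cl \<theta> A) l Rs ar s) r (expand A Q) *
      real (card (colouring.precolourings (univ A) (cl \<theta> A) l Rs ar
        :: (('p, 'r) lsym \<times> 'a list) set set)) =
    real (card {w \<in> colouring.precolourings (univ A) (cl \<theta> A) l Rs ar.
      dcut (cl \<theta> A) r (prune s l (cl \<theta> A) w) = (Q :: (('p, 'r) lsym \<times> 'a list) set)})"
proof -
  interpret colouring "univ A" "cl \<theta> A" l Rs ar s "TYPE('p)" by fact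
  let ?c = "cl \<theta> A"
  let ?K = "expand A ` colourings"
  have sub: "P \<subseteq> LT" if "P \<in> colourings" for P
    using that by (auto simp: colourings_def precolourings_def)
  have inj: "expand A P = expand A P' \<longleftrightarrow> P = P'" if "P \<subseteq> LT" "P' \<subseteq> LT" for P P'
    using expand_inj[of A P P' l Rs ar "univ A"] that by auto
  have dsub: "dcut ?c r P \<subseteq> LT" if "P \<in> colourings" for P r
    using sub[OF that] dcut_subset by blast
  show ?thesis
    using assms(2)
  proof (induction r arbitrary: Q)
    case 0
    then have Q: "Q = {}" using dcut_0_colouring by auto
    have "dim_restrict \<theta> 0 ` ?K = {expand A {}}"
      using colourings_nonempty by (auto simp: image_image dim_restrict_expand dcut_0_colouring)
    moreover have "fibre 0 Q = precolourings"
      using Q dcut_0_colouring prune_in_colourings by auto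
    ultimately show ?case by simp
  next
    case (Suc r)
    obtain P where P: "P \<in> colourings" "Q = dcut ?c (Suc r) P" using Suc.prems by auto
    have Qr: "dcut ?c r Q = dcut ?c r P" using P by (simp add: dcut_dcut)
    have IH: "dc_prob \<theta> ?K r (expand A (dcut ?c r Q)) * real (card precolourings) =
        real (card (fibre r (dcut ?c r Q)))"
      using P Qr by (intro Suc.IH) auto
    let ?C = "{Q' \<in> dcut ?c (Suc r) ` colourings. dcut ?c r Q' = dcut ?c r Q}"
    have "{M' \<in> dim_restrict \<theta> (Suc r) ` ?K. dim_restrict \<theta> r M' = dim_restrict \<theta> r (expand A Q)} =
        expand A ` ?C" (is "?D = _")
    proof (intro set_eqI iffI)
      fix M assume "M \<in> ?D"
      then obtain P' where P': "P' \<in> colourings" "M = expand A (dcut ?c (Suc r) P')"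
        "expand A (dcut ?c r P') = expand A (dcut ?c r P)"
        using Qr by (auto simp: dim_restrict_expand dcut_dcut)
      then have "dcut ?c r P' = dcut ?c r P" using dsub P by (simp add: inj)
      with P' Qr show "M \<in> expand A ` ?C" by (auto simp: dcut_dcut)
    next
      fix M assume "M \<in> expand A ` ?C"
      then show "M \<in> ?D" by (auto simp: dim_restrict_expand image_image)
    qed
    moreover have "inj_on (expand A) ?C"
      using dsub by (auto intro!: inj_onI simp: inj)
    ultimately have cC: "card ?D = card ?C" by (simp add: card_image)
    have "Q \<in> ?C" using P by auto
    moreover have "finite ?C" using finite_colourings by simp
    ultimately have pos: "card ?C \<noteq> 0" by auto
    have step: "card (fibre r (dcut ?c r Q)) = card ?C * card (fibre (Suc r) Q)"
      using Suc.prems by (rule card_fibre_step)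
    have "dc_prob \<theta> ?K (Suc r) (expand A Q) * real (card precolourings) =
        dc_prob \<theta> ?K r (expand A (dcut ?c r Q)) * real (card precolourings) / real (card ?C)"
      using cC by (simp add: dim_restrict_expand)
    also have "\<dots> = real (card (fibre (Suc r) Q))"
      unfolding IH step using pos by simp
    finally show ?case .
  qed
qed

text \<open>At the maximal arity nothing is cut any more, so the fibre of a colouring is its full
  preimage under \<open>prune\<close>. The fibres are disjoint, and summing their sizes counts the
  preimage of the event.\<close>

lemma dc_measure_expand:
  fixes X :: "('f, ('p, 'r) lsym, 'a) struct set"
  assumes col: "colouring (univ A) (cl \<theta> A) l Rs ar"
    and X: "X \<subseteq> expand A ` colouring.colourings (univ A) (cl \<theta> A) l Rs ar s"
  shows "dc_measure \<theta> Rs ar (expand A ` colouring.colourings (univ A) (cl \<theta> A) l Rs ar s) X =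
    real (card {w \<in> colouring.precolourings (univ A) (cl \<theta> A) l Rs ar.
      expand A (prune s l (cl \<theta> A) w) \<in> X}) /
    real (card (colouring.precolourings (univ A) (cl \<theta> A) l Rs ar
      :: (('p, 'r) lsym \<times> 'a list) set set))"
proof -
  interpret colouring "univ A" "cl \<theta> A" l Rs ar s "TYPE('p)" by fact
  let ?c = "cl \<theta> A"
  let ?K = "expand A ` colourings"
  let ?m = "Max (ar ` Rs)"
  have sub: "P \<subseteq> LT" if "P \<in> colourings" for P
    using that by (auto simp: colourings_def precolourings_def)
  have inj: "inj_on (expand A) colourings"
    using expand_inj sub by (intro inj_onI) blast
  define Y where "Y = {Q \<in> colourings. expand A Q \<in> X}"
  have XY: "X = expand A ` Y" using X by (auto simp: Y_def)
  have injY: "inj_on (expand A) Y" using inj by (rule inj_on_subset) (auto simp: Y_def)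
  have finY: "finite Y" using finite_colourings by (simp add: Y_def)
  have pos: "card precolourings \<noteq> 0"
    using precolourings_nonempty finite_precolourings by simp
  have "dc_measure \<theta> Rs ar ?K X * real (card precolourings) =
      (\<Sum>Q \<in> Y. dc_prob \<theta> ?K ?m (expand A Q) * real (card precolourings))"
    by (simp add: dc_measure_def XY sum.reindex[OF injY] sum_distrib_right)
  also have "\<dots> = (\<Sum>Q \<in> Y. real (card (fibre ?m Q)))"
  proof (intro sum.cong refl)
    fix Q assume "Q \<in> Y"
    then have "Q \<in> colourings" by (simp add: Y_def)
    then have "Q \<in> dcut ?c ?m ` colourings" using dcut_Max_colouring[of Q] by (metis imageI)
    then show "dc_prob \<theta> ?K ?m (expand A Q) * real (card precolourings) = real (card (fibre ?m Q))"
      by (rule dc_prob_expand[OF col])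
  qed
  also have "\<dots> = real (card (\<Union>Q \<in> Y. fibre ?m Q))"
    using finY finite_precolourings by (subst card_UN_disjoint) auto
  also have "(\<Union>Q \<in> Y. fibre ?m Q) = {w \<in> precolourings. expand A (prune s l ?c w) \<in> X}"
    using prune_in_colourings dcut_Max_colouring by (auto simp: Y_def)
  finally show ?thesis using pos by (simp add: field_simps)
qed

section \<open>Transfer along isomorphisms\<close>

lemma cl_iso:
  assumes iso: "iso V p A B" and A: "is_struct V A" and \<theta>: "pregeometry_formulas V \<theta>"
    and X: "X \<subseteq> univ A"
  shows "cl \<theta> B (p ` X) = p ` cl \<theta> A X"
proof -
  have surj: "p ` univ A = univ B" using iso_bij[OF iso] by (simp add: bij_betw_def)
  have "holds A (\<theta> (length as)) (as @ [a]) \<longleftrightarrow> holds B (\<theta> (length as)) (map p as @ [p a])"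
    if "set as \<subseteq> X" "a \<in> univ A" for as a
    unfolding holds_def
  proof (rule sat_iso[OF iso A])
    show "wf_fm V (\<theta> (length as))" using \<theta> by (simp add: pregeometry_formulas_def)
    show "\<forall>i \<in> fv (\<theta> (length as)). (as @ [a]) ! i \<in> univ A \<and> (map p as @ [p a]) ! i = p ((as @ [a]) ! i)"
    proof
      fix i assume "i \<in> fv (\<theta> (length as))"
      then have "i \<le> length as" using \<theta> by (auto simp: pregeometry_formulas_def)
      then have i: "i < length (as @ [a])" by simp
      have "(as @ [a]) ! i \<in> set (as @ [a])" using i by (rule nth_mem)
      then have "(as @ [a]) ! i \<in> univ A" using that X by auto
      moreover have "map p (as @ [a]) ! i = p ((as @ [a]) ! i)" using i by (rule nth_map)
      ultimately show "(as @ [a]) ! i \<in> univ A \<and> (map p as @ [p a]) ! i = p ((as @ [a]) ! i)" by simp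
    qed
  qed
  note key = this
  show ?thesis
  proof (intro set_eqI iffI)
    fix b assume "b \<in> cl \<theta> B (p ` X)"
    then obtain bs where b: "b \<in> univ B" "set bs \<subseteq> p ` X" "holds B (\<theta> (length bs)) (bs @ [b])"
      by (auto simp: cl_def)
    obtain a where a: "a \<in> univ A" "b = p a" using b surj by auto
    have "bs \<in> lists (p ` X)" using b by auto
    then obtain as where as: "bs = map p as" "set as \<subseteq> X" by (auto simp: lists_image)
    then show "b \<in> p ` cl \<theta> A X" using key[of as a] a b by (auto simp: cl_def)
  next
    fix b assume "b \<in> p ` cl \<theta> A X"
    then obtain a as where a: "b = p a" "a \<in> univ A" "set as \<subseteq> X" "holds A (\<theta> (length as)) (as @ [a])"
      by (auto simp: cl_def)
    then show "b \<in> cl \<theta> B (p ` X)"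
      using key[of as a] surj image_mono[OF a(3), of p] unfolding cl_def
      by (auto intro!: exI[of _ "map p as"])
  qed
qed

text \<open>What an isomorphism between closed pieces retains of the two ambient closure operators:
  they are compared only on subsets of \<open>X\<close>, whose closures stay inside
  \<open>X\<close>.\<close>

locale closure_map =
  fixes p :: "'a \<Rightarrow> 'b" and X :: "'a set" and c :: "'a set \<Rightarrow> 'a set" and c' :: "'b set \<Rightarrow> 'b set"
  assumes inj: "inj_on p X" and cl_image: "\<And>T. T \<subseteq> X \<Longrightarrow> c' (p ` T) = p ` c T"
    and cl_closed: "\<And>T. T \<subseteq> X \<Longrightarrow> c T \<subseteq> X"
begin

lemma cl_empty: "c' {} = p ` c {}"
  using cl_image[of "{}"] by simp

lemma mem_image_iff: "a \<in> X \<Longrightarrow> T \<subseteq> X \<Longrightarrow> p a \<in> p ` T \<longleftrightarrow> a \<in> T"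
  using inj by (rule inj_on_image_mem_iff)

lemma mem_cl_empty_iff: "a \<in> X \<Longrightarrow> p a \<in> c' {} \<longleftrightarrow> a \<in> c {}"
  by (simp add: cl_empty mem_image_iff cl_closed)

lemma mem_cl_singleton_iff: "a \<in> X \<Longrightarrow> b \<in> X \<Longrightarrow> p a \<in> c' {p b} \<longleftrightarrow> a \<in> c {b}"
  using cl_image[of "{b}"] cl_closed[of "{b}"] by (simp add: mem_image_iff)

lemma cl_diff: "Z \<subseteq> X \<Longrightarrow> c' (p ` Z) - c' {} = p ` (c Z - c {})"
  using inj_on_image_set_diff[OF inj, of "c Z" "c {}"] cl_closed[of Z] cl_closed[of "{}"]
  by (auto simp: cl_empty cl_image)

text \<open>Permission of \<open>Z\<close> reads colours inside the closure of \<open>Z\<close>,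
  which stays within \<open>X\<close>; agreement of the colours on \<open>X\<close> is therefore
  enough.\<close>

lemma permitted_transfer:
  assumes col: "\<And>i a. i \<in> {1..l} \<Longrightarrow> a \<in> X \<Longrightarrow> (Col i, [a]) \<in> Q \<longleftrightarrow> (Col i, [p a]) \<in> Q'"
    and Z: "Z \<subseteq> X"
  shows "permitted s l c' Q' (p ` Z) = permitted s l c Q Z"
proof -
  have sh: "sharing l Q' (p b) (p d) = sharing l Q b d" if "b \<in> X" "d \<in> X" for b d
    using col that by (auto simp: sharing_def)
  have sub: "b \<in> X" if "b \<in> c Z - c {}" for b
    using cl_closed[OF Z] that by auto
  show ?thesis
    unfolding permitted_def cl_diff[OF Z] by (auto simp: sh sub mem_cl_singleton_iff)
qed

lemma colour_ok_transfer:
  assumes col: "\<And>i a. i \<in> {1..l} \<Longrightarrow> a \<in> X \<Longrightarrow> (Col i, [a]) \<in> Q \<longleftrightarrow> (Col i, [p a]) \<in> Q'"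
  shows "colour_ok l c' (p ` X) Q' = colour_ok l c X Q"
proof -
  have ex: "(\<exists>i \<in> {1..l}. (Col i, [p a]) \<in> Q') \<longleftrightarrow> (\<exists>i \<in> {1..l}. (Col i, [a]) \<in> Q)"
    if "a \<in> X" for a
    using col that by (intro bex_cong) auto
  have e: "p ` X - c' {} = p ` (X - c {})"
    by (simp add: cl_empty inj_on_image_set_diff[OF inj] cl_closed)
  have "(\<forall>a \<in> p ` X. (\<exists>i \<in> {1..l}. (Col i, [a]) \<in> Q') \<longleftrightarrow> a \<notin> c' {}) \<longleftrightarrow>
      (\<forall>a \<in> X. (\<exists>i \<in> {1..l}. (Col i, [a]) \<in> Q) \<longleftrightarrow> a \<notin> c {})"
    by (simp add: mem_cl_empty_iff ex del: One_nat_def)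
  moreover have "(\<forall>a \<in> p ` (X - c {}). \<forall>b \<in> p ` (X - c {}). a \<in> c' {b} \<longrightarrow>
        (\<forall>i \<in> {1..l}. \<forall>j \<in> {1..l}. (Col i, [a]) \<in> Q' \<and> (Col j, [b]) \<in> Q' \<longrightarrow> i = j)) \<longleftrightarrow>
      (\<forall>a \<in> X - c {}. \<forall>b \<in> X - c {}. a \<in> c {b} \<longrightarrow>
        (\<forall>i \<in> {1..l}. \<forall>j \<in> {1..l}. (Col i, [a]) \<in> Q \<and> (Col j, [b]) \<in> Q \<longrightarrow> i = j))"
    by (simp add: mem_cl_singleton_iff col)
  ultimately show ?thesis unfolding colour_ok_def e by simp
qed

lemma dim_transfer: "dim c' (p ` X) = dim c X"
  using inj cl_image cl_closed by (rule dim_bij)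

end

lemma cl_subset_univ: "cl \<theta> A X \<subseteq> univ A"
  by (auto simp: cl_def)

lemma closure_map_iso:
  assumes "iso V p A B" "is_struct V A" "pregeometry_formulas V \<theta>"
  shows "closure_map p (univ A) (cl \<theta> A) (cl \<theta> B)"
  using assms cl_iso[OF assms] cl_subset_univ[of \<theta> A] by unfold_locales (auto simp: iso_def bij_betw_def)

lemma sdim_iso:
  assumes "iso V p A B" "is_struct V A" "pregeometry_formulas V \<theta>"
  shows "sdim \<theta> B = sdim \<theta> A"
proof -
  interpret closure_map p "univ A" "cl \<theta> A" "cl \<theta> B" using assms by (rule closure_map_iso)
  show ?thesis
    using dim_transfer iso_bij[OF assms(1)] by (simp add: sdim_def bij_betw_def)
qed

section \<open>Copying a structure over a prescribed substructure\<close>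

lemma extend_injection:
  assumes fin: "finite Z" and Y: "Y \<subseteq> Z" and p: "inj_on p Y" and inf: "infinite (UNIV :: 'b set)"
  obtains e :: "'a \<Rightarrow> 'b" where "inj_on e Z" "\<forall>y \<in> Y. e y = p y"
proof -
  have "finite (p ` Y)" using fin Y by (simp add: finite_subset)
  then have "infinite (- p ` Y)" using inf by (simp add: finite_compl)
  then obtain T where T: "T \<subseteq> - p ` Y" "finite T" "card T = card (Z - Y)"
    using infinite_arbitrarily_large by metis
  then obtain q where q: "bij_betw q (Z - Y) T"
    using fin by (metis finite_Diff finite_same_card_bij)
  let ?e = "\<lambda>z. if z \<in> Y then p z else q z"
  have "inj_on ?e Z"
  proof (rule inj_onI)
    fix x y assume xy: "x \<in> Z" "y \<in> Z" "?e x = ?e y"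
    have "q z \<in> T" if "z \<in> Z - Y" for z using q that by (auto simp: bij_betw_def)
    then have out: "q z \<notin> p ` Y" if "z \<in> Z - Y" for z using T that by blast
    show "x = y"
    proof (cases "x \<in> Y"; cases "y \<in> Y")
      assume "x \<in> Y" "y \<in> Y"
      then show ?thesis using xy p by (auto dest: inj_onD)
    next
      assume "x \<notin> Y" "y \<notin> Y"
      then show ?thesis using xy q by (auto simp: bij_betw_def dest: inj_onD)
    qed (use xy out in force)+
  qed
  then show thesis by (rule that) simp
qed

lemma tuples_imageE:
  assumes "xs \<in> tuples (p ` X) m"
  obtains ys where "ys \<in> tuples X m" "xs = map p ys"
proof -
  have "xs \<in> lists (p ` X)" using assms by (auto simp: tuples_def)
  then obtain ys where "xs = map p ys" "ys \<in> lists X" by (auto simp: lists_image)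
  with assms show thesis by (intro that[of ys]) (auto simp: tuples_def)
qed

text \<open>The given isomorphism extends to an injection of the whole universe, because an infinite
  type has room for the remaining elements. Transporting the structure along this injection yields a
  copy that contains the substructure on \<open>X\<close> literally, as the formulation of
  saturation demands.\<close>

lemma copy_over:
  fixes A :: "('f, 'p, 'a) struct" and B :: "('f, 'p, 'b) struct"
  assumes A: "is_struct V A" "finite (univ A)" and Y: "Y \<subseteq> univ A" "is_struct V (restr A Y)"
    and iso: "iso V p (restr A Y) (restr B X)" and B: "is_struct V (restr B X)"
    and inf: "infinite (UNIV :: 'b set)"
  obtains H :: "('f, 'p, 'b) struct" and e where
    "is_struct V H" "iso V e A H" "\<forall>y \<in> Y. e y = p y" "substructure V (restr B X) H"
proof -
  have bij: "bij_betw p Y X" using iso_bij[OF iso] by simp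
  obtain e where e: "inj_on e (univ A)" "\<forall>y \<in> Y. e y = p y"
    using extend_injection[OF A(2) Y(1) _ inf, of p] bij by (auto simp: bij_betw_def)
  let ?i = "inv_into (univ A) e"
  define H where "H = \<lparr>univ = e ` univ A, fint = (\<lambda>f xs. e (fint A f (map ?i xs))),
    rint = (\<lambda>R. map e ` rint A R)\<rparr>"
  have H: "univ H = e ` univ A" "fint H f xs = e (fint A f (map ?i xs))" "rint H R = map e ` rint A R"
    for f xs R
    by (simp_all add: H_def)
  have inv: "map ?i (map e xs) = xs" if "xs \<in> tuples (univ A) m" for xs m
    using that e(1) by (auto simp: tuples_def intro!: map_idI)
  have rsub: "rint A R \<subseteq> tuples (univ A) (rarity V R)" if "R \<in> rsyms V" for R
    using A(1) that by (simp add: is_struct_def)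
  have "is_struct V H"
    unfolding is_struct_def H
  proof (intro conjI ballI allI impI)
    fix f xs assume f: "f \<in> fsyms V" and xs: "xs \<in> tuples (e ` univ A) (farity V f)"
    obtain ys where ys: "ys \<in> tuples (univ A) (farity V f)" "xs = map e ys" using tuples_imageE[OF xs] by blast
    then have "map ?i xs = ys" using inv by simp
    then show "e (fint A f (map ?i xs)) \<in> e ` univ A"
      using A(1) f ys by (simp add: is_struct_def)
  next
    fix R assume "R \<in> rsyms V"
    then show "map e ` rint A R \<subseteq> tuples (e ` univ A) (rarity V R)"
      using rsub by (fastforce simp: tuples_def)
  next
    fix R assume "R \<notin> rsyms V"
    then show "map e ` rint A R = {}" using A(1) by (simp add: is_struct_def)
  qed
  moreover have isoH: "iso V e A H"
    unfolding iso_def H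
  proof (intro conjI ballI)
    show "bij_betw e (univ A) (e ` univ A)" using e(1) by (simp add: bij_betw_def)
    fix f xs assume xs: "xs \<in> tuples (univ A) (farity V f)"
    show "e (fint A f xs) = e (fint A f (map ?i (map e xs)))" using inv[OF xs] by simp
  next
    fix R xs assume R: "R \<in> rsyms V" and xs: "xs \<in> tuples (univ A) (rarity V R)"
    show "xs \<in> rint A R \<longleftrightarrow> map e xs \<in> map e ` rint A R"
    proof
      assume "map e xs \<in> map e ` rint A R"
      then obtain ys where ys: "ys \<in> rint A R" "map e xs = map e ys" by auto
      then have "ys \<in> tuples (univ A) (rarity V R)" using rsub[OF R] by auto
      then have "xs = ys" using inv[OF xs] inv[of ys] ys by metis
      with ys show "xs \<in> rint A R" by simp
    qed auto
  qed
  moreover have "substructure V (restr B X) H"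
  proof -
    have isoY: "iso V e (restr A Y) (restr B X)"
      using iso_cong[OF iso _ Y(2), of e] e by simp
    then have XY: "X = e ` Y" using iso_bij[OF isoY] by (simp add: bij_betw_def)
    have subt: "ys \<in> tuples (univ A) m" if "ys \<in> tuples Y m" for ys m
      using that Y(1) by (auto simp: tuples_def)
    show ?thesis
      unfolding substructure_iff_restr univ_restr
    proof (intro conjI ballI)
      show "X \<subseteq> univ H" using XY Y(1) H by auto
    next
      fix f xs assume f: "f \<in> fsyms V" and "xs \<in> tuples X (farity V f)"
      then obtain ys where ys: "ys \<in> tuples Y (farity V f)" "xs = map e ys"
        unfolding XY using tuples_imageE by blast
      have "fint B f xs = e (fint A f ys)"
        using isoY f ys unfolding iso_restr_iff by simp
      moreover have "fint H f xs = e (fint A f ys)"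
        using isoH f subt[OF ys(1)] ys(2) unfolding iso_def by simp
      ultimately show "fint (restr B X) f xs = fint H f xs" by (simp add: restr_def)
    next
      fix R xs assume R: "R \<in> rsyms V" and xs: "xs \<in> tuples X (rarity V R)"
      then obtain ys where ys: "ys \<in> tuples Y (rarity V R)" "xs = map e ys"
        unfolding XY using tuples_imageE by blast
      have "xs \<in> rint B R \<longleftrightarrow> ys \<in> rint A R"
        using isoY R ys unfolding iso_restr_iff by simp
      moreover have "xs \<in> rint H R \<longleftrightarrow> ys \<in> rint A R"
        using isoH R subt[OF ys(1)] ys(2) unfolding iso_def by simp
      ultimately show "xs \<in> rint (restr B X) R \<longleftrightarrow> xs \<in> rint H R"
        using xs by (simp add: restr_def tuples_def)
    qed (rule B)
  qed
  ultimately show thesis using e(2) that by blast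
qed

section \<open>The family of pregeometries\<close>

text \<open>The flag \<open>s\<close> is a parameter, so that the coloured and the strongly coloured
  structures are two instances of one argument.\<close>

locale coloured_family =
  fixes V :: "('f, 'p) vocab" and \<theta> :: "nat \<Rightarrow> ('f, 'p) fm" and G :: "nat \<Rightarrow> ('f, 'p, 'a) struct"
    and l :: nat and Rs :: "'r set" and ar :: "'r \<Rightarrow> nat" and s :: bool
  assumes l: "2 \<le> l" and Rs: "finite Rs" "Rs \<noteq> {}" "\<forall>R \<in> Rs. 2 \<le> ar R"
    and formulas: "pregeometry_formulas V \<theta>"
    and pregeometries: "finite_pregeometries V \<theta> G"
    and bounded: "bounded_closures V \<theta> G"
    and agree: "closures_agree V \<theta> G"
    and substructures: "closed_under_substructures V \<theta> G"
    and saturated: "\<forall>k. polynomially_saturated V \<theta> G k"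
begin

abbreviation U :: "nat \<Rightarrow> 'a set" where "U n \<equiv> univ (G n)"
abbreviation c :: "nat \<Rightarrow> 'a set \<Rightarrow> 'a set" where "c n \<equiv> cl \<theta> (G n)"
abbreviation L :: "('f, ('p, 'r) lsym) vocab" where "L \<equiv> full_vocab V l Rs ar"
abbreviation lt :: "'a set \<Rightarrow> (('p, 'r) lsym \<times> 'a list) set" where "lt \<equiv> ltuples l Rs ar"
abbreviation precol :: "nat \<Rightarrow> (('p, 'r) lsym \<times> 'a list) set set" where
  "precol n \<equiv> colouring.precolourings (U n) (c n) l Rs ar"
abbreviation cols :: "nat \<Rightarrow> (('p, 'r) lsym \<times> 'a list) set set" where
  "cols n \<equiv> colouring.colourings (U n) (c n) l Rs ar s"

definition closed :: "nat \<Rightarrow> 'a set \<Rightarrow> bool" where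
  "closed n X \<longleftrightarrow> X \<subseteq> U n \<and> c n X = X"

lemma G_struct: "is_struct V (G n)" and finU: "finite (U n)" and pg: "pregeometry (U n) (c n)"
  using pregeometries by (auto simp: finite_pregeometries_def defines_pregeometry_def)

lemma col: "colouring (U n) (c n) l Rs ar"
  using pg finU l Rs by unfold_locales auto

text \<open>All universes live in one type, whose cardinality would otherwise bound the
  dimensions.\<close>

lemma infinite_type: "infinite (UNIV :: 'a set)"
proof
  assume fin: "finite (UNIV :: 'a set)"
  have "filterlim (\<lambda>n. sdim \<theta> (G n)) at_top sequentially"
    using substructures by (simp add: closed_under_substructures_def)
  then have "\<forall>\<^sub>F n in sequentially. Suc (card (UNIV :: 'a set)) \<le> sdim \<theta> (G n)"
    by (simp add: filterlim_at_top)
  then obtain n where "Suc (card (UNIV :: 'a set)) \<le> sdim \<theta> (G n)"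
    by (auto simp: eventually_sequentially)
  moreover have "sdim \<theta> (G n) \<le> card (U n)"
    unfolding sdim_def by (rule dim_le_card[OF pg finU]) simp
  moreover have "card (U n) \<le> card (UNIV :: 'a set)" using fin by (intro card_mono) auto
  ultimately show False by simp
qed

lemma closedD: "closed n X \<Longrightarrow> X \<subseteq> U n" "closed n X \<Longrightarrow> c n X = X" "closed n X \<Longrightarrow> finite X"
  using finU by (auto simp: closed_def intro: finite_subset)

lemma cl_subset_closed: "closed n X \<Longrightarrow> T \<subseteq> X \<Longrightarrow> c n T \<subseteq> X"
  using cl_mono[OF pg, of T X n] by (simp add: closed_def)

lemma closed_cl: "T \<subseteq> U n \<Longrightarrow> closed n (c n T)"
  using cl_subset[OF pg, of T n] cl_idem[OF pg, of T n] by (simp add: closed_def)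

lemma closed_U: "closed n (U n)"
  using cl_subset[OF pg, of "U n" n] cl_extensive[OF pg, of "U n" n] by (auto simp: closed_def)

lemma closed_substructure_restr:
  assumes "closed n X"
  shows "closed_substructure V (c n) (restr (G n) X) (G n)"
proof -
  obtain A where "substructure V A (G n)" "univ A = X"
    using bounded assms unfolding bounded_closures_def closed_def by metis
  then show ?thesis
    using substructure_restr[OF G_struct, of A n] closedD(2)[OF assms]
    by (simp add: closed_substructure_def)
qed

lemma is_struct_restr_G: "closed n X \<Longrightarrow> is_struct V (restr (G n) X)"
  using closed_substructure_restr by (simp add: closed_substructure_def substructure_def)

lemma closed_of_closed_substructure:
  "closed_substructure V (c n) A (G n) \<Longrightarrow> closed n (univ A)"
  by (simp add: closed_substructure_def closed_def substructure_def)

lemma cl_restr: "closed n X \<Longrightarrow> T \<subseteq> X \<Longrightarrow> cl \<theta> (restr (G n) X) T = c n T"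
  using agree closed_substructure_restr[of n X] unfolding closures_agree_def by (metis univ_restr)

text \<open>The formulas \<open>\<theta>\<close> may contain quantifiers, so a local isomorphism
  says nothing directly about ambient closures. It transports them because
  \<open>closures_agree\<close> identifies them, on both sides, with the closures computed inside
  the closed pieces.\<close>

lemma closure_map_G:
  assumes X: "closed m X" and Y: "closed n Y" and iso: "iso V p (restr (G m) X) (restr (G n) Y)"
  shows "closure_map p X (c m) (c n)"
proof -
  interpret closure_map p X "cl \<theta> (restr (G m) X)" "cl \<theta> (restr (G n) Y)"
    using closure_map_iso[OF iso is_struct_restr_G[OF X] formulas] by simp
  have pX: "p ` X = Y" using iso_bij[OF iso] by (simp add: bij_betw_def)
  show ?thesis
  proof
    show "inj_on p X" by (rule inj)
    fix T assume T: "T \<subseteq> X"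
    then show "c n (p ` T) = p ` c m T"
      using cl_image[OF T] cl_restr[OF X T] cl_restr[OF Y, of "p ` T"] pX by auto
    show "c m T \<subseteq> X" using cl_subset_closed[OF X T] .
  qed
qed

lemma dim_iso:
  assumes X: "closed m X" and Y: "closed n Y" and iso: "iso V p (restr (G m) X) (restr (G n) Y)"
  shows "dim (c n) Y = dim (c m) X"
proof -
  interpret closure_map p X "c m" "c n" using X Y iso by (rule closure_map_G)
  have "p ` X = Y" using iso_bij[OF iso] by (simp add: bij_betw_def)
  then show ?thesis using dim_transfer by simp
qed

lemma sdim_restr:
  assumes X: "closed n X"
  shows "sdim \<theta> (restr (G n) X) = dim (c n) X"
  unfolding sdim_def univ_restr
  by (intro dim_cong) (auto simp: cl_restr[OF X] dest: cl_subset_closed[OF X])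

text \<open>Saturation in the form used later: the extension to be copied is given inside a member
  of the family and attached along an isomorphism \<open>p\<close>, instead of over a literally
  shared substructure.\<close>

definition many_extensions :: "nat \<Rightarrow> (nat \<Rightarrow> nat) \<Rightarrow> bool" where
  "many_extensions k \<Lambda> \<longleftrightarrow> (\<forall>m n X Y Z p. closed m Y \<and> closed m Z \<and> closed n X \<and> Y \<subset> Z \<and>
     dim (c m) Z = dim (c m) Y + 1 \<and> dim (c m) Z \<le> k \<and> iso V p (restr (G m) Y) (restr (G n) X) \<longrightarrow>
     (\<exists>W q. (\<forall>i < \<Lambda> n. closed n (W i) \<and> iso V (q i) (restr (G m) Z) (restr (G n) (W i)) \<and>
        (\<forall>y \<in> Y. q i y = p y)) \<and>
        (\<forall>i < \<Lambda> n. \<forall>j < \<Lambda> n. i \<noteq> j \<longrightarrow> W i \<inter> W j = X)))"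

text \<open>Saturation only speaks about extensions of closed substructures of \<open>G n\<close>, so \<open>G m\<close> is first
  copied over \<open>X\<close>.\<close>

lemma saturation:
  obtains \<Lambda> :: "nat \<Rightarrow> nat" and P :: "real poly" where
    "filterlim \<Lambda> at_top sequentially"
    "\<And>n. real (card (U n)) \<le> poly P (real (\<Lambda> n))"
    "many_extensions k \<Lambda>"
proof -
  obtain \<Lambda> P where *: "filterlim \<Lambda> at_top sequentially \<and>
      (\<forall>n. \<Lambda> n \<le> card (U n) \<and> real (card (U n)) \<le> poly P (real (\<Lambda> n))) \<and>
      (\<forall>n A H B. closed_substructure V (c n) A (G n) \<and> is_struct V H \<and>
         (\<exists>m. isomorphic V H (G m)) \<and> closed_substructure V (cl \<theta> H) A H \<and>
         closed_substructure V (cl \<theta> H) B H \<and> univ A \<subset> univ B \<and>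
         sdim \<theta> A + 1 = sdim \<theta> B \<and> sdim \<theta> B \<le> k \<longrightarrow>
         (\<exists>C :: nat \<Rightarrow> ('f, 'p, 'a) struct.
            (\<forall>i < \<Lambda> n. closed_substructure V (c n) (C i) (G n) \<and>
               (\<exists>h. iso V h B (C i) \<and> (\<forall>a \<in> univ A. h a = a))) \<and>
            (\<forall>i < \<Lambda> n. \<forall>j < \<Lambda> n. i \<noteq> j \<longrightarrow> univ (C i) \<inter> univ (C j) = univ A)))"
    using saturated[rule_format, of k, unfolded polynomially_saturated_def] by (elim exE)
  note lim = *[THEN conjunct1] and bd = *[THEN conjunct2, THEN conjunct1]
    and sat = *[THEN conjunct2, THEN conjunct2, THEN spec, THEN spec, THEN spec, THEN spec, THEN mp]
  have "many_extensions k \<Lambda>"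
    unfolding many_extensions_def
  proof (intro allI impI, elim conjE)
    fix m n X Y Z p
    assume Y: "closed m Y" and Z: "closed m Z" and X: "closed n X" and YZ: "Y \<subset> Z"
      and d: "dim (c m) Z = dim (c m) Y + 1" "dim (c m) Z \<le> k"
      and iso: "iso V p (restr (G m) Y) (restr (G n) X)"
    obtain H :: "('f, 'p, 'a) struct" and e where H: "is_struct V H" and e: "iso V e (G m) H"
      and ep: "\<forall>y \<in> Y. e y = p y" and subX: "substructure V (restr (G n) X) H"
      using copy_over[OF G_struct finU closedD(1)[OF Y] is_struct_restr_G[OF Y] iso
        is_struct_restr_G[OF X] infinite_type] by blast
    interpret H: closure_map e "U m" "c m" "cl \<theta> H"
      using e G_struct formulas by (rule closure_map_iso)
    \<comment> \<open>The image of \<open>Y\<close> in the copy is \<open>X\<close> itself, so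
      \<open>restr (G n) X\<close> is a closed substructure of both \<open>G n\<close> and
      \<open>H\<close>.\<close>
    have eY: "e ` Y = X"
      using iso_bij[OF iso] ep by (auto simp: bij_betw_def)
    have eU: "e ` U m = univ H" using iso_bij[OF e] by (simp add: bij_betw_def)
    have isoZ: "iso V e (restr (G m) Z) (restr H (e ` Z))"
      using iso_restr_mono[of V e "G m" "U m" H "univ H" Z] e closedD(1)[OF Z]
      by (simp add: restr_univ[OF G_struct] restr_univ[OF H])
    have clX: "cl \<theta> H X = X"
      using H.cl_image[of Y] closedD[OF Y] eY by simp
    have clZ: "cl \<theta> H (e ` Z) = e ` Z"
      using H.cl_image[of Z] closedD[OF Z] by simp
    have "is_struct V (restr H (e ` Z))"
    proof (rule is_struct_restr[OF H])
      show "e ` Z \<subseteq> univ H" using closedD(1)[OF Z] eU by auto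
      show "\<forall>f \<in> fsyms V. \<forall>xs \<in> tuples (e ` Z) (farity V f). fint H f xs \<in> e ` Z"
      proof (intro ballI)
        fix f xs assume f: "f \<in> fsyms V" and xs: "xs \<in> tuples (e ` Z) (farity V f)"
        obtain zs where zs: "zs \<in> tuples Z (farity V f)" "xs = map e zs"
          using tuples_imageE[OF xs] by blast
        have "fint (G m) f zs \<in> Z"
          using is_struct_restr_G[OF Z] f zs(1) by (simp add: is_struct_def restr_def)
        moreover have "fint H f xs = e (fint (G m) f zs)"
          using isoZ f zs unfolding iso_restr_iff by simp
        ultimately show "fint H f xs \<in> e ` Z" by simp
      qed
    qed
    then have "substructure V (restr H (e ` Z)) H"
      using closedD(1)[OF Z] eU by (auto simp: substructure_iff_restr restr_def tuples_def)
    then have subZ: "closed_substructure V (cl \<theta> H) (restr H (e ` Z)) H"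
      using clZ by (simp add: closed_substructure_def)
    have sdX: "sdim \<theta> (restr (G n) X) = dim (c m) Y"
      using sdim_restr[OF X] dim_iso[OF Y X iso] by simp
    have sdZ: "sdim \<theta> (restr H (e ` Z)) = dim (c m) Z"
      using sdim_iso[OF isoZ is_struct_restr_G[OF Z] formulas] sdim_restr[OF Z] by simp
    have psub: "X \<subset> e ` Z"
    proof -
      obtain z where "z \<in> Z" "z \<notin> Y" using YZ by auto
      then have "e z \<notin> e ` Y"
        using H.mem_image_iff[of z Y] closedD(1)[OF Y] closedD(1)[OF Z] by auto
      then show ?thesis using eY YZ \<open>z \<in> Z\<close> by auto
    qed
    have "isomorphic V H (G m)"
      using iso_inv[OF e G_struct] by (auto simp: isomorphic_def)
    moreover have "closed_substructure V (cl \<theta> H) (restr (G n) X) H"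
      using subX clX by (simp add: closed_substructure_def)
    ultimately have "closed_substructure V (c n) (restr (G n) X) (G n) \<and> is_struct V H \<and>
         (\<exists>m. isomorphic V H (G m)) \<and> closed_substructure V (cl \<theta> H) (restr (G n) X) H \<and>
         closed_substructure V (cl \<theta> H) (restr H (e ` Z)) H \<and>
         univ (restr (G n) X) \<subset> univ (restr H (e ` Z)) \<and>
         sdim \<theta> (restr (G n) X) + 1 = sdim \<theta> (restr H (e ` Z)) \<and> sdim \<theta> (restr H (e ` Z)) \<le> k"
      unfolding univ_restr sdX sdZ using closed_substructure_restr[OF X] H subZ d psub by auto
    from sat[OF this] obtain C :: "nat \<Rightarrow> ('f, 'p, 'a) struct" where
      C: "\<forall>i < \<Lambda> n. closed_substructure V (c n) (C i) (G n) \<and>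
           (\<exists>h. iso V h (restr H (e ` Z)) (C i) \<and> (\<forall>a \<in> X. h a = a))"
      and int: "\<forall>i < \<Lambda> n. \<forall>j < \<Lambda> n. i \<noteq> j \<longrightarrow> univ (C i) \<inter> univ (C j) = X"
      unfolding univ_restr by (elim exE conjE)
    obtain h where h: "\<forall>i < \<Lambda> n. iso V (h i) (restr H (e ` Z)) (C i) \<and> (\<forall>a \<in> X. h i a = a)"
      using C by metis
    have "closed n (univ (C i)) \<and> iso V (h i \<circ> e) (restr (G m) Z) (restr (G n) (univ (C i))) \<and>
        (\<forall>y \<in> Y. (h i \<circ> e) y = p y)" if i: "i < \<Lambda> n" for i
    proof (intro conjI)
      have Ci: "closed_substructure V (c n) (C i) (G n)" using C i by blast
      then show "closed n (univ (C i))" by (rule closed_of_closed_substructure)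
      have "iso V id (C i) (restr (G n) (univ (C i)))"
        using Ci by (intro substructure_iso_restr) (simp add: closed_substructure_def)
      then have "iso V (id \<circ> (h i \<circ> e)) (restr (G m) Z) (restr (G n) (univ (C i)))"
        using h i isoZ by (intro iso_comp[where B = "C i"] iso_comp[where B = "restr H (e ` Z)"]) auto
      then show "iso V (h i \<circ> e) (restr (G m) Z) (restr (G n) (univ (C i)))" by simp
      show "\<forall>y \<in> Y. (h i \<circ> e) y = p y"
        using h i ep eY by fastforce
    qed
    with int show "\<exists>W q. (\<forall>i < \<Lambda> n. closed n (W i) \<and>
        iso V (q i) (restr (G m) Z) (restr (G n) (W i)) \<and> (\<forall>y \<in> Y. q i y = p y)) \<and>
        (\<forall>i < \<Lambda> n. \<forall>j < \<Lambda> n. i \<noteq> j \<longrightarrow> W i \<inter> W j = X)"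
      by (intro exI[of _ "\<lambda>i. univ (C i)"] exI[of _ "\<lambda>i. h i \<circ> e"]) auto
  qed
  with lim bd show thesis by (intro that[of \<Lambda> P]) auto
qed

section \<open>Extension problems\<close>

text \<open>A configuration \<open>(X, Y, D)\<close> poses the problem of realising \<open>D\<close> over \<open>X\<close>.\<close>

definition configurations :: "nat \<Rightarrow> nat \<Rightarrow> ('a set \<times> 'a set \<times> (('p, 'r) lsym \<times> 'a list) set) set" where
  "configurations k n = {(X, Y, D). closed n X \<and> closed n Y \<and> X \<subset> Y \<and>
     dim (c n) Y = dim (c n) X + 1 \<and> dim (c n) Y \<le> k \<and>
     D \<subseteq> lt Y \<and> colour_ok l (c n) Y D \<and> relations_ok s l (c n) D}"

text \<open>A configuration counts as missed only if \<open>Q\<close> actually poses it, that is, if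
  \<open>Q\<close> agrees with \<open>D\<close> on the tuples from \<open>X\<close>.\<close>

definition missed ::
  "nat \<Rightarrow> ('a set \<times> 'a set \<times> (('p, 'r) lsym \<times> 'a list) set) \<Rightarrow> (('p, 'r) lsym \<times> 'a list) set \<Rightarrow> bool"
  where
  "missed n = (\<lambda>(X, Y, D) Q. (\<forall>S xs. (S, xs) \<in> lt X \<longrightarrow> ((S, xs) \<in> D \<longleftrightarrow> (S, xs) \<in> Q)) \<and>
     \<not> (\<exists>W j. closed n W \<and> iso L j (restr (expand (G n) D) Y) (restr (expand (G n) Q) W) \<and>
          (\<forall>x \<in> X. j x = x)))"

lemma precol_iff: "Q \<in> precol n \<longleftrightarrow> Q \<subseteq> lt (U n) \<and> colour_ok l (c n) (U n) Q"
  by (simp add: colouring.precolourings_def[OF col])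

lemma cols_iff: "Q \<in> cols n \<longleftrightarrow> Q \<in> precol n \<and> relations_ok s l (c n) Q"
  by (simp add: colouring.colourings_def[OF col])

lemma finite_precol: "finite (precol n)"
  by (rule colouring.finite_precolourings[OF col])

text \<open>\<open>B\<close> is the block of tuples that belong to the copy \<open>W\<close> and not
  just to \<open>X\<close>; \<open>P\<close> is the pattern that \<open>D\<close> prescribes on it.
  Colours stay admissible because outside the closure of the empty set dependence does not cross the
  border of \<open>W - X\<close>, both sets being closed.\<close>

lemma overwrite:
  assumes X: "closed n X" and Y: "closed n Y" and W: "closed n W" and XY: "X \<subseteq> Y"
    and D: "D \<subseteq> lt Y" "colour_ok l (c n) Y D"
    and h: "iso V h (restr (G n) Y) (restr (G n) W)" and fx: "\<forall>x \<in> X. h x = x"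
    and Q: "Q \<in> precol n"
  defines "B \<equiv> lt W - lt X"
    and "P \<equiv> (\<lambda>(S, xs). (S, map h xs)) ` D - lt X"
  shows "P \<subseteq> B"
    and "\<And>S xs. (S, xs) \<in> lt Y \<Longrightarrow> (S, xs) \<notin> lt X \<Longrightarrow> (S, map h xs) \<in> (Q - B) \<union> P \<longleftrightarrow> (S, xs) \<in> D"
    and "(Q - B) \<union> P \<in> precol n"
proof -
  interpret h: closure_map h Y "c n" "c n" using Y W h by (rule closure_map_G)
  let ?c = "c n"
  let ?Q = "(Q - B) \<union> P"
  have hY: "h ` Y = W" using iso_bij[OF h] by (simp add: bij_betw_def)
  \<comment> \<open>Injectivity and the fixed points in \<open>X\<close> keep \<open>Y - X\<close>
    away from \<open>X\<close>, so the pattern never collides with tuples over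
    \<open>X\<close>.\<close>
  have hX: "h a \<in> X \<longleftrightarrow> a \<in> X" if "a \<in> Y" for a
  proof
    assume "h a \<in> X"
    then have "h (h a) = h a" "h a \<in> Y" using fx XY by auto
    then show "a \<in> X" using h.inj that \<open>h a \<in> X\<close> by (auto dest: inj_onD)
  qed (use fx in auto)
  have lt_map: "(S, map h xs) \<in> lt W" "(S, map h xs) \<in> lt X \<longleftrightarrow> (S, xs) \<in> lt X"
    if "(S, xs) \<in> lt Y" for S xs
    using that hX hY unfolding mem_ltuples by (auto simp: subset_iff)
  show PB: "P \<subseteq> B"
    using D(1) lt_map(1) unfolding P_def B_def by (auto dest!: subsetD)
  show new: "(S, map h xs) \<in> ?Q \<longleftrightarrow> (S, xs) \<in> D" if "(S, xs) \<in> lt Y" "(S, xs) \<notin> lt X" for S xs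
  proof -
    have "(S, map h xs) \<in> B" using lt_map[OF that(1)] that(2) by (simp add: B_def)
    then have "(S, map h xs) \<in> ?Q \<longleftrightarrow> (S, map h xs) \<in> P" by auto
    also have "\<dots> \<longleftrightarrow> (\<exists>ys. (S, ys) \<in> D \<and> map h xs = map h ys)"
      using lt_map[OF that(1)] that(2) by (auto simp: P_def)
    also have "\<dots> \<longleftrightarrow> (S, xs) \<in> D"
    proof
      assume "\<exists>ys. (S, ys) \<in> D \<and> map h xs = map h ys"
      then obtain ys where ys: "(S, ys) \<in> D" "map h xs = map h ys" by auto
      have "set xs \<subseteq> Y" "set ys \<subseteq> Y" using that D(1) ys(1) by (auto simp: mem_ltuples dest!: subsetD)
      then have "xs = ys" using ys(2) h.inj
        by (intro map_inj_on[OF ys(2)]) (auto intro: inj_on_subset)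
      then show "(S, xs) \<in> D" using ys by simp
    qed auto
    finally show ?thesis .
  qed
  have old: "(S, xs) \<in> ?Q \<longleftrightarrow> (S, xs) \<in> Q" if "(S, xs) \<notin> B" for S xs
    using that PB by auto
  have QT: "Q \<subseteq> lt (U n)" and Qok: "colour_ok l ?c (U n) Q" using Q by (auto simp: precol_iff)
  have WU: "W \<subseteq> U n" using closedD(1)[OF W] .
  have "lt W \<subseteq> lt (U n)" using WU unfolding ltuples_def tuples_def by blast
  then have "?Q \<subseteq> lt (U n)" using QT PB unfolding B_def by blast
  moreover have "colour_ok l ?c (U n) ?Q"
  proof -
    have e: "?c {} \<subseteq> X" using cl_subset_closed[OF X, of "{}"] by simp
    have Ynew: "(Col j, [h a]) \<in> ?Q \<longleftrightarrow> (Col j, [a]) \<in> D" if "j \<in> {1..l}" "a \<in> Y" "a \<notin> X" for j a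
      using new[of "Col j" "[a]"] that by (simp add: mem_ltuples syms_def symar_def)
    have Cold: "(Col j, [a]) \<in> ?Q \<longleftrightarrow> (Col j, [a]) \<in> Q" if "a \<notin> W - X" "j \<in> {1..l}" for j a
      using old[of "Col j" "[a]"] that by (simp add: B_def mem_ltuples)
    have 1: "(\<exists>i \<in> {1..l}. (Col i, [a]) \<in> ?Q) \<longleftrightarrow> a \<notin> ?c {}" if a: "a \<in> U n" for a
    proof (cases "a \<in> W - X")
      case True
      then obtain b where b: "b \<in> Y" "a = h b" using hY by auto
      then have bX: "b \<notin> X" using True hX by auto
      then obtain i where "i \<in> {1..l}" "(Col i, [b]) \<in> D"
        using colour_okD[OF D(2) b(1)] e by auto
      then show ?thesis using Ynew[of i b] b bX True e by blast
    next
      case False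
      then have "(\<exists>i \<in> {1..l}. (Col i, [a]) \<in> ?Q) \<longleftrightarrow> (\<exists>i \<in> {1..l}. (Col i, [a]) \<in> Q)"
        using Cold by (intro bex_cong) auto
      then show ?thesis using colour_okD[OF Qok a] by simp
    qed
    have 2: "i = j" if ab: "a \<in> U n" "b \<in> U n" "a \<notin> ?c {}" "b \<notin> ?c {}" "a \<in> ?c {b}"
      and ij: "i \<in> {1..l}" "j \<in> {1..l}" "(Col i, [a]) \<in> ?Q" "(Col j, [b]) \<in> ?Q" for a b i j
    proof -
      \<comment> \<open>By exchange \<open>a\<close> and \<open>b\<close> lie in each other's
        closure, hence in the same closed sets: either both are recoloured or neither is.\<close>
      have ba: "b \<in> ?c {a}" using dependent_sym[OF pg, of a n b] ab by auto
      have WW: "b \<in> T" if "closed n T" "a \<in> T" for T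
        using cl_subset_closed[OF that(1), of "{a}"] that(2) ba by auto
      have WW': "a \<in> T" if "closed n T" "b \<in> T" for T
        using cl_subset_closed[OF that(1), of "{b}"] that(2) ab by auto
      have iff: "a \<in> W - X \<longleftrightarrow> b \<in> W - X" using WW WW' W X by blast
      show ?thesis
      proof (cases "a \<in> W - X")
        case True
        with iff obtain a' b' where a': "a' \<in> Y" "a = h a'" and b': "b' \<in> Y" "b = h b'"
          using hY by (metis DiffD1 imageE)
        have nX: "a' \<notin> X" "b' \<notin> X" using True iff a' b' hX by auto
        show ?thesis
        proof (rule colour_ok_unique[OF D(2) a'(1) b'(1)])
          show "a' \<notin> ?c {}" "b' \<notin> ?c {}" using nX e by auto
          show "a' \<in> ?c {b'}" using h.mem_cl_singleton_iff[OF a'(1) b'(1)] ab a' b' by simp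
          show "i \<in> {1..l}" "j \<in> {1..l}" by fact+
          show "(Col i, [a']) \<in> D" "(Col j, [b']) \<in> D"
            using ij Ynew[of i a'] Ynew[of j b'] a' b' nX by simp_all
        qed
      next
        case False
        then have "(Col i, [a]) \<in> Q" "(Col j, [b]) \<in> Q"
          using Cold[OF False ij(1)] Cold[OF _ ij(2), of b] ij(3,4) iff by blast+
        then show ?thesis by (rule colour_ok_unique[OF Qok ab ij(1,2)])
      qed
    qed
    show ?thesis
      unfolding colour_ok_def
    proof (intro conjI ballI impI; (elim conjE DiffE)?)
      fix a assume "a \<in> U n"
      then show "(\<exists>i \<in> {1..l}. (Col i, [a]) \<in> ?Q) \<longleftrightarrow> a \<notin> ?c {}" by (rule 1)
    qed (rule 2)
  qed
  ultimately show "?Q \<in> precol n" by (simp add: precol_iff)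
qed

text \<open>If a posed configuration is missed, then \<open>w\<close> differs from the prescribed
  pattern on every block: a block with the right pattern has the colours of \<open>D\<close>, its
  prescribed relation tuples are therefore permitted, and they survive pruning, so the copy would
  realise \<open>D\<close>. \<open>card_avoid_patterns\<close> bounds the number of such
  \<open>w\<close>.\<close>

lemma card_missed_le:
  assumes conf: "(X, Y, D) \<in> configurations k n" and ext: "many_extensions k \<Lambda>"
    and t: "card (lt Y) \<le> t"
    and cardlt: "\<And>W. closed n W \<Longrightarrow> card W = card Y \<Longrightarrow> card (lt W) \<le> t"
  shows "real (card {w \<in> precol n. missed n (X, Y, D) (prune s l (c n) w)}) \<le>
    (1 - 1 / 2 ^ t) ^ \<Lambda> n * real (card (precol n))"
proof -
  have X: "closed n X" and Y: "closed n Y" and XY: "X \<subset> Y"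
    and dim: "dim (c n) Y = dim (c n) X + 1" "dim (c n) Y \<le> k"
    and D: "D \<subseteq> lt Y" "colour_ok l (c n) Y D" "relations_ok s l (c n) D"
    using conf by (auto simp: configurations_def)
  obtain W h where W: "\<forall>i < \<Lambda> n. closed n (W i) \<and> iso V (h i) (restr (G n) Y) (restr (G n) (W i)) \<and>
        (\<forall>x \<in> X. h i x = id x)"
    and int: "\<forall>i < \<Lambda> n. \<forall>j < \<Lambda> n. i \<noteq> j \<longrightarrow> W i \<inter> W j = X"
  proof -
    have "closed n X \<and> closed n Y \<and> closed n X \<and> X \<subset> Y \<and> dim (c n) Y = dim (c n) X + 1 \<and>
        dim (c n) Y \<le> k \<and> iso V id (restr (G n) X) (restr (G n) X)"
      using X Y XY dim iso_id by simp
    from ext[unfolded many_extensions_def, THEN spec, THEN spec, THEN spec, THEN spec, THEN spec,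
        THEN spec, THEN mp, OF this]
    show thesis by (elim exE conjE) (rule that)
  qed
  let ?B = "\<lambda>i. lt (W i) - lt X"
  let ?P = "\<lambda>i. (\<lambda>(S, xs). (S, map (h i) xs)) ` D - lt X"
  have W': "closed n (W i)" "iso V (h i) (restr (G n) Y) (restr (G n) (W i))" "\<forall>x \<in> X. h i x = x"
    if "i < \<Lambda> n" for i
    using W that by auto
  note ov = overwrite[OF X Y W'(1) _ D(1,2) W'(2,3)]
  have sub: "{w \<in> precol n. missed n (X, Y, D) (prune s l (c n) w)} \<subseteq>
      {w \<in> precol n. \<forall>i < \<Lambda> n. w \<inter> ?B i \<noteq> ?P i}"
  proof (intro subsetI CollectI conjI allI impI notI; clarify)
    fix w i
    assume w: "w \<in> precol n" and miss: "missed n (X, Y, D) (prune s l (c n) w)"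
      and i: "i < \<Lambda> n" and eq: "w \<inter> ?B i = ?P i"
    interpret h: closure_map "h i" Y "c n" "c n" using Y W'[OF i] by (intro closure_map_G) auto
    have agree: "(S, xs) \<in> D \<longleftrightarrow> (S, xs) \<in> prune s l (c n) w" if "(S, xs) \<in> lt X" for S xs
      using miss that by (auto simp: missed_def)
    have wQ: "(w - ?B i) \<union> ?P i = w" using eq by blast
    have new: "(S, map (h i) xs) \<in> w \<longleftrightarrow> (S, xs) \<in> D" if "(S, xs) \<in> lt Y" "(S, xs) \<notin> lt X" for S xs
      using ov(2)[OF i _ i i w that] XY unfolding wQ by auto
    have fixX: "map (h i) xs = xs" if "(S, xs) \<in> lt X" for S xs
      using that W'(3)[OF i] by (auto simp: mem_ltuples intro!: map_idI)
    \<comment> \<open>Over \<open>X\<close> the agreement concerns the pruned set, but pruning keeps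
      colours; outside \<open>X\<close> the block carries the pattern.\<close>
    have cols: "(Col j, [a]) \<in> D \<longleftrightarrow> (Col j, [h i a]) \<in> w" if "j \<in> {1..l}" "a \<in> Y" for j a
    proof (cases "a \<in> X")
      case True
      then have "(Col j, [a]) \<in> lt X" using that by (simp add: mem_ltuples syms_def symar_def)
      then show ?thesis using agree[of "Col j" "[a]"] W'(3)[OF i] True by simp
    next
      case False
      then show ?thesis using new[of "Col j" "[a]"] that by (simp add: mem_ltuples syms_def symar_def)
    qed
    have "(S, xs) \<in> D \<longleftrightarrow> (S, map (h i) xs) \<in> prune s l (c n) w" if x: "(S, xs) \<in> lt Y" for S xs
    proof (cases "(S, xs) \<in> lt X")
      case True
      then show ?thesis using agree fixX by metis
    next
      case False
      have "(S, xs) \<in> D \<longleftrightarrow> (S, map (h i) xs) \<in> w" using new[OF x False] by simp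
      \<comment> \<open>The tuple is permitted in \<open>D\<close>, and \<open>h i\<close> carries
        both closures and colours to \<open>w\<close>.\<close>
      moreover have "permitted s l (c n) w (set (map (h i) xs))" if "(S, xs) \<in> D" "S = Rel R" for R
      proof -
        have "permitted s l (c n) D (set xs)" using D(3) that by (simp add: relations_ok_def)
        moreover have "set xs \<subseteq> Y" using x by (simp add: mem_ltuples)
        ultimately show ?thesis
          using h.permitted_transfer[OF cols, where Z = "set xs"] by simp
      qed
      ultimately show ?thesis by (auto simp: prune_def)
    qed
    then have "iso L (h i) (restr (expand (G n) D) Y) (restr (expand (G n) (prune s l (c n) w)) (W i))"
      using W'(2)[OF i] by (simp add: iso_expand_iff)
    then have "\<exists>W j. closed n W \<and>
        iso L j (restr (expand (G n) D) Y) (restr (expand (G n) (prune s l (c n) w)) W) \<and>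
        (\<forall>x \<in> X. j x = x)"
      using W'[OF i] by (intro exI[of _ "W i"] exI[of _ "h i"] conjI)
    then show False using miss unfolding missed_def prod.case by blast
  qed
  have "real (card {w \<in> precol n. \<forall>i < \<Lambda> n. w \<inter> ?B i \<noteq> ?P i}) \<le>
      (1 - 1 / 2 ^ t) ^ \<Lambda> n * real (card (precol n))"
  proof (rule card_avoid_patterns)
    show "finite (precol n)" by (rule colouring.finite_precolourings[OF col])
    show "?B i \<inter> ?B j = {}" if "i < \<Lambda> n" "j < \<Lambda> n" "i \<noteq> j" for i j
    proof -
      \<comment> \<open>A tuple in two blocks would have all its entries in \<open>X\<close>, and
        such tuples were removed from the blocks.\<close>
      have "W i \<inter> W j = X" using int that by blast
      then show ?thesis by (fastforce simp: mem_ltuples)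
    qed
    obtain Q0 where Q0: "Q0 \<in> precol n" using colouring.precolourings_nonempty[OF col] by blast
    show "?P i \<subseteq> ?B i" if "i < \<Lambda> n" for i
      using ov(1)[OF that _ that that Q0] XY by auto
    show "finite (?B i) \<and> card (?B i) \<le> t" if i: "i < \<Lambda> n" for i
    proof -
      have "card (W i) = card Y" using bij_betw_same_card[OF iso_bij[OF W'(2)[OF i]]] by simp
      then have "card (lt (W i)) \<le> t" using cardlt W'(1)[OF i] by simp
      moreover have "finite (lt (W i))" using finite_ltuples[OF Rs(1)] closedD(3)[OF W'(1)[OF i]] by blast
      ultimately show ?thesis using card_mono[of "lt (W i)" "?B i"] by auto
    qed
    show "(Q - ?B i) \<union> ?P i \<in> precol n" if "i < \<Lambda> n" "Q \<in> precol n" for i Q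
      using ov(3)[OF that(1) _ that(1) that(1) that(2)] XY by auto
  qed
  moreover have "card {w \<in> precol n. missed n (X, Y, D) (prune s l (c n) w)} \<le>
      card {w \<in> precol n. \<forall>i < \<Lambda> n. w \<inter> ?B i \<noteq> ?P i}"
    using finite_precol[of n] by (intro card_mono[OF _ sub]) simp
  ultimately show ?thesis by linarith
qed

text \<open>A closed set of dimension at most \<open>k\<close> is the closure of a list of at most
  \<open>k\<close> elements, so there are polynomially many; the square accounts for the pair
  \<open>X\<close>, \<open>Y\<close>. Their size is bounded in terms of \<open>k\<close>, so the
  choice of \<open>D\<close> contributes only the constant \<open>2 ^ t\<close>.\<close>

lemma card_configurations_le:
  obtains t :: nat where
    "\<And>n. real (card (configurations k n)) \<le> (\<Sum>i\<le>k. real (card (U n)) ^ i)\<^sup>2 * 2 ^ t"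
    "\<And>n. finite (configurations k n)"
    "\<And>n W. closed n W \<Longrightarrow> dim (c n) W \<le> k \<Longrightarrow> card (lt W) \<le> t"
    "\<And>n W W'. closed n W \<Longrightarrow> dim (c n) W \<le> k \<Longrightarrow> closed n W' \<Longrightarrow> card W' = card W \<Longrightarrow> card (lt W') \<le> t"
proof -
  obtain f :: "nat \<Rightarrow> nat" where f: "\<And>n X. X \<subseteq> U n \<Longrightarrow> card (c n X) \<le> f (dim (c n) X)"
    using bounded unfolding bounded_closures_def by blast
  \<comment> \<open>\<open>f\<close> is not assumed monotone, so the maximum over all dimensions up
    to \<open>k\<close> is taken.\<close>
  define F where "F = Max (f ` {..k})"
  have F: "card W \<le> F" if "closed n W" "dim (c n) W \<le> k" for n W
  proof -
    have "card W \<le> f (dim (c n) W)" using f[of W n] closedD[OF that(1)] by simp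
    also have "\<dots> \<le> F" using that(2) by (simp add: F_def)
    finally show ?thesis .
  qed
  define t where "t = (\<Sum>S \<in> (syms l Rs :: ('p, 'r) lsym set). F ^ symar ar S)"
  have t': "card (lt W') \<le> t" if "closed n W'" "card W' \<le> F" for n W'
    unfolding t_def using card_ltuples_le[OF Rs(1) closedD(3)[OF that(1)] that(2)] .
  define CL where "CL n = {X. closed n X \<and> dim (c n) X \<le> k}" for n
  have CL_sub: "CL n \<subseteq> (\<lambda>bs. c n (set bs)) ` {bs. set bs \<subseteq> U n \<and> length bs \<le> k}" for n
  proof
    fix X assume "X \<in> CL n"
    then have X: "closed n X" "dim (c n) X \<le> k" by (auto simp: CL_def)
    obtain J where J: "finite J" "J \<subseteq> X" "X \<subseteq> c n J" "card J = dim (c n) X"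
      using basis_exists[OF pg closedD(3)[OF X(1)] closedD(1)[OF X(1)]] by metis
    obtain bs where bs: "set bs = J" "distinct bs" using finite_distinct_list[OF J(1)] by blast
    have "c n J = X" using J cl_subset_closed[OF X(1) J(2)] by auto
    moreover have "length bs \<le> k" using bs J X(2) by (metis distinct_card)
    ultimately show "X \<in> (\<lambda>bs. c n (set bs)) ` {bs. set bs \<subseteq> U n \<and> length bs \<le> k}"
      using bs J closedD(1)[OF X(1)] by blast
  qed
  have fin_lists: "finite {bs. set bs \<subseteq> U n \<and> length bs \<le> k}" for n
    by (rule finite_lists_length_le[OF finU])
  have finCL: "finite (CL n)" for n
    using finite_subset[OF CL_sub] fin_lists by blast
  \<comment> \<open>The sum counts the lists of length at most \<open>k\<close> over
    \<open>U n\<close>.\<close>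
  have cardCL: "card (CL n) \<le> (\<Sum>i\<le>k. card (U n) ^ i)" for n
    unfolding card_lists_length_le[OF finU[of n], of k, symmetric]
    by (rule surj_card_le[OF fin_lists CL_sub])
  have sub: "configurations k n \<subseteq> (SIGMA X : CL n. SIGMA Y : CL n. Pow (lt Y))" for n
    by (auto simp: configurations_def CL_def)
  have fin_lt: "finite (lt Y)" if "Y \<in> CL n" for Y n
    using that by (intro finite_ltuples Rs(1)) (auto simp: CL_def intro: closedD(3))
  have finS: "finite (SIGMA Y : CL n. Pow (lt Y))" for n
    using finCL fin_lt by (intro finite_SigmaI) auto
  have finSS: "finite (SIGMA X : CL n. SIGMA Y : CL n. Pow (lt Y))" for n
    by (rule finite_SigmaI[OF finCL finS])
  have "card (configurations k n) \<le> (\<Sum>i\<le>k. card (U n) ^ i)\<^sup>2 * 2 ^ t" for n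
  proof -
    have lt: "card (lt Y) \<le> t" if "Y \<in> CL n" for Y
      using t'[of n Y] F[of n Y] that by (auto simp: CL_def)
    have "card (SIGMA Y : CL n. Pow (lt Y)) = (\<Sum>Y \<in> CL n. 2 ^ card (lt Y))"
      using finCL fin_lt by (simp add: card_SigmaI card_Pow)
    also have "\<dots> \<le> (\<Sum>Y \<in> CL n. 2 ^ t)"
      using lt by (intro sum_mono power_increasing) auto
    finally have A: "card (SIGMA Y : CL n. Pow (lt Y)) \<le> card (CL n) * 2 ^ t" by simp
    have "card (configurations k n) \<le> card (SIGMA X : CL n. SIGMA Y : CL n. Pow (lt Y))"
      by (rule card_mono[OF finSS sub])
    also have "\<dots> = card (CL n) * card (SIGMA Y : CL n. Pow (lt Y))"
      by (rule card_cartesian_product)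
    also have "\<dots> \<le> card (CL n) * (card (CL n) * 2 ^ t)"
      using A by (rule mult_le_mono2)
    also have "\<dots> = (card (CL n))\<^sup>2 * 2 ^ t" by (simp add: power2_eq_square)
    also have "\<dots> \<le> (\<Sum>i\<le>k. card (U n) ^ i)\<^sup>2 * 2 ^ t"
      using cardCL by (intro mult_le_mono1 power_mono) auto
    finally show ?thesis .
  qed
  then have "real (card (configurations k n)) \<le> real ((\<Sum>i\<le>k. card (U n) ^ i)\<^sup>2 * 2 ^ t)" for n
    by (rule of_nat_mono)
  then have "real (card (configurations k n)) \<le> (\<Sum>i\<le>k. real (card (U n)) ^ i)\<^sup>2 * 2 ^ t" for n
    by simp
  moreover have "finite (configurations k n)" for n
    using finite_subset[OF sub finSS] .
  moreover have "card (lt W) \<le> t" if "closed n W" "dim (c n) W \<le> k" for n W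
    using t'[OF that(1) F[OF that]] .
  moreover have "card (lt W') \<le> t"
    if "closed n W" "dim (c n) W \<le> k" "closed n W'" "card W' = card W" for n W W'
    using t'[OF that(3)] F[OF that(1,2)] that(4) by simp
  ultimately show thesis by (rule that)
qed

end

text \<open>Induction on the polynomial for all \<open>r\<close> at once: with
  \<open>q = sqrt r\<close>, one factor \<open>q ^ m\<close> absorbs the additional factor
  \<open>m\<close> and the other is left to the induction hypothesis.\<close>

lemma poly_times_power_tendsto_0:
  fixes r :: real and R :: "real poly"
  assumes "0 \<le> r" "r < 1"
  shows "(\<lambda>m. poly R (real m) * r ^ m) \<longlonglongrightarrow> 0"
  using assms
proof (induction R arbitrary: r)
  case 0
  then show ?case by simp
next
  case (pCons a R)
  define q where "q = sqrt r"
  have q: "0 \<le> q" "q < 1" "r = q * q"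
    using pCons.prems by (auto simp: q_def)
  have "(\<lambda>m. a * r ^ m + (real m * q ^ m) * (poly R (real m) * q ^ m)) \<longlonglongrightarrow> a * 0 + 0 * 0"
    using q pCons.prems powser_times_n_limit_0[of q] pCons.IH[of q]
    by (intro tendsto_add tendsto_mult tendsto_const LIMSEQ_power_zero) auto
  moreover have "poly (pCons a R) (real m) * r ^ m =
      a * r ^ m + (real m * q ^ m) * (poly R (real m) * q ^ m)" for m
    by (simp add: q(3) power_mult_distrib algebra_simps)
  ultimately show ?case by simp
qed

lemma iso_reduct:
  assumes "iso (full_vocab V l Rs ar) q B M"
  shows "iso V q (reduct B) (reduct M)"
  using assms by (auto simp: iso_def reduct_def)

lemma is_struct_reduct:
  assumes "is_struct (full_vocab V l Rs ar) B"
  shows "is_struct V (reduct B)"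
  unfolding is_struct_def
proof (intro conjI ballI allI impI)
  fix R assume "R \<in> rsyms V"
  then have "rint B (Pre R) \<subseteq> tuples (univ B) (rarity (full_vocab V l Rs ar) (Pre R))"
    using assms[unfolded is_struct_def, THEN conjunct2, THEN conjunct1, rule_format, of "Pre R"]
    by simp
  then show "rint (reduct B) R \<subseteq> tuples (univ (reduct B)) (rarity V R)"
    by (simp add: reduct_def)
next
  fix R assume "R \<notin> rsyms V"
  then have "Pre R \<notin> rsyms (full_vocab V l Rs ar)" by auto
  then show "rint (reduct B) R = {}"
    using assms unfolding is_struct_def reduct_def by simp
qed (use assms in \<open>auto simp: is_struct_def reduct_def\<close>)

section \<open>Colourings that solve every one-dimensional extension problem\<close>

context coloured_family
begin

abbreviation str :: "nat \<Rightarrow> (('p, 'r) lsym \<times> 'a list) set \<Rightarrow> 'a set \<Rightarrow> ('f, ('p, 'r) lsym, 'a) struct"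
  where "str n Q X \<equiv> restr (expand (G n) Q) X"

text \<open>The problems come from colourings of arbitrary members \<open>G m\<close>. This covers
  the abstract pairs of the extension property up to isomorphism, and it allows another random
  structure to serve as the source in the back-and-forth argument.\<close>

definition good :: "nat \<Rightarrow> nat \<Rightarrow> (('p, 'r) lsym \<times> 'a list) set \<Rightarrow> bool" where
  "good k n Q \<longleftrightarrow> (\<forall>m. \<forall>Q0 \<in> cols m. \<forall>X Y b p. closed m Y \<longrightarrow> b \<in> U m - Y \<longrightarrow>
     dim (c m) Y + 1 \<le> k \<longrightarrow> closed n X \<longrightarrow> iso L p (str m Q0 Y) (str n Q X) \<longrightarrow>
     (\<exists>W p'. closed n W \<and> iso L p' (str m Q0 (c m (insert b Y))) (str n Q W) \<and>
       (\<forall>y \<in> Y. p' y = p y)))"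

lemma cols_subset: "Q \<in> cols n \<Longrightarrow> Q \<subseteq> lt (U n)"
  by (simp add: cols_iff precol_iff)

lemma is_struct_L: "Q \<in> cols n \<Longrightarrow> is_struct L (expand (G n) Q)"
  by (intro is_struct_expand G_struct cols_subset)

lemma is_struct_str: "Q \<in> cols n \<Longrightarrow> closed n X \<Longrightarrow> is_struct L (str n Q X)"
  using is_struct_restr_G[of n X] closedD(1)[of n X]
  by (intro is_struct_restr is_struct_L) (auto simp: is_struct_def restr_def)

text \<open>An unsolved problem lives in some \<open>G m\<close>, of which there are infinitely
  many. One copy of \<open>Z\<close> over \<open>X\<close>, available as soon as
  \<open>1 \<le> \<Lambda> n\<close>, moves it into \<open>G n\<close>, where only finitely many
  configurations exist.\<close>

lemma missed_of_not_good:
  assumes ext: "many_extensions k \<Lambda>" and pos: "1 \<le> \<Lambda> n" and Q: "Q \<in> cols n" and ng: "\<not> good k n Q"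
  shows "\<exists>x \<in> configurations k n. missed n x Q"
proof -
  obtain m Q0 X Y b p where Q0: "Q0 \<in> cols m" and Y: "closed m Y" and b: "b \<in> U m - Y"
    and d: "dim (c m) Y + 1 \<le> k" and X: "closed n X" and iso: "iso L p (str m Q0 Y) (str n Q X)"
    and none: "\<not> (\<exists>W p'. closed n W \<and> iso L p' (str m Q0 (c m (insert b Y))) (str n Q W) \<and>
       (\<forall>y \<in> Y. p' y = p y))"
    using ng unfolding good_def by blast
  define Z where "Z = c m (insert b Y)"
  have bY: "insert b Y \<subseteq> U m" using b closedD(1)[OF Y] by auto
  have Z: "closed m Z" unfolding Z_def using bY by (rule closed_cl)
  have YZ: "Y \<subset> Z" using cl_extensive[OF pg bY] b unfolding Z_def by auto
  have dZ: "dim (c m) Z = dim (c m) Y + 1"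
    unfolding Z_def using dim_cl_insert[OF pg finU closedD(1,2)[OF Y] b] .
  have isoV: "iso V p (restr (G m) Y) (restr (G n) X)"
    and isoQ: "\<And>S xs. (S, xs) \<in> lt Y \<Longrightarrow> (S, xs) \<in> Q0 \<longleftrightarrow> (S, map p xs) \<in> Q"
    using iso by (auto simp: iso_expand_iff)
  have "closed m Y \<and> closed m Z \<and> closed n X \<and> Y \<subset> Z \<and> dim (c m) Z = dim (c m) Y + 1 \<and>
      dim (c m) Z \<le> k \<and> iso V p (restr (G m) Y) (restr (G n) X)"
    using Y Z X YZ dZ d isoV by simp
  from ext[unfolded many_extensions_def, THEN spec, THEN spec, THEN spec, THEN spec, THEN spec,
      THEN spec, THEN mp, OF this]
  obtain W q where W: "closed n W" and q: "iso V q (restr (G m) Z) (restr (G n) W)"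
    and qp: "\<forall>y \<in> Y. q y = p y"
    using pos by (metis One_nat_def Suc_le_eq)
  interpret q: closure_map q Z "c m" "c n" using Z W q by (rule closure_map_G)
  have qZ: "q ` Z = W" using iso_bij[OF q] by (simp add: bij_betw_def)
  have pY: "p ` Y = X" using iso_bij[OF isoV] by (simp add: bij_betw_def)
  have qY: "q ` Y = X" using pY qp by auto
  \<comment> \<open>The labelled tuples of \<open>Q0\<close> on \<open>Z\<close>, moved to
    \<open>W\<close>. As \<open>q\<close> extends \<open>p\<close>, they agree with \<open>Q\<close>
    over \<open>X\<close>.\<close>
  define D where "D = (\<lambda>(S, xs). (S, map q xs)) ` (Q0 \<inter> lt Z)"
  have D: "(S, map q xs) \<in> D \<longleftrightarrow> (S, xs) \<in> Q0" if "(S, xs) \<in> lt Z" for S xs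
  proof
    assume "(S, map q xs) \<in> D"
    then obtain ys where ys: "(S, ys) \<in> Q0" "(S, ys) \<in> lt Z" "map q xs = map q ys"
      by (auto simp: D_def)
    have "xs = ys"
      using that ys q.inj by (intro map_inj_on[OF ys(3)]) (auto simp: mem_ltuples intro: inj_on_subset)
    then show "(S, xs) \<in> Q0" using ys by simp
  qed (use that in \<open>auto simp: D_def\<close>)
  have Dcol: "(Col i, [a]) \<in> Q0 \<longleftrightarrow> (Col i, [q a]) \<in> D" if "i \<in> {1..l}" "a \<in> Z" for i a
    using D[of "Col i" "[a]"] that by (simp add: mem_ltuples syms_def symar_def)
  have isoD: "iso L q (str m Q0 Z) (str n D W)"
    unfolding iso_expand_iff using q D by auto
  have "(X, W, D) \<in> configurations k n"
  proof -
    obtain z where "z \<in> Z" "z \<notin> Y" using YZ by auto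
    then have "q z \<in> W" "q z \<notin> X"
      using q.mem_image_iff[of z Y] YZ qY qZ by auto
    then have XW: "X \<subset> W" using qY qZ YZ by auto
    have "dim (c n) W = dim (c n) X + 1" "dim (c n) W \<le> k"
      using dim_iso[OF Z W q] dim_iso[OF Y X isoV] dZ d by simp_all
    moreover have "D \<subseteq> lt W"
      unfolding qZ[symmetric] by (auto simp: D_def mem_ltuples intro!: imageI)
    moreover have "colour_ok l (c n) W D"
    proof -
      have "colour_ok l (c m) (U m) Q0" using Q0 by (simp add: cols_iff precol_iff)
      then have "colour_ok l (c m) Z Q0"
        using closedD(1)[OF Z] by (rule colour_ok_subset)
      then show ?thesis using q.colour_ok_transfer[OF Dcol] qZ by simp
    qed
    moreover have "relations_ok s l (c n) D"
      unfolding relations_ok_def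
    proof (intro allI impI)
      fix R ys assume "(Rel R, ys) \<in> D"
      then obtain xs where xs: "ys = map q xs" "(Rel R, xs) \<in> Q0" "(Rel R, xs) \<in> lt Z"
        by (auto simp: D_def)
      have "permitted s l (c m) Q0 (set xs)" using Q0 xs by (auto simp: cols_iff relations_ok_def)
      moreover have "set xs \<subseteq> Z" using xs by (simp add: mem_ltuples)
      ultimately show "permitted s l (c n) D (set ys)"
        using q.permitted_transfer[OF Dcol, where Z = "set xs"] xs by simp
    qed
    ultimately show ?thesis using X W XW by (simp add: configurations_def)
  qed
  moreover have "missed n (X, W, D) Q"
    unfolding missed_def prod.case
  proof (intro conjI allI impI notI)
    fix S xs assume x: "(S, xs) \<in> lt X"
    then have "xs \<in> tuples (p ` Y) (symar ar S)" by (simp add: pY ltuples_def)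
    then obtain ys where ys: "ys \<in> tuples Y (symar ar S)" "xs = map p ys"
      using tuples_imageE by blast
    have yY: "(S, ys) \<in> lt Y" using x ys(1) by (simp add: ltuples_def)
    then have yZ: "(S, ys) \<in> lt Z" using YZ by (auto simp: mem_ltuples)
    have "map q ys = map p ys" using qp ys(1) by (auto simp: tuples_def)
    then show "(S, xs) \<in> D \<longleftrightarrow> (S, xs) \<in> Q"
      using D[OF yZ] isoQ[OF yY] ys(2) by (simp only:)
  next
    assume "\<exists>W' j. closed n W' \<and> iso L j (str n D W) (str n Q W') \<and> (\<forall>x \<in> X. j x = x)"
    then obtain W' j where j: "closed n W'" "iso L j (str n D W) (str n Q W')" "\<forall>x \<in> X. j x = x"
      by blast
    \<comment> \<open>A realisation of \<open>D\<close> over \<open>X\<close>, preceded by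
      \<open>q\<close>, would solve the original problem.\<close>
    have "iso L (j \<circ> q) (str m Q0 Z) (str n Q W')" using isoD j(2) by (rule iso_comp)
    moreover have "\<forall>y \<in> Y. (j \<circ> q) y = p y" using j(3) qp pY by auto
    ultimately show False using none j(1) unfolding Z_def by blast
  qed
  ultimately show ?thesis by blast
qed

lemma prune_in_cols: "w \<in> precol n \<Longrightarrow> prune s l (c n) w \<in> cols n"
  by (rule colouring.prune_in_colourings[OF col])

lemma card_precol_pos: "0 < card (precol n)"
  using finite_precol colouring.precolourings_nonempty[OF col] by (simp add: card_gt_0_iff)

text \<open>Union bound over the configurations: polynomially many in \<open>\<Lambda> n\<close>,
  each missed with probability at most \<open>r ^ \<Lambda> n\<close>.\<close>

lemma good_tendsto:
  "(\<lambda>n. real (card {w \<in> precol n. \<not> good k n (prune s l (c n) w)}) / real (card (precol n))) \<longlonglongrightarrow> 0"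
proof -
  obtain \<Lambda> :: "nat \<Rightarrow> nat" and P :: "real poly" where lim: "filterlim \<Lambda> at_top sequentially"
    and P: "\<And>n. real (card (U n)) \<le> poly P (real (\<Lambda> n))" and ext: "many_extensions k \<Lambda>"
    using saturation[of k] by blast
  obtain t :: nat where
    conf: "\<And>n. real (card (configurations k n)) \<le> (\<Sum>i\<le>k. real (card (U n)) ^ i)\<^sup>2 * 2 ^ t"
    and fin: "\<And>n. finite (configurations k n)"
    and t1: "\<And>n W. closed n W \<Longrightarrow> dim (c n) W \<le> k \<Longrightarrow> card (lt W) \<le> t"
    and t2: "\<And>n W W'. closed n W \<Longrightarrow> dim (c n) W \<le> k \<Longrightarrow> closed n W' \<Longrightarrow> card W' = card W \<Longrightarrow>
      card (lt W') \<le> t"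
    by (rule card_configurations_le[of k]) (rule that; assumption?)
  define r :: real where "r = 1 - 1 / 2 ^ t"
  have r: "0 \<le> r" "r < 1" by (simp_all add: r_def)
  \<comment> \<open>The bound on the number of configurations, with \<open>P\<close> in place of the
    size of the universe.\<close>
  define R :: "real poly" where "R = (\<Sum>i\<le>k. P ^ i)\<^sup>2 * [:2 ^ t:]"
  have "real (card {w \<in> precol n. \<not> good k n (prune s l (c n) w)}) / real (card (precol n)) \<le>
      poly R (real (\<Lambda> n)) * r ^ \<Lambda> n" if pos: "1 \<le> \<Lambda> n" for n
  proof -
    let ?E = "\<lambda>x. {w \<in> precol n. missed n x (prune s l (c n) w)}"
    have "{w \<in> precol n. \<not> good k n (prune s l (c n) w)} \<subseteq> (\<Union>x \<in> configurations k n. ?E x)"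
      using missed_of_not_good[OF ext pos prune_in_cols] by blast
    moreover have "finite (\<Union>x \<in> configurations k n. ?E x)"
      by (rule finite_subset[OF _ finite_precol[of n]]) auto
    ultimately have "card {w \<in> precol n. \<not> good k n (prune s l (c n) w)} \<le>
        card (\<Union>x \<in> configurations k n. ?E x)"
      by (intro card_mono)
    also have "\<dots> \<le> (\<Sum>x \<in> configurations k n. card (?E x))"
      using fin by (rule card_UN_le)
    finally have "real (card {w \<in> precol n. \<not> good k n (prune s l (c n) w)}) \<le>
        real (\<Sum>x \<in> configurations k n. card (?E x))"
      by (rule of_nat_mono)
    also have "\<dots> = (\<Sum>x \<in> configurations k n. real (card (?E x)))" by simp
    also have "\<dots> \<le> (\<Sum>x \<in> configurations k n. r ^ \<Lambda> n * real (card (precol n)))"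
    proof (rule sum_mono)
      fix x assume x: "x \<in> configurations k n"
      obtain X Y D where xe: "x = (X, Y, D)" by (cases x)
      then have Y: "closed n Y" "dim (c n) Y \<le> k" using x by (auto simp: configurations_def)
      show "real (card (?E x)) \<le> r ^ \<Lambda> n * real (card (precol n))"
        using card_missed_le[OF x[unfolded xe] ext t1[OF Y] t2[OF Y]] by (simp add: xe r_def)
    qed
    also have "\<dots> = real (card (configurations k n)) * r ^ \<Lambda> n * real (card (precol n))" by simp
    finally have "real (card {w \<in> precol n. \<not> good k n (prune s l (c n) w)}) / real (card (precol n)) \<le>
        real (card (configurations k n)) * r ^ \<Lambda> n"
      using card_precol_pos[of n] by (simp add: divide_le_eq)
    also have "real (card (configurations k n)) \<le> poly R (real (\<Lambda> n))"
    proof -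
      have "(\<Sum>i\<le>k. real (card (U n)) ^ i)\<^sup>2 * 2 ^ t \<le> (\<Sum>i\<le>k. poly P (real (\<Lambda> n)) ^ i)\<^sup>2 * 2 ^ t"
        using P[of n] by (intro mult_right_mono power_mono sum_mono sum_nonneg) auto
      also have "\<dots> = poly R (real (\<Lambda> n))" by (simp add: R_def poly_sum)
      finally show ?thesis using conf[of n] by linarith
    qed
    then have "real (card (configurations k n)) * r ^ \<Lambda> n \<le> poly R (real (\<Lambda> n)) * r ^ \<Lambda> n"
      using r by (intro mult_right_mono) auto
    finally show ?thesis .
  qed
  moreover have "\<forall>\<^sub>F n in sequentially. 1 \<le> \<Lambda> n" using lim by (simp add: filterlim_at_top)
  ultimately have "\<forall>\<^sub>F n in sequentially.
      real (card {w \<in> precol n. \<not> good k n (prune s l (c n) w)}) / real (card (precol n)) \<le>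
      poly R (real (\<Lambda> n)) * r ^ \<Lambda> n"
    by (rule eventually_mono[rotated])
  moreover have "(\<lambda>n. poly R (real (\<Lambda> n)) * r ^ \<Lambda> n) \<longlonglongrightarrow> 0"
    using filterlim_compose[OF poly_times_power_tendsto_0[OF r, of R] lim] .
  moreover have "\<forall>\<^sub>F n in sequentially.
      0 \<le> real (card {w \<in> precol n. \<not> good k n (prune s l (c n) w)}) / real (card (precol n))"
    by simp
  ultimately show ?thesis
    by (rule tendsto_sandwich[OF _ _ tendsto_const, rotated])
qed

lemma good_extend:
  assumes "good k n Q" "Q0 \<in> cols m" "closed m Y" "closed m Z" "Y \<subseteq> Z" "dim (c m) Z \<le> k"
    "closed n X" "iso L p (str m Q0 Y) (str n Q X)"
  shows "\<exists>W p'. closed n W \<and> iso L p' (str m Q0 Z) (str n Q W) \<and> (\<forall>y \<in> Y. p' y = p y)"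
  using assms(3,5,7,8)
proof (induction "card (Z - Y)" arbitrary: X Y p rule: less_induct)
  case less
  show ?case
  proof (cases "Y = Z")
    case True
    with less.prems show ?thesis by blast
  next
    case False
    then obtain b where b: "b \<in> Z" "b \<notin> Y" using less.prems by auto
    have ZU: "Z \<subseteq> U m" using assms(4) by (rule closedD)
    have bY: "insert b Y \<subseteq> Z" using b less.prems by auto
    define Y1 where "Y1 = c m (insert b Y)"
    have Y1: "closed m Y1" unfolding Y1_def using bY ZU by (intro closed_cl) auto
    have Y1Z: "Y1 \<subseteq> Z" unfolding Y1_def using assms(4) bY by (rule cl_subset_closed)
    have sub: "insert b Y \<subseteq> Y1" unfolding Y1_def using cl_extensive[OF pg, of "insert b Y" m] bY ZU by auto
    have "dim (c m) Y1 = dim (c m) Y + 1"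
      unfolding Y1_def using dim_cl_insert[OF pg finU closedD(1,2)[OF less.prems(1)], of b] b ZU by auto
    moreover have "dim (c m) Y1 \<le> dim (c m) Z"
      using dim_mono[OF pg closedD(3)[OF assms(4)] Y1Z ZU] .
    ultimately have "dim (c m) Y + 1 \<le> k" using assms(6) by simp
    moreover have "b \<in> U m - Y" using b ZU by auto
    ultimately obtain W1 p1 where 1: "closed n W1" "iso L p1 (str m Q0 Y1) (str n Q W1)"
      "\<forall>y \<in> Y. p1 y = p y"
      using assms(1)[unfolded good_def, rule_format, OF assms(2) less.prems(1) _ _ less.prems(3,4), of b]
      unfolding Y1_def by blast
    have "card (Z - Y1) < card (Z - Y)"
      using b sub closedD(3)[OF assms(4)] by (intro psubset_card_mono) auto
    then obtain W p' where "closed n W" "iso L p' (str m Q0 Z) (str n Q W)" "\<forall>y \<in> Y1. p' y = p1 y"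
      using less.hyps[OF _ Y1 Y1Z 1(1,2)] by blast
    then show ?thesis using 1(3) sub by (intro exI[of _ W] exI[of _ p']) auto
  qed
qed

text \<open>\<open>good\<close> extends maps into the random structure, while the extension property
  extends maps out of it onto \<open>A\<close>. So the given map is composed with an identification
  \<open>q\<close> of \<open>B\<close> with a member of the family and inverted; the extended map is
  inverted back.\<close>

lemma k_extension_of_good:
  assumes Q: "Q \<in> cols n" and good: "good k n Q"
  shows "k_extension_property L \<theta> (iso_class L (\<lambda>m. expand (G m) ` cols m)) k (expand (G n) Q)"
  unfolding k_extension_property_def extension_property_def reduct_expand
proof (intro ballI allI impI; elim conjE)
  let ?M = "expand (G n) Q"
  fix B :: "('f, ('p, 'r) lsym, 'a) struct" and A A' :: "('f, ('p, 'r) lsym, 'a) struct" and h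
  assume B: "B \<in> iso_class L (\<lambda>m. expand (G m) ` cols m)"
    and AB: "closed_substructure L (cl \<theta> (reduct B)) A B" and k: "sdim \<theta> (reduct B) \<le> k"
    and A': "closed_substructure L (c n) A' ?M" and h: "iso L h A' A"
  obtain m Q0 q where Bst: "is_struct L B" and Q0: "Q0 \<in> cols m" and q: "iso L q B (expand (G m) Q0)"
    using B by (auto simp: iso_class_def isomorphic_def)
  let ?N = "expand (G m) Q0"
  have qV: "iso V q (reduct B) (G m)" using iso_reduct[OF q] by simp
  have BV: "is_struct V (reduct B)" using Bst by (rule is_struct_reduct)
  have uB: "univ (reduct B) = univ B" by (simp add: reduct_def)
  have AsubB: "univ A \<subseteq> univ B" using AB by (simp add: closed_substructure_def substructure_def)
  define Y where "Y = q ` univ A"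
  define X where "X = univ A'"
  have bq: "bij_betw q (univ B) (U m)" using iso_bij[OF q] by simp
  have Y: "closed m Y"
    using cl_iso[OF qV BV formulas, of "univ A"] AB AsubB bq image_mono[OF AsubB, of q]
    by (simp add: closed_def Y_def closed_substructure_def uB bij_betw_def)
  have X: "closed n X"
    using A' by (simp add: closed_def X_def closed_substructure_def substructure_def)
  have h': "iso L h (str n Q X) (restr B (univ A))"
    using h A' AB iso_substructure_iff[of L A' ?M A B h] by (simp add: X_def closed_substructure_def)
  have q': "iso L q (restr B (univ A)) (str m Q0 Y)"
    unfolding Y_def using iso_restr_mono[of L q B "univ B" ?N "univ ?N" "univ A"] q AsubB
    by (simp only: restr_univ[OF Bst] restr_univ[OF is_struct_L[OF Q0]])
  have comp: "iso L (q \<circ> h) (str n Q X) (str m Q0 Y)" using h' q' by (rule iso_comp)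
  define p where "p = inv_into X (q \<circ> h)"
  have p: "iso L p (str m Q0 Y) (str n Q X)"
    using iso_inv[OF comp is_struct_str[OF Q X]] by (simp add: p_def)
  have "dim (c m) (U m) \<le> k"
    using sdim_iso[OF qV BV formulas] k by (simp add: sdim_def)
  then obtain W p' where W: "closed n W" and p': "iso L p' (str m Q0 (U m)) (str n Q W)"
    and ext: "\<forall>y \<in> Y. p' y = p y"
    using good_extend[OF good Q0 Y closed_U closedD(1)[OF Y] _ X p] by blast
  let ?g = "inv_into (univ B) q \<circ> inv_into (U m) p'"
  have strU: "str m Q0 (U m) = ?N" using restr_univ[OF is_struct_L[OF Q0]] by simp
  have bp': "bij_betw p' (U m) W" using iso_bij[OF p'] by simp
  have key: "q (h a) \<in> Y \<and> p' (q (h a)) = a \<and> h a \<in> univ B" if a: "a \<in> X" for a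
  proof -
    have bij: "bij_betw (q \<circ> h) X Y" using iso_bij[OF comp] by simp
    then have "(q \<circ> h) a \<in> Y" using a by (auto simp: bij_betw_def)
    moreover have "p ((q \<circ> h) a) = a" unfolding p_def using bij a by (intro inv_into_f_f) (auto simp: bij_betw_def)
    moreover have "h a \<in> univ A" using iso_bij[OF h] a by (auto simp: X_def bij_betw_def)
    ultimately show ?thesis using ext AsubB by auto
  qed
  have "closed_substructure L (c n) (str n Q W) ?M"
    using is_struct_str[OF Q W] closedD[OF W]
    by (auto simp: closed_substructure_def substructure_iff_restr restr_def tuples_def)
  moreover have "univ A' \<subseteq> univ (str n Q W)"
  proof
    fix a assume "a \<in> univ A'"
    then have "a \<in> X" by (simp add: X_def)
    then have "p' (q (h a)) = a" "q (h a) \<in> U m" using key closedD(1)[OF Y] by auto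
    then show "a \<in> univ (str n Q W)" using bij_betwE[OF bp'] by force
  qed
  moreover have "iso L ?g (str n Q W) B"
  proof (rule iso_comp)
    show "iso L (inv_into (U m) p') (str n Q W) ?N"
      using iso_inv[OF p' is_struct_str[OF Q0 closed_U]] unfolding strU by simp
    show "iso L (inv_into (univ B) q) ?N B" using iso_inv[OF q Bst] .
  qed
  moreover have "\<forall>a \<in> univ A'. ?g a = h a"
  proof
    fix a assume "a \<in> univ A'"
    then have a: "q (h a) \<in> Y" "p' (q (h a)) = a" "h a \<in> univ B" using key by (auto simp: X_def)
    have "inv_into (U m) p' (p' (q (h a))) = q (h a)"
      using bp' a(1) closedD(1)[OF Y] by (intro inv_into_f_f) (auto simp: bij_betw_def)
    moreover have "inv_into (univ B) q (q (h a)) = h a"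
      using bq a(3) by (intro inv_into_f_f) (auto simp: bij_betw_def)
    ultimately show "?g a = h a" using a(2) by simp
  qed
  ultimately show "\<exists>B' g. closed_substructure L (c n) B' ?M \<and> univ A' \<subseteq> univ B' \<and>
      iso L g B' B \<and> (\<forall>a \<in> univ A'. g a = h a)"
    by blast
qed

end

section \<open>The back-and-forth argument\<close>

fun quantifier_rank :: "('f, 'r) fm \<Rightarrow> nat" where
  "quantifier_rank (Neg \<phi>) = quantifier_rank \<phi>"
| "quantifier_rank (And \<phi> \<psi>) = max (quantifier_rank \<phi>) (quantifier_rank \<psi>)"
| "quantifier_rank (Exi i \<phi>) = Suc (quantifier_rank \<phi>)"
| "quantifier_rank _ = 0"

lemma eval_tm_restr [simp]: "eval_tm (restr M X) e = eval_tm M e"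
proof
  show "eval_tm (restr M X) e t = eval_tm M e t" for t
    by (induction t) (simp_all add: restr_def cong: map_cong)
qed

lemma mem_rint_restr: "xs \<in> rint (restr M X) R \<longleftrightarrow> xs \<in> rint M R \<and> set xs \<subseteq> X"
  by (simp add: restr_def)

context coloured_family
begin

lemma forth_step:
  assumes Q: "Q \<in> cols n" and good': "good k n' Q'" and X: "closed n X" and Y: "closed n' Y"
    and iso: "iso L p (str n Q X) (str n' Q' Y)" and d: "dim (c n) X + 1 \<le> k" and a: "a \<in> U n"
  obtains X' Y' p' where "closed n X'" "closed n' Y'" "iso L p' (str n Q X') (str n' Q' Y')"
    "X \<subseteq> X'" "\<forall>x \<in> X. p' x = p x" "a \<in> X'" "dim (c n) X' \<le> dim (c n) X + 1"
proof (cases "a \<in> X")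
  case True
  then show thesis using that[OF X Y iso] by auto
next
  case False
  then have "a \<in> U n - X" using a by simp
  then obtain W p' where W: "closed n' W" "iso L p' (str n Q (c n (insert a X))) (str n' Q' W)"
    "\<forall>x \<in> X. p' x = p x"
    using good'[unfolded good_def, rule_format, OF Q X _ d Y iso] by blast
  have sub: "insert a X \<subseteq> U n" using a closedD(1)[OF X] by auto
  show thesis
  proof (rule that[OF closed_cl[OF sub] W(1,2) _ W(3)])
    show "X \<subseteq> c n (insert a X)" "a \<in> c n (insert a X)"
      using cl_extensive[OF pg sub] by auto
    show "dim (c n) (c n (insert a X)) \<le> dim (c n) X + 1"
      using dim_cl_insert[OF pg finU closedD(1,2)[OF X] \<open>a \<in> U n - X\<close>] by simp
  qed
qed

lemma dim_iso_L:
  assumes "closed n X" "closed n' Y" "iso L p (str n Q X) (str n' Q' Y)"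
  shows "dim (c n') Y = dim (c n) X"
  using dim_iso[OF assms(1,2)] assms(3) by (auto simp: iso_expand_iff)

text \<open>The forth step for the inverse isomorphism, so that now goodness of \<open>Q\<close> is
  used; the result is inverted again.\<close>

lemma back_step:
  assumes Q: "Q \<in> cols n" and Q': "Q' \<in> cols n'" and good: "good k n Q"
    and X: "closed n X" and Y: "closed n' Y"
    and iso: "iso L p (str n Q X) (str n' Q' Y)" and d: "dim (c n) X + 1 \<le> k" and b: "b \<in> U n'"
  obtains X' Y' p' a where "closed n X'" "closed n' Y'" "iso L p' (str n Q X') (str n' Q' Y')"
    "X \<subseteq> X'" "\<forall>x \<in> X. p' x = p x" "a \<in> X'" "p' a = b" "dim (c n) X' \<le> dim (c n) X + 1"
proof -
  let ?q = "inv_into X p"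
  have q: "iso L ?q (str n' Q' Y) (str n Q X)"
    using iso_inv[OF iso is_struct_str[OF Q X]] by simp
  have dY: "dim (c n') Y = dim (c n) X" using dim_iso_L[OF X Y iso] .
  obtain Y' X' r where Y': "closed n' Y'" and X': "closed n X'"
    and r: "iso L r (str n' Q' Y') (str n Q X')" and YY: "Y \<subseteq> Y'" and rq: "\<forall>y \<in> Y. r y = ?q y"
    and b': "b \<in> Y'" and dY': "dim (c n') Y' \<le> dim (c n') Y + 1"
    by (rule forth_step[OF Q' good Y X q _ b]) (use d dY in auto)
  let ?p = "inv_into Y' r"
  have p: "iso L ?p (str n Q X') (str n' Q' Y')"
    using iso_inv[OF r is_struct_str[OF Q' Y']] by simp
  have bp: "bij_betw p X Y" and br: "bij_betw r Y' X'" using iso_bij[OF iso] iso_bij[OF r] by simp_all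
  have px: "p x \<in> Y' \<and> r (p x) = x" if "x \<in> X" for x
    using that bp rq YY by (auto simp: bij_betw_def)
  show thesis
  proof (rule that[OF X' Y' p])
    show "X \<subseteq> X'" using px br by (force simp: bij_betw_def)
    show "\<forall>x \<in> X. ?p x = p x"
      using px br by (metis bij_betw_def inv_into_f_f)
    show "r b \<in> X'" "?p (r b) = b" using b' br by (auto simp: bij_betw_def)
    show "dim (c n) X' \<le> dim (c n) X + 1"
      using dY' dY dim_iso_L[OF Y' X' r] by simp
  qed
qed

text \<open>Each quantifier costs at most one dimension, so the sum of the dimension reached and the
  remaining quantifier rank never exceeds \<open>k\<close>.\<close>

lemma sat_equivalent:
  assumes Q: "Q \<in> cols n" and Q': "Q' \<in> cols n'" and good: "good k n Q" and good': "good k n' Q'"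
  shows "closed n X \<Longrightarrow> closed n' Y \<Longrightarrow> iso L p (str n Q X) (str n' Q' Y) \<Longrightarrow>
    dim (c n) X + quantifier_rank \<phi> \<le> k \<Longrightarrow> wf_fm L \<phi> \<Longrightarrow>
    \<forall>i \<in> fv \<phi>. e i \<in> X \<and> e' i = p (e i) \<Longrightarrow>
    sat (expand (G n) Q) e \<phi> \<longleftrightarrow> sat (expand (G n') Q') e' \<phi>"
proof (induction \<phi> arbitrary: X Y p e e')
  case (Eq t u)
  \<comment> \<open>Closed pieces are closed under the functions, so terms do not leave
    \<open>X\<close> and atomic formulas are decided inside the pieces.\<close>
  have "sat (str n Q X) e (Eq t u) \<longleftrightarrow> sat (str n' Q' Y) e' (Eq t u)"
    using Eq.prems by (intro sat_iso[OF Eq.prems(3) is_struct_str[OF Q Eq.prems(1)]]) auto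
  then show ?case by simp
next
  case (Pred R ts)
  have A: "is_struct L (str n Q X)" using is_struct_str[OF Q Pred.prems(1)] .
  have ev: "eval_tm (expand (G n) Q) e t \<in> X \<and>
      eval_tm (expand (G n') Q') e' t = p (eval_tm (expand (G n) Q) e t)" if "t \<in> set ts" for t
    using eval_tm_iso[OF Pred.prems(3) A, of t e e'] Pred.prems(5,6) that by auto
  have pX: "p x \<in> Y" if "x \<in> X" for x
    using iso_bij[OF Pred.prems(3)] that by (auto simp: bij_betw_def)
  have "sat (str n Q X) e (Pred R ts) \<longleftrightarrow> sat (str n' Q' Y) e' (Pred R ts)"
    using Pred.prems by (intro sat_iso[OF Pred.prems(3) A]) auto
  moreover have "sat (str n Q X) e (Pred R ts) \<longleftrightarrow> sat (expand (G n) Q) e (Pred R ts)"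
    using ev by (auto simp: mem_rint_restr)
  moreover have "sat (str n' Q' Y) e' (Pred R ts) \<longleftrightarrow> sat (expand (G n') Q') e' (Pred R ts)"
    using ev pX by (auto simp: mem_rint_restr)
  ultimately show ?case by simp
next
  case (Neg \<phi>)
  have "sat (expand (G n) Q) e \<phi> \<longleftrightarrow> sat (expand (G n') Q') e' \<phi>"
    using Neg.prems by (intro Neg.IH) auto
  then show ?case by simp
next
  case (And \<phi> \<psi>)
  have "sat (expand (G n) Q) e \<phi> \<longleftrightarrow> sat (expand (G n') Q') e' \<phi>"
    using And.prems by (intro And.IH(1)) auto
  moreover have "sat (expand (G n) Q) e \<psi> \<longleftrightarrow> sat (expand (G n') Q') e' \<psi>"
    using And.prems by (intro And.IH(2)) auto
  ultimately show ?case by simp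
next
  case (Exi i \<phi>)
  note X = Exi.prems(1) and Y = Exi.prems(2) and iso = Exi.prems(3)
  have d: "dim (c n) X + 1 \<le> k" and d': "dim (c n) X + 1 + quantifier_rank \<phi> \<le> k"
    using Exi.prems(4) by auto
  have wf: "wf_fm L \<phi>" and env: "\<forall>j \<in> fv \<phi>. j \<noteq> i \<longrightarrow> e j \<in> X \<and> e' j = p (e j)"
    using Exi.prems(5,6) by auto
  show ?case
  proof
    assume "sat (expand (G n) Q) e (Exi i \<phi>)"
    then obtain a where a: "a \<in> U n" "sat (expand (G n) Q) (e(i := a)) \<phi>" by auto
    obtain X' Y' p' where *: "closed n X'" "closed n' Y'" "iso L p' (str n Q X') (str n' Q' Y')"
      and **: "X \<subseteq> X'" "\<forall>x \<in> X. p' x = p x" "a \<in> X'" "dim (c n) X' \<le> dim (c n) X + 1"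
      by (rule forth_step[OF Q good' X Y iso d a(1)])
    have "sat (expand (G n) Q) (e(i := a)) \<phi> \<longleftrightarrow> sat (expand (G n') Q') (e'(i := p' a)) \<phi>"
      using ** d' env by (intro Exi.IH[OF * _ wf]) auto
    moreover have "p' a \<in> U n'"
      using iso_bij[OF *(3)] **(3) closedD(1)[OF *(2)] by (auto simp: bij_betw_def)
    ultimately show "sat (expand (G n') Q') e' (Exi i \<phi>)" using a by auto
  next
    assume "sat (expand (G n') Q') e' (Exi i \<phi>)"
    then obtain b where b: "b \<in> U n'" "sat (expand (G n') Q') (e'(i := b)) \<phi>" by auto
    obtain X' Y' p' a where *: "closed n X'" "closed n' Y'" "iso L p' (str n Q X') (str n' Q' Y')"
      and **: "X \<subseteq> X'" "\<forall>x \<in> X. p' x = p x" "a \<in> X'" "p' a = b" "dim (c n) X' \<le> dim (c n) X + 1"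
      by (rule back_step[OF Q Q' good X Y iso d b(1)])
    have "sat (expand (G n) Q) (e(i := a)) \<phi> \<longleftrightarrow> sat (expand (G n') Q') (e'(i := b)) \<phi>"
      using ** d' env by (intro Exi.IH[OF * _ wf]) auto
    moreover have "a \<in> U n" using **(3) closedD(1)[OF *(1)] by auto
    ultimately show "sat (expand (G n) Q) e (Exi i \<phi>)" using b by auto
  qed
qed simp

text \<open>The starting position of the back-and-forth argument: both bases are isomorphic to
  \<open>G 0\<close>, and neither carries a colour or a relation because nothing happens in
  dimension zero.\<close>

lemma iso_cl_empty:
  assumes Q: "Q \<in> cols n" and Q': "Q' \<in> cols n'"
  shows "\<exists>p. iso L p (str n Q (c n {})) (str n' Q' (c n' {}))"
proof -
  have "\<exists>A. substructure V A (G m) \<and> univ A = c m {} \<and> isomorphic V A (G 0)" for m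
    using substructures by (simp add: closed_under_substructures_def)
  then have ex: "\<exists>p. iso V p (restr (G m) (c m {})) (G 0)" for m
    using iso_comp[OF restr_iso_substructure] unfolding isomorphic_def by metis
  obtain p q where p: "iso V p (restr (G n) (c n {})) (G 0)"
    and q: "iso V q (restr (G n') (c n' {})) (G 0)"
    using ex by blast
  have cl: "closed m (c m {})" for m by (rule closed_cl) simp
  have "iso V (inv_into (univ (restr (G n') (c n' {}))) q \<circ> p)
      (restr (G n) (c n {})) (restr (G n') (c n' {}))"
    using p iso_inv[OF q is_struct_restr_G[OF cl]] by (rule iso_comp)
  moreover have none: "(S, xs) \<notin> P" if "P \<in> cols m" "(S, xs) \<in> lt (c m {})" for P m S xs
  proof -
    have "dim (c m) (set xs) = 0"
      using that(2) closedD(1)[OF cl[of m]] dim_0_iff[OF pg, of "set xs" m]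
      by (auto simp: mem_ltuples)
    moreover have "dcut (c m) 0 P = {}" by (rule colouring.dcut_0_colouring[OF col that(1)])
    ultimately have "(S, xs) \<notin> dcut (c m) 0 P" "dim (c m) (set xs) = 0" by simp_all
    then show ?thesis by (simp add: dcut_def)
  qed
  moreover have "(S, map r xs) \<in> lt (c n' {})"
    if "(S, xs) \<in> lt (c n {})" "iso V r (restr (G n) (c n {})) (restr (G n') (c n' {}))" for S xs r
    using that iso_bij[OF that(2)] by (auto simp: mem_ltuples bij_betw_def)
  ultimately show ?thesis
    unfolding iso_expand_iff using none[OF Q] none[OF Q'] by blast
qed

text \<open>The starting position has dimension zero, so goodness up to the quantifier rank of the
  sentence suffices.\<close>

lemma models_equivalent:
  assumes "Q \<in> cols n" "Q' \<in> cols n'" "good (quantifier_rank \<phi>) n Q" "good (quantifier_rank \<phi>) n' Q'"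
    and \<phi>: "sentence L \<phi>" and M: "models (expand (G n) Q) \<phi>"
  shows "models (expand (G n') Q') \<phi>"
proof -
  have cl: "closed m (c m {})" for m by (rule closed_cl) simp
  have "dim (c n) (c n {}) = 0"
    using dim_0_iff[OF pg closedD(3)[OF cl] closedD(1)[OF cl]] by simp
  moreover obtain p where "iso L p (str n Q (c n {})) (str n' Q' (c n' {}))"
    using iso_cl_empty[OF assms(1,2)] by blast
  ultimately have "sat (expand (G n) Q) e \<phi> \<longleftrightarrow> sat (expand (G n') Q') e' \<phi>" for e e'
    using \<phi> by (intro sat_equivalent[OF assms(1-4) cl cl]) (auto simp: sentence_def)
  then show ?thesis using M unfolding models_def by blast
qed

section \<open>Limits\<close>

definition measure :: "nat \<Rightarrow> (('f, ('p, 'r) lsym, 'a) struct \<Rightarrow> bool) \<Rightarrow> real" where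
  "measure n P = dc_measure \<theta> Rs ar (expand (G n) ` cols n) {M \<in> expand (G n) ` cols n. P M}"

lemma measure_eq:
  "measure n P = real (card {w \<in> precol n. P (expand (G n) (prune s l (c n) w))}) / real (card (precol n))"
proof -
  have "{w \<in> precol n. expand (G n) (prune s l (c n) w) \<in> {M \<in> expand (G n) ` cols n. P M}} =
      {w \<in> precol n. P (expand (G n) (prune s l (c n) w))}"
    using prune_in_cols by blast
  then show ?thesis
    unfolding measure_def using dc_measure_expand[OF col, of "{M \<in> expand (G n) ` cols n. P M}" n s]
    by simp
qed

lemma measure_not: "measure n (\<lambda>M. \<not> P M) = 1 - measure n P"
proof -
  let ?e = "\<lambda>w. expand (G n) (prune s l (c n) w)"
  have "card {w \<in> precol n. P (?e w)} + card {w \<in> precol n. \<not> P (?e w)} =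
      card ({w \<in> precol n. P (?e w)} \<union> {w \<in> precol n. \<not> P (?e w)})"
    using finite_precol[of n] by (intro card_Un_disjoint[symmetric]) auto
  also have "{w \<in> precol n. P (?e w)} \<union> {w \<in> precol n. \<not> P (?e w)} = precol n" by auto
  finally have "real (card {w \<in> precol n. \<not> P (?e w)}) =
      real (card (precol n)) - real (card {w \<in> precol n. P (?e w)})"
    by linarith
  then show ?thesis
    using card_precol_pos[of n] by (simp add: measure_eq diff_divide_distrib)
qed

lemma measure_tendsto_1:
  assumes P: "\<And>n Q. Q \<in> cols n \<Longrightarrow> good k n Q \<Longrightarrow> P (expand (G n) Q)"
  shows "(\<lambda>n. measure n P) \<longlonglongrightarrow> 1"
proof -
  have "(\<lambda>n. measure n (\<lambda>M. \<not> P M)) \<longlonglongrightarrow> 0"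
  proof (rule tendsto_sandwich[OF _ _ tendsto_const good_tendsto[of k]])
    show "\<forall>\<^sub>F n in sequentially. 0 \<le> measure n (\<lambda>M. \<not> P M)"
      by (simp add: measure_eq)
    have "card {w \<in> precol n. \<not> P (expand (G n) (prune s l (c n) w))} \<le>
        card {w \<in> precol n. \<not> good k n (prune s l (c n) w)}" for n
    proof (rule card_mono)
      show "finite {w \<in> precol n. \<not> good k n (prune s l (c n) w)}" using finite_precol[of n] by simp
      show "{w \<in> precol n. \<not> P (expand (G n) (prune s l (c n) w))} \<subseteq>
          {w \<in> precol n. \<not> good k n (prune s l (c n) w)}"
        using P prune_in_cols by blast
    qed
    then show "\<forall>\<^sub>F n in sequentially. measure n (\<lambda>M. \<not> P M) \<le>
        real (card {w \<in> precol n. \<not> good k n (prune s l (c n) w)}) / real (card (precol n))"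
      by (simp add: measure_eq divide_right_mono)
  qed
  then have "(\<lambda>n. 1 - measure n (\<lambda>M. \<not> P M)) \<longlonglongrightarrow> 1 - 0"
    by (intro tendsto_diff tendsto_const)
  then show ?thesis by (simp add: measure_not)
qed

lemma extension_limit:
  "(\<lambda>n. measure n (k_extension_property L \<theta> (iso_class L (\<lambda>m. expand (G m) ` cols m)) k)) \<longlonglongrightarrow> 1"
  by (rule measure_tendsto_1) (rule k_extension_of_good)

text \<open>All good structures, over all \<open>n\<close>, agree on the sentence. Either one of
  them satisfies it and then all do, or all of them refute it; in both cases almost every structure
  follows.\<close>

lemma zero_one_law:
  assumes \<phi>: "sentence L \<phi>"
  shows "(\<lambda>n. measure n (\<lambda>M. models M \<phi>)) \<longlonglongrightarrow> 0 \<or> (\<lambda>n. measure n (\<lambda>M. models M \<phi>)) \<longlonglongrightarrow> 1"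
proof (cases "\<exists>n. \<exists>Q \<in> cols n. good (quantifier_rank \<phi>) n Q \<and> models (expand (G n) Q) \<phi>")
  case True
  then have "(\<lambda>n. measure n (\<lambda>M. models M \<phi>)) \<longlonglongrightarrow> 1"
    using models_equivalent[OF _ _ _ _ \<phi>] by (intro measure_tendsto_1) blast
  then show ?thesis ..
next
  case False
  then have "(\<lambda>n. measure n (\<lambda>M. \<not> models M \<phi>)) \<longlonglongrightarrow> 1"
    by (intro measure_tendsto_1) blast
  then have "(\<lambda>n. 1 - measure n (\<lambda>M. \<not> models M \<phi>)) \<longlonglongrightarrow> 1 - 1"
    by (intro tendsto_diff tendsto_const)
  then show ?thesis by (simp add: measure_not)
qed

lemma structures_eq:
  "{M. is_struct L M \<and> reduct M = G n \<and>
      (if s then strongly_coloured \<theta> l Rs M else coloured \<theta> l Rs M)} = expand (G n) ` cols n"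
proof (intro set_eqI iffI)
  fix M assume "M \<in> {M. is_struct L M \<and> reduct M = G n \<and>
      (if s then strongly_coloured \<theta> l Rs M else coloured \<theta> l Rs M)}"
  then have M: "is_struct L M" "reduct M = G n"
    and col: "if s then strongly_coloured \<theta> l Rs M else coloured \<theta> l Rs M" by auto
  obtain Q where Q: "Q \<subseteq> lt (univ M)" "M = expand (G n) Q"
    using expandE[OF M(1)] M(2) by metis
  then have QU: "Q \<subseteq> lt (U n)" by simp
  have "Q \<in> cols n"
    using col coloured_expand_iff[OF pg QU] QU unfolding Q(2) cols_iff precol_iff by (cases s) auto
  then show "M \<in> expand (G n) ` cols n" using Q(2) by blast
next
  fix M assume "M \<in> expand (G n) ` cols n"
  then obtain Q where Q: "Q \<in> cols n" "M = expand (G n) Q" by blast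
  have QU: "Q \<subseteq> lt (U n)" using cols_subset[OF Q(1)] .
  show "M \<in> {M. is_struct L M \<and> reduct M = G n \<and>
      (if s then strongly_coloured \<theta> l Rs M else coloured \<theta> l Rs M)}"
    using is_struct_L[OF Q(1)] coloured_expand_iff[OF pg QU] Q(1)
    unfolding Q(2) cols_iff precol_iff by (cases s) auto
qed

end

theorem theorem2p22:
  fixes V :: "('f, 'p) vocab"
    and \<theta> :: "nat \<Rightarrow> ('f, 'p) fm"
    and G :: "nat \<Rightarrow> ('f, 'p, 'a) struct"
    and l :: nat
    and Rs :: "'r set"
    and ar :: "'r \<Rightarrow> nat"
  defines "L \<equiv> full_vocab V l Rs ar"
    and "K \<equiv> Kset V \<theta> G l Rs ar"
    and "SK \<equiv> SKset V \<theta> G l Rs ar"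
  assumes "l \<ge> 2"
    and "finite Rs" and "Rs \<noteq> {}" and "\<forall>R \<in> Rs. ar R \<ge> 2"
    and "pregeometry_formulas V \<theta>"
    and "finite_pregeometries V \<theta> G"
    and "bounded_closures V \<theta> G"
    and "closures_agree V \<theta> G"
    and "closed_under_substructures V \<theta> G"
    and "characteristic_formulas V \<theta> G"
    and "\<forall>k. polynomially_saturated V \<theta> G k"
  shows
    "(\<forall>k.
       (\<lambda>n. dc_measure \<theta> Rs ar (K n)
              {M \<in> K n. k_extension_property L \<theta> (iso_class L K) k M}) \<longlonglongrightarrow> 1 \<and>
       (\<lambda>n. dc_measure \<theta> Rs ar (SK n)
              {M \<in> SK n. k_extension_property L \<theta> (iso_class L SK) k M}) \<longlonglongrightarrow> 1) \<and>
     (\<forall>\<phi>. sentence L \<phi> \<longrightarrow>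
       ((\<lambda>n. dc_measure \<theta> Rs ar (K n) {M \<in> K n. models M \<phi>}) \<longlonglongrightarrow> 0 \<or>
        (\<lambda>n. dc_measure \<theta> Rs ar (K n) {M \<in> K n. models M \<phi>}) \<longlonglongrightarrow> 1) \<and>
       ((\<lambda>n. dc_measure \<theta> Rs ar (SK n) {M \<in> SK n. models M \<phi>}) \<longlonglongrightarrow> 0 \<or>
        (\<lambda>n. dc_measure \<theta> Rs ar (SK n) {M \<in> SK n. models M \<phi>}) \<longlonglongrightarrow> 1))"
proof -
  interpret K: coloured_family V \<theta> G l Rs ar False
    using assms(4-12,14) by unfold_locales
  interpret SK: coloured_family V \<theta> G l Rs ar True
    using assms(4-12,14) by unfold_locales
  have K: "K = (\<lambda>m. expand (G m) ` K.cols m)"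
    unfolding K_def Kset_def using K.structures_eq by (intro ext) simp
  have SK: "SK = (\<lambda>m. expand (G m) ` SK.cols m)"
    unfolding SK_def SKset_def using SK.structures_eq by (intro ext) simp
  show ?thesis
    unfolding L_def K SK
    using K.extension_limit[unfolded K.measure_def] SK.extension_limit[unfolded SK.measure_def]
      K.zero_one_law[unfolded K.measure_def] SK.zero_one_law[unfolded SK.measure_def]
    by simp
qed

end
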